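(* Let $M$ be a smooth manifold of dimension $m\geq 2$, let $c\in\mathbb{R}$ with $c\neq 0,1$, and let $\varepsilon$ be a locally variational source form on $\mathbb{R}\times T^{2}M$ whose coefficients $\varepsilon_i$ (in every chart) are homogeneous of degree $c$. Then $\varepsilon$ is globally variational, and it admits a global Lagrangian given by $\lambda=h(\mu_0+\kappa)$, where $\mu_0$ and $\kappa$ are the $1$-forms on $\mathbb{R}\times TM$ given in every chart by $$\mu_0=-\left(A_i-\frac12\left(\frac{\partial A_i}{\partial\dot x^j}-\frac{\partial A_j}{\partial\dot x^i}\right)\dot x^j\right)t\,dx^i-B_{ij}\dot x^i t\,d\dot x^j,$$ $$\kappa=-\sum_{l=1}^m\left(\int_0^{\dot x^l}B_{jl}(x^p,0,\ldots,0,\nu,\dot x^{l+1},\ldots,\dot x^m)\,d\nu\right)dx^j,$$ with $\varepsilon_i=A_i+B_{ij}\ddot x^j$.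
   Context: Einstein summation over repeated indices is used; all functions and forms are smooth. $TM$ is the tangent bundle and $T^2M$ is the manifold of second-order velocities ($2$-jets at $0\in\mathbb{R}$ of curves in $M$). A chart $(V,\psi)$, $\psi=(x^i)$, on $M$ induces charts with coordinates $(x^i,\dot x^i)$ on $V^1\subset TM$ and $(x^i,\dot x^i,\ddot x^i)$ on $V^2\subset T^2M$, where $V^1$, $V^2$ are the preimages of $V$; together with the coordinate $t$ on $\mathbb{R}$ these give charts on $\mathbb{R}\times TM$ and $\mathbb{R}\times T^2M$. Objects on $TM$ are pulled back to $\mathbb{R}\times TM$ without change of notation. Put $\omega^i=dx^i-\dot x^i dt$. A source form on $\mathbb{R}\times T^2M$ is a $2$-form $\varepsilon$ with chart expression $\varepsilon=\varepsilon_i\,\omega^i\wedge dt$ in every chart; throughout, the coefficients $\varepsilon_i$ are functions on $V^2$, i.e. $\varepsilon_i=\varepsilon_i(x^j,\dot x^j,\ddot x^j)$ do not depend on $t$. A Lagrangian is a $1$-form $\lambda$ on an open subset of $\mathbb{R}\times T^2M$ of the form $\lambda=\mathscr{L}(t,x^i,\dot x^i,\ddot x^i)\,dt$; its Euler-Lagrange form is $E_\lambda=E_i(\mathscr{L})\,\omega^i\wedge dt$ with $E_i(\mathscr{L})=\frac{\partial\mathscr{L}}{\partial x^i}-\frac{d}{dt}\frac{\partial\mathscr{L}}{\partial\dot x^i}+\frac{d^2}{dt^2}\frac{\partial\mathscr{L}}{\partial\ddot x^i}$, where $d/dt$ is the total derivative. $\lambda$ is a Lagrangian for $\varepsilon$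 (and $\mathscr{L}$ a Lagrange function for $\varepsilon$) if $E_\lambda=\varepsilon$; it is a global Lagrangian if it is defined on all of $\mathbb{R}\times T^2M$. $\varepsilon$ is locally variational if in charts $(V,\psi)$ covering $M$ there is a Lagrange function $\mathscr{L}:\mathbb{R}\times V^2\to\mathbb{R}$ with $\varepsilon_i=E_i(\mathscr{L})$. $\varepsilon$ is globally variational if there is a Lagrange function for $\varepsilon$ defined on the whole of $\mathbb{R}\times TM$. For locally variational $\varepsilon$ one has in every chart $\varepsilon_i=A_i+B_{ij}\ddot x^j$, with $A_i$, $B_{ij}=B_{ji}$ functions of $(x^k,\dot x^k)$ on $V^1$. A function $F$ of $(x^i,\dot x^i,\ddot x^i)$ is homogeneous of degree $c$ if $\frac{\partial F}{\partial\dot x^i}\dot x^i+2\frac{\partial F}{\partial\ddot x^i}\ddot x^i=cF$. The horizontalization $h$ is the homomorphism from the exterior algebra of forms on $\mathbb{R}\times TM$ to that on $\mathbb{R}\times T^2M$ given by $h\,dt=dt$, $h\,dx^i=\dot x^i dt$, $h\,d\dot x^i=\ddot x^i dt$, and $hf=f\circ\pi^{2,1}$ for functions $f$, where $\pi^{2,1}:\mathbb{R}\times T^2M\to\mathbb{R}\times TM$ is the canonical projection. *)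

theory Defs
  imports "HOL-Analysis.Analysis"
begin

section \<open>Smooth functions and partial derivatives\<close>

(* k times continuously differentiable; only used on open sets *)
fun Ck_on :: "nat \<Rightarrow> 'a::euclidean_space set \<Rightarrow> ('a \<Rightarrow> 'b::real_normed_vector) \<Rightarrow> bool" where
  "Ck_on 0 S f \<longleftrightarrow> continuous_on S f"
| "Ck_on (Suc k) S f \<longleftrightarrow>
     (\<forall>x\<in>S. f differentiable (at x)) \<and> (\<forall>v. Ck_on k S (\<lambda>x. frechet_derivative f (at x) v))"

definition smooth_on :: "'a::euclidean_space set \<Rightarrow> ('a \<Rightarrow> 'b::real_normed_vector) \<Rightarrow> bool" where
  "smooth_on S f \<longleftrightarrow> (\<forall>k. Ck_on k S f)"

(* derivative of F at z in the direction b; partial derivatives arise from basis vectors b *)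
definition pd :: "('a::real_normed_vector \<Rightarrow> 'b::real_normed_vector) \<Rightarrow> 'a \<Rightarrow> 'a \<Rightarrow> 'b" where
  "pd F z b = frechet_derivative F (at z) b"

section \<open>Smooth manifolds\<close>

(* A chart (V, \<psi>); the values of \<psi> outside V are irrelevant. *)
type_synonym ('p, 'e) chart = "'p set \<times> ('p \<Rightarrow> 'e)"

definition chart_image :: "('p, 'e) chart \<Rightarrow> 'e set" where
  "chart_image c = snd c ` fst c"

definition chart_inv :: "('p, 'e) chart \<Rightarrow> 'e \<Rightarrow> 'p" where
  "chart_inv c = inv_into (fst c) (snd c)"

definition overlap :: "('p, 'e) chart \<Rightarrow> ('p, 'e) chart \<Rightarrow> 'e set" where
  "overlap c d = snd c ` (fst c \<inter> fst d)"

definition transition :: "('p, 'e) chart \<Rightarrow> ('p, 'e) chart \<Rightarrow> 'e \<Rightarrow> 'e" where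
  "transition c d = snd d \<circ> chart_inv c"

definition topological_chart :: "'p topology \<Rightarrow> ('p, 'e::euclidean_space) chart \<Rightarrow> bool" where
  "topological_chart X c \<longleftrightarrow> openin X (fst c) \<and> open (chart_image c) \<and>
     homeomorphic_map (subtopology X (fst c)) (top_of_set (chart_image c)) (snd c)"

definition smoothly_compatible :: "('p, 'e::euclidean_space) chart \<Rightarrow> ('p, 'e) chart \<Rightarrow> bool" where
  "smoothly_compatible c d \<longleftrightarrow>
     smooth_on (overlap c d) (transition c d) \<and> smooth_on (overlap d c) (transition d c)"

(* The atlas is the maximal one, so "c \<in> \<A>" means "c is a chart of the manifold". *)
definition smooth_manifold :: "'p topology \<Rightarrow> ('p, 'e::euclidean_space) chart set \<Rightarrow> bool" where
  "smooth_manifold X \<A> \<longleftrightarrow>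
     Hausdorff_space X \<and> second_countable X \<and>
     (\<forall>c\<in>\<A>. topological_chart X c) \<and>
     (\<Union>c\<in>\<A>. fst c) = topspace X \<and>
     (\<forall>c\<in>\<A>. \<forall>d\<in>\<A>. smoothly_compatible c d) \<and>
     (\<forall>c. topological_chart X c \<longrightarrow> (\<forall>d\<in>\<A>. smoothly_compatible c d) \<longrightarrow> c \<in> \<A>)"

section \<open>Velocities: jets at 0 of curves\<close>

(* Only the germ of \<gamma> at 0 matters. *)
definition smooth_curve :: "('p, 'e::euclidean_space) chart set \<Rightarrow> (real \<Rightarrow> 'p) \<Rightarrow> bool" where
  "smooth_curve \<A> \<gamma> \<longleftrightarrow> (\<exists>c\<in>\<A>. \<exists>\<delta>>0. \<gamma> ` {-\<delta><..<\<delta>} \<subseteq> fst c \<and> smooth_on {-\<delta><..<\<delta>} (snd c \<circ> \<gamma>))"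

(* the i-th derivative at 0 of the coordinate expression of \<gamma> *)
definition curve_coord :: "('p, 'e::euclidean_space) chart \<Rightarrow> nat \<Rightarrow> (real \<Rightarrow> 'p) \<Rightarrow> 'e" where
  "curve_coord c i \<gamma> = ((\<lambda>f s. vector_derivative f (at s)) ^^ i) (snd c \<circ> \<gamma>) 0"

type_synonym 'p jet = "(real \<Rightarrow> 'p) set"

definition jet :: "('p, 'e::euclidean_space) chart set \<Rightarrow> nat \<Rightarrow> (real \<Rightarrow> 'p) \<Rightarrow> 'p jet" where
  "jet \<A> k \<gamma> = {\<delta>. smooth_curve \<A> \<delta> \<and> \<delta> 0 = \<gamma> 0 \<and>
     (\<forall>c\<in>\<A>. \<gamma> 0 \<in> fst c \<longrightarrow> (\<forall>i\<le>k. curve_coord c i \<delta> = curve_coord c i \<gamma>))}"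

(* The preimage of V in the manifold of k-th order velocities; k = 1 gives the tangent bundle. *)
definition jets_over :: "('p, 'e::euclidean_space) chart set \<Rightarrow> nat \<Rightarrow> 'p set \<Rightarrow> 'p jet set" where
  "jets_over \<A> k V = {jet \<A> k \<gamma> |\<gamma>. smooth_curve \<A> \<gamma> \<and> \<gamma> 0 \<in> V}"

(* independent of the chosen representative as long as i does not exceed the order of the jet *)
definition jet_coord :: "('p, 'e::euclidean_space) chart \<Rightarrow> nat \<Rightarrow> 'p jet \<Rightarrow> 'e" where
  "jet_coord c i j = curve_coord c i (SOME \<gamma>. \<gamma> \<in> j)"

(* The charts on \<real> \<times> TM and \<real> \<times> T\<^sup>2M induced by a chart c of M, with coordinates
   (t, x, v) and (t, x, v, a); here v and a stand for the first and second derivatives of x. *)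
definition rt1 :: "('p, 'e::euclidean_space) chart set \<Rightarrow> ('p, 'e) chart \<Rightarrow>
    (real \<times> 'p jet, real \<times> 'e \<times> 'e) chart" where
  "rt1 \<A> c = (UNIV \<times> jets_over \<A> 1 (fst c), \<lambda>(t, j). (t, jet_coord c 0 j, jet_coord c 1 j))"

definition rt2 :: "('p, 'e::euclidean_space) chart set \<Rightarrow> ('p, 'e) chart \<Rightarrow>
    (real \<times> 'p jet, real \<times> 'e \<times> 'e \<times> 'e) chart" where
  "rt2 \<A> c = (UNIV \<times> jets_over \<A> 2 (fst c),
     \<lambda>(t, j). (t, jet_coord c 0 j, jet_coord c 1 j, jet_coord c 2 j))"

section \<open>Differential forms\<close>

(* A form on a manifold whose charts are the L c, for c in \<A>, is the family of its chart
   expressions, which have to be related by pullback along the transition maps.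
   Below, L is rt1 \<A> or rt2 \<A>. *)
definition form1 :: "(('p, 'e) chart \<Rightarrow> ('q, 'f::euclidean_space) chart) \<Rightarrow> ('p, 'e) chart set \<Rightarrow>
    (('p, 'e) chart \<Rightarrow> 'f \<Rightarrow> 'f \<Rightarrow> real) \<Rightarrow> bool" where
  "form1 L \<A> \<alpha> \<longleftrightarrow>
     (\<forall>c\<in>\<A>. (\<forall>z\<in>chart_image (L c). linear (\<alpha> c z)) \<and>
        (\<forall>X. smooth_on (chart_image (L c)) (\<lambda>z. \<alpha> c z X))) \<and>
     (\<forall>c\<in>\<A>. \<forall>d\<in>\<A>. \<forall>z\<in>overlap (L c) (L d). \<forall>X.
        \<alpha> c z X = \<alpha> d (transition (L c) (L d) z)
                    (frechet_derivative (transition (L c) (L d)) (at z) X))"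

definition form2 :: "(('p, 'e) chart \<Rightarrow> ('q, 'f::euclidean_space) chart) \<Rightarrow> ('p, 'e) chart set \<Rightarrow>
    (('p, 'e) chart \<Rightarrow> 'f \<Rightarrow> 'f \<Rightarrow> 'f \<Rightarrow> real) \<Rightarrow> bool" where
  "form2 L \<A> \<omega> \<longleftrightarrow>
     (\<forall>c\<in>\<A>. (\<forall>z\<in>chart_image (L c). bilinear (\<omega> c z) \<and> (\<forall>X. \<omega> c z X X = 0)) \<and>
        (\<forall>X Y. smooth_on (chart_image (L c)) (\<lambda>z. \<omega> c z X Y))) \<and>
     (\<forall>c\<in>\<A>. \<forall>d\<in>\<A>. \<forall>z\<in>overlap (L c) (L d). \<forall>X Y.
        \<omega> c z X Y = \<omega> d (transition (L c) (L d) z)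
                      (frechet_derivative (transition (L c) (L d)) (at z) X)
                      (frechet_derivative (transition (L c) (L d)) (at z) Y))"

definition wedge :: "('f \<Rightarrow> real) \<Rightarrow> ('f \<Rightarrow> real) \<Rightarrow> 'f \<Rightarrow> 'f \<Rightarrow> real" where
  "wedge \<alpha> \<beta> X Y = \<alpha> X * \<beta> Y - \<alpha> Y * \<beta> X"

type_synonym 'm rn = "real ^ 'm"

section \<open>Source forms\<close>

(* \<omega>\<^sup>i = dx\<^sup>i - v\<^sup>i dt *)
fun contact :: "'m::finite \<Rightarrow> real \<times> 'm rn \<times> 'm rn \<times> 'm rn \<Rightarrow>
    real \<times> 'm rn \<times> 'm rn \<times> 'm rn \<Rightarrow> real" where
  "contact i (t, x, v, a) (\<tau>, \<xi>, \<eta>, \<zeta>) = \<xi> $ i - v $ i * \<tau>"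

(* fst is the form dt. The components e c of \<epsilon> in the chart c do not depend on t; on the image
   of the chart they are determined by \<epsilon>. *)
definition source_form :: "('p, 'm::finite rn) chart set \<Rightarrow>
    (('p, 'm rn) chart \<Rightarrow> real \<times> 'm rn \<times> 'm rn \<times> 'm rn \<Rightarrow> real \<times> 'm rn \<times> 'm rn \<times> 'm rn \<Rightarrow>
       real \<times> 'm rn \<times> 'm rn \<times> 'm rn \<Rightarrow> real) \<Rightarrow>
    (('p, 'm rn) chart \<Rightarrow> 'm rn \<times> 'm rn \<times> 'm rn \<Rightarrow> 'm rn) \<Rightarrow> bool" where
  "source_form \<A> \<epsilon> e \<longleftrightarrow> form2 (rt2 \<A>) \<A> \<epsilon> \<and>
     (\<forall>c\<in>\<A>. \<forall>(t, x, v, a)\<in>chart_image (rt2 \<A> c). \<forall>X Y.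
        \<epsilon> c (t, x, v, a) X Y = (\<Sum>i\<in>UNIV. e c (x, v, a) $ i * wedge (contact i (t, x, v, a)) fst X Y))"

definition homogeneous_at :: "real \<Rightarrow> ('m::finite rn \<times> 'm rn \<times> 'm rn \<Rightarrow> real) \<Rightarrow>
    'm rn \<times> 'm rn \<times> 'm rn \<Rightarrow> bool" where
  "homogeneous_at k F = (\<lambda>(x, v, a).
     (\<Sum>i\<in>UNIV. pd F (x, v, a) (0, axis i 1, 0) * v $ i)
     + 2 * (\<Sum>i\<in>UNIV. pd F (x, v, a) (0, 0, axis i 1) * a $ i) = k * F (x, v, a))"

definition homogeneous_coeffs :: "('p, 'm::finite rn) chart set \<Rightarrow> real \<Rightarrow>
    (('p, 'm rn) chart \<Rightarrow> 'm rn \<times> 'm rn \<times> 'm rn \<Rightarrow> 'm rn) \<Rightarrow> bool" where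
  "homogeneous_coeffs \<A> k e \<longleftrightarrow>
     (\<forall>c\<in>\<A>. \<forall>(t, x, v, a)\<in>chart_image (rt2 \<A> c). \<forall>i. homogeneous_at k (\<lambda>w. e c w $ i) (x, v, a))"

section \<open>Euler-Lagrange expressions and variationality\<close>

(* total derivatives of functions of order 2 and 3; b and w are the third and fourth derivatives *)
fun td2 :: "(real \<times> 'm::finite rn \<times> 'm rn \<times> 'm rn \<Rightarrow> real) \<Rightarrow>
    real \<times> 'm rn \<times> 'm rn \<times> 'm rn \<times> 'm rn \<Rightarrow> real" where
  "td2 F (t, x, v, a, b) =
     pd F (t, x, v, a) (1, 0, 0, 0)
     + (\<Sum>j\<in>UNIV. pd F (t, x, v, a) (0, axis j 1, 0, 0) * v $ j)
     + (\<Sum>j\<in>UNIV. pd F (t, x, v, a) (0, 0, axis j 1, 0) * a $ j)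
     + (\<Sum>j\<in>UNIV. pd F (t, x, v, a) (0, 0, 0, axis j 1) * b $ j)"

fun td3 :: "(real \<times> 'm::finite rn \<times> 'm rn \<times> 'm rn \<times> 'm rn \<Rightarrow> real) \<Rightarrow>
    real \<times> 'm rn \<times> 'm rn \<times> 'm rn \<times> 'm rn \<times> 'm rn \<Rightarrow> real" where
  "td3 F (t, x, v, a, b, w) =
     pd F (t, x, v, a, b) (1, 0, 0, 0, 0)
     + (\<Sum>j\<in>UNIV. pd F (t, x, v, a, b) (0, axis j 1, 0, 0, 0) * v $ j)
     + (\<Sum>j\<in>UNIV. pd F (t, x, v, a, b) (0, 0, axis j 1, 0, 0) * a $ j)
     + (\<Sum>j\<in>UNIV. pd F (t, x, v, a, b) (0, 0, 0, axis j 1, 0) * b $ j)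
     + (\<Sum>j\<in>UNIV. pd F (t, x, v, a, b) (0, 0, 0, 0, axis j 1) * w $ j)"

fun euler_lagrange :: "'m::finite \<Rightarrow> (real \<times> 'm rn \<times> 'm rn \<times> 'm rn \<Rightarrow> real) \<Rightarrow>
    real \<times> 'm rn \<times> 'm rn \<times> 'm rn \<times> 'm rn \<times> 'm rn \<Rightarrow> real" where
  "euler_lagrange i L (t, x, v, a, b, w) =
     pd L (t, x, v, a) (0, axis i 1, 0, 0)
     - td2 (\<lambda>z. pd L z (0, 0, axis i 1, 0)) (t, x, v, a, b)
     + td3 (td2 (\<lambda>z. pd L z (0, 0, 0, axis i 1))) (t, x, v, a, b, w)"

(* L is the chart expression on \<real> \<times> V\<^sup>2 of a Lagrange function for the components f. As E\<^sub>i(L) is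
   in general of order 4, the components are compared after pulling f back to order 4. *)
definition lagrange_function :: "('p, 'm::finite rn) chart set \<Rightarrow> ('p, 'm rn) chart \<Rightarrow>
    ('m rn \<times> 'm rn \<times> 'm rn \<Rightarrow> 'm rn) \<Rightarrow> (real \<times> 'm rn \<times> 'm rn \<times> 'm rn \<Rightarrow> real) \<Rightarrow> bool" where
  "lagrange_function \<A> c f L \<longleftrightarrow> smooth_on (chart_image (rt2 \<A> c)) L \<and>
     (\<forall>(t, x, v, a)\<in>chart_image (rt2 \<A> c). \<forall>b w i.
        f (x, v, a) $ i = euler_lagrange i L (t, x, v, a, b, w))"

definition locally_variational :: "'p topology \<Rightarrow> ('p, 'm::finite rn) chart set \<Rightarrow>
    (('p, 'm rn) chart \<Rightarrow> 'm rn \<times> 'm rn \<times> 'm rn \<Rightarrow> 'm rn) \<Rightarrow> bool" where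
  "locally_variational X \<A> e \<longleftrightarrow>
     (\<exists>\<C>\<subseteq>\<A>. (\<Union>c\<in>\<C>. fst c) = topspace X \<and> (\<forall>c\<in>\<C>. \<exists>L. lagrange_function \<A> c (e c) L))"

(* The Lagrange function is a function on the points of \<real> \<times> TM. *)
definition globally_variational :: "('p, 'm::finite rn) chart set \<Rightarrow>
    (('p, 'm rn) chart \<Rightarrow> 'm rn \<times> 'm rn \<times> 'm rn \<Rightarrow> 'm rn) \<Rightarrow> bool" where
  "globally_variational \<A> e \<longleftrightarrow>
     (\<exists>L :: real \<times> 'p jet \<Rightarrow> real. \<forall>c\<in>\<A>.
        smooth_on (chart_image (rt1 \<A> c)) (L \<circ> chart_inv (rt1 \<A> c)) \<and>
        lagrange_function \<A> c (e c) (\<lambda>(t, x, v, a). L (chart_inv (rt1 \<A> c) (t, x, v))))"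

(* lam is a 1-form L dt on all of \<real> \<times> T\<^sup>2M with Euler-Lagrange form \<epsilon> = e\<^sub>i \<omega>\<^sup>i \<and> dt *)
definition global_lagrangian :: "('p, 'm::finite rn) chart set \<Rightarrow>
    (('p, 'm rn) chart \<Rightarrow> 'm rn \<times> 'm rn \<times> 'm rn \<Rightarrow> 'm rn) \<Rightarrow>
    (('p, 'm rn) chart \<Rightarrow> real \<times> 'm rn \<times> 'm rn \<times> 'm rn \<Rightarrow> real \<times> 'm rn \<times> 'm rn \<times> 'm rn \<Rightarrow> real) \<Rightarrow> bool"
  where
  "global_lagrangian \<A> e lam \<longleftrightarrow> form1 (rt2 \<A>) \<A> lam \<and>
     (\<exists>L. \<forall>c\<in>\<A>. (\<forall>z\<in>chart_image (rt2 \<A> c). \<forall>X. lam c z X = L c z * fst X) \<and>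
        lagrange_function \<A> c (e c) (L c))"

section \<open>Horizontalization and the global Lagrangian\<close>

(* the restriction to 1-forms of the homomorphism with dt \<mapsto> dt, dx\<^sup>i \<mapsto> v\<^sup>i dt, dv\<^sup>i \<mapsto> a\<^sup>i dt *)
fun hor :: "(('p, 'm::finite rn) chart \<Rightarrow> real \<times> 'm rn \<times> 'm rn \<Rightarrow> real \<times> 'm rn \<times> 'm rn \<Rightarrow> real) \<Rightarrow>
    ('p, 'm rn) chart \<Rightarrow> real \<times> 'm rn \<times> 'm rn \<times> 'm rn \<Rightarrow> real \<times> 'm rn \<times> 'm rn \<times> 'm rn \<Rightarrow> real" where
  "hor \<alpha> c (t, x, v, a) (\<tau>, \<xi>, \<eta>, \<zeta>) =
     \<alpha> c (t, x, v) (1, 0, 0) * \<tau>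
     + (\<Sum>i\<in>UNIV. \<alpha> c (t, x, v) (0, axis i 1, 0) * (v $ i * \<tau>))
     + (\<Sum>i\<in>UNIV. \<alpha> c (t, x, v) (0, 0, axis i 1) * (a $ i * \<tau>))"

(* e\<^sub>i = A\<^sub>i + B\<^sub>i\<^sub>j a\<^sup>j in every chart; this determines A and B on the images of the charts *)
definition affine_coeffs :: "('p, 'm::finite rn) chart set \<Rightarrow>
    (('p, 'm rn) chart \<Rightarrow> 'm rn \<times> 'm rn \<times> 'm rn \<Rightarrow> 'm rn) \<Rightarrow>
    (('p, 'm rn) chart \<Rightarrow> 'm rn \<times> 'm rn \<Rightarrow> 'm rn) \<Rightarrow>
    (('p, 'm rn) chart \<Rightarrow> 'm rn \<times> 'm rn \<Rightarrow> real ^ 'm ^ 'm) \<Rightarrow> bool" where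
  "affine_coeffs \<A> e A B \<longleftrightarrow>
     (\<forall>c\<in>\<A>. smooth_on (chart_image c \<times> UNIV) (A c) \<and> smooth_on (chart_image c \<times> UNIV) (B c) \<and>
       (\<forall>(t, x, v, a)\<in>chart_image (rt2 \<A> c). \<forall>i.
          e c (x, v, a) $ i = A c (x, v) $ i + (\<Sum>j\<in>UNIV. B c (x, v) $ i $ j * a $ j) \<and>
          (\<forall>j. B c (x, v) $ i $ j = B c (x, v) $ j $ i)))"

fun mu0 :: "(('p, 'm::finite rn) chart \<Rightarrow> 'm rn \<times> 'm rn \<Rightarrow> 'm rn) \<Rightarrow>
    (('p, 'm rn) chart \<Rightarrow> 'm rn \<times> 'm rn \<Rightarrow> real ^ 'm ^ 'm) \<Rightarrow>
    ('p, 'm rn) chart \<Rightarrow> real \<times> 'm rn \<times> 'm rn \<Rightarrow> real \<times> 'm rn \<times> 'm rn \<Rightarrow> real" where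
  "mu0 A B c (t, x, v) (\<tau>, \<xi>, \<eta>) =
     - (\<Sum>i\<in>UNIV. (A c (x, v) $ i
          - 1 / 2 * (\<Sum>j\<in>UNIV. (pd (\<lambda>w. A c w $ i) (x, v) (0, axis j 1)
                               - pd (\<lambda>w. A c w $ j) (x, v) (0, axis i 1)) * v $ j)) * t * \<xi> $ i)
     - (\<Sum>i\<in>UNIV. \<Sum>j\<in>UNIV. B c (x, v) $ i $ j * v $ i * t * \<eta> $ j)"

(* The integral is oriented: it changes sign if its endpoints are exchanged. The linear order on
   the index type fixes the numbering of the coordinates. *)
definition kappa :: "(('p, 'm rn) chart \<Rightarrow> 'm rn \<times> 'm rn \<Rightarrow> ((real, 'm) vec, 'm) vec) \<Rightarrow>
    ('p, 'm rn) chart \<Rightarrow> real \<times> 'm rn \<times> 'm rn \<Rightarrow> real \<times> 'm rn \<times> 'm::{finite,linorder} rn \<Rightarrow> real" where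
  "kappa B c = (\<lambda>(t, x, v) (\<tau>, \<xi>, \<eta>).
     - (\<Sum>j\<in>UNIV. (\<Sum>l\<in>UNIV.
          LBINT \<nu>=0..ereal (v $ l).
            B c (x, \<chi> p. if p < l then 0 else if p = l then \<nu> else v $ p) $ j $ l) * \<xi> $ j))"

end

theory Submission
  imports Defs
begin

text \<open>
  The theorem holds because homogeneity forces everything to be determined by one function on the
  tangent bundle, the quadratic contraction \<open>f = B\<^sub>i\<^sub>j v\<^sup>i v\<^sup>j\<close>. Put \<open>r = - 1 / (k (k - 1))\<close>.

  In a chart with a Lagrange function the components satisfy the Helmholtz conditions: \<open>B\<close> is
  symmetric, its fibre derivative is totally symmetric, and the symmetric and antisymmetric parts of
  \<open>\<partial>A\<^sub>i / \<partial>v\<^sup>j\<close> are controlled by base derivatives of \<open>B\<close> (lemma \<open>helmholtz_conditions\<close>).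
  Homogeneity says that \<open>A\<close> has degree \<open>k\<close> and \<open>B\<close> degree \<open>k - 2\<close> in the velocities. Hence
  \<open>\<partial>f / \<partial>v\<^sup>i = k B\<^sub>i\<^sub>j v\<^sup>j\<close>, and contracting the last Helmholtz condition twice with \<open>v\<close> expresses
  \<open>A\<close> by \<open>f\<close> as well; together, the source form is the Euler-Lagrange form of \<open>r f\<close>
  (lemma \<open>variational_homogeneous_chart\<close>).

  The function \<open>f\<close> can be read off from the components without derivatives, as
  \<open>(e(x, v, v) - e(x, v, 0)) \<bullet> v\<close>. The components form a covector, and the accelerations of two charts
  are related by an affine map, so this number is independent of the chart as soon as the components
  are affine in the acceleration in one of the two charts (lemma \<open>energy_invariant\<close>). Since the
  Euler-Lagrange expressions of first-order functions are natural under changes of coordinates,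
  the formula \<open>\<epsilon> = E(r f)\<close> passes from the charts of the given covering to all charts
  (lemma \<open>energy_form_transfer\<close>). So \<open>r f\<close> is a Lagrange function on the whole tangent bundle.

  The explicit forms become transparent: \<open>\<mu>\<^sub>0 = - (t / k) df\<close> and
  \<open>\<kappa> = r (\<partial>f / \<partial>v\<^sup>j) dx\<^sup>j\<close> (lemmas \<open>mu0_formula\<close> and \<open>kappa_formula\<close>). For \<open>\<kappa>\<close> the reason is that
  \<open>\<partial>f / \<partial>v\<^sup>j\<close> vanishes at \<open>v = 0\<close> and has fibre derivatives \<open>k (k - 1) B\<^sub>j\<^sub>l\<close>, so the integrals
  along the axis-parallel path telescope. In this shape both are manifestly \<open>1\<close>-forms, and the
  Lagrange function of \<open>h(\<mu>\<^sub>0 + \<kappa>)\<close> is \<open>- (t / k) df/dt + r k f\<close>, which differs from \<open>r f\<close> by the total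
  derivative of \<open>- t f / k\<close> and therefore has the same Euler-Lagrange form
  (lemma \<open>euler_lagrange_total\<close>).
\<close>


section \<open>Calculus of smooth functions\<close>

lemma has_derivative_cong_open:
  assumes "open S" "x \<in> S" "\<And>y. y \<in> S \<Longrightarrow> f y = g y"
  shows "(f has_derivative D) (at x) \<longleftrightarrow> (g has_derivative D) (at x)"
  using assms has_derivative_transform_within_open[of f D x UNIV S g]
    has_derivative_transform_within_open[of g D x UNIV S f] by auto

lemma frechet_derivative_cong_open:
  assumes "open S" "x \<in> S" "\<And>y. y \<in> S \<Longrightarrow> f y = g y"
  shows "frechet_derivative f (at x) = frechet_derivative g (at x)"
  unfolding frechet_derivative_def using has_derivative_cong_open[OF assms] by simp

lemma differentiable_cong_open:
  assumes "open S" "x \<in> S" "\<And>y. y \<in> S \<Longrightarrow> f y = g y"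
  shows "f differentiable at x \<longleftrightarrow> g differentiable at x"
  unfolding differentiable_def using has_derivative_cong_open[OF assms] by simp

lemma frechet_derivativeI:
  "f differentiable (at x) \<Longrightarrow> (f has_derivative frechet_derivative f (at x)) (at x)"
  by (simp add: frechet_derivative_works)

lemma pd_cong_open:
  assumes "open S" "x \<in> S" "\<And>y. y \<in> S \<Longrightarrow> f y = g y"
  shows "pd f x b = pd g x b"
  unfolding pd_def using frechet_derivative_cong_open[OF assms] by simp

lemma pd_eq: "(f has_derivative D) (at x) \<Longrightarrow> pd f x = D"
  unfolding pd_def using frechet_derivative_at by fastforce

lemma pd_works: "f differentiable at x \<Longrightarrow> (f has_derivative pd f x) (at x)"
proof -
  have "pd f x = frechet_derivative f (at x)" by (rule ext) (simp add: pd_def)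
  then show "f differentiable at x \<Longrightarrow> (f has_derivative pd f x) (at x)"
    by (simp add: frechet_derivative_works)
qed

lemma linear_pd: "f differentiable at x \<Longrightarrow> linear (pd f x)"
  using pd_works has_derivative_linear by blast

lemma Ck_on_cong:
  assumes "open S" "\<And>x. x \<in> S \<Longrightarrow> f x = g x" "Ck_on k S f"
  shows "Ck_on k S g"
  using assms(2,3)
proof (induction k arbitrary: f g)
  case 0
  then show ?case by (simp cong: continuous_on_cong)
next
  case (Suc k)
  have "Ck_on k S (\<lambda>x. frechet_derivative g (at x) v)" for v
    by (rule Suc.IH[of "\<lambda>x. frechet_derivative f (at x) v"])
      (use Suc.prems frechet_derivative_cong_open[OF assms(1), of _ f g] in auto)
  then show ?case using Suc.prems differentiable_cong_open[OF assms(1), of _ f g] by auto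
qed

lemma Ck_on_subset: "T \<subseteq> S \<Longrightarrow> Ck_on k S f \<Longrightarrow> Ck_on k T f"
  by (induction k arbitrary: f) (auto intro: continuous_on_subset)

lemma Ck_on_Suc_imp: "Ck_on (Suc k) S f \<Longrightarrow> Ck_on k S f"
proof (induction k arbitrary: f)
  case 0
  then show ?case
    by (auto intro!: continuous_at_imp_continuous_on differentiable_imp_continuous_within)
next
  case (Suc k)
  then show ?case by (metis Ck_on.simps(2))
qed

lemma Ck_on_const: "Ck_on k S (\<lambda>x. c)"
  by (induction k arbitrary: c) auto

lemma Ck_on_compose_linear:
  assumes "open S" "bounded_linear h" "Ck_on k S f"
  shows "Ck_on k S (\<lambda>x. h (f x))"
  using assms(3)
proof (induction k arbitrary: f)
  case 0
  then show ?case using bounded_linear.continuous_on[OF assms(2)] by simp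
next
  case (Suc k)
  have d: "((\<lambda>x. h (f x)) has_derivative (\<lambda>v. h (frechet_derivative f (at x) v))) (at x)" if "x \<in> S" for x
    by (rule bounded_linear.has_derivative[OF assms(2)]) (use Suc.prems that in \<open>auto intro!: frechet_derivativeI\<close>)
  have "Ck_on k S (\<lambda>x. frechet_derivative (\<lambda>x. h (f x)) (at x) v)" for v
    by (rule Ck_on_cong[OF assms(1), of "\<lambda>x. h (frechet_derivative f (at x) v)"])
      (use Suc frechet_derivative_at[OF d] in \<open>auto dest: fun_cong\<close>)
  then show ?case using d by (auto simp: differentiable_def)
qed

lemma Ck_on_linear: "bounded_linear h \<Longrightarrow> Ck_on k S h"
proof (induction k arbitrary: h)
  case 0
  then show ?case by (simp add: linear_continuous_on)
next
  case (Suc k)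
  then have "frechet_derivative h (at x) = h" for x
    by (metis bounded_linear_imp_has_derivative frechet_derivative_at)
  then show ?case using Suc by (auto simp: Ck_on_const bounded_linear_imp_differentiable)
qed

lemma Ck_on_add:
  assumes "open S" "Ck_on k S f" "Ck_on k S g"
  shows "Ck_on k S (\<lambda>x. f x + g x)"
  using assms(2,3)
proof (induction k arbitrary: f g)
  case 0
  then show ?case by (simp add: continuous_on_add)
next
  case (Suc k)
  have d: "((\<lambda>x. f x + g x) has_derivative
     (\<lambda>v. frechet_derivative f (at x) v + frechet_derivative g (at x) v)) (at x)" if "x \<in> S" for x
    by (rule has_derivative_add) (use Suc.prems that in \<open>auto intro!: frechet_derivativeI\<close>)
  have "Ck_on k S (\<lambda>x. frechet_derivative (\<lambda>x. f x + g x) (at x) v)" for v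
    by (rule Ck_on_cong[OF assms(1), of "\<lambda>x. frechet_derivative f (at x) v + frechet_derivative g (at x) v"])
      (use Suc frechet_derivative_at[OF d] in \<open>auto dest: fun_cong\<close>)
  then show ?case using d by (auto simp: differentiable_def)
qed

lemma Ck_on_bilinear:
  assumes "open S" "bounded_bilinear p" "Ck_on k S f" "Ck_on k S g"
  shows "Ck_on k S (\<lambda>x. p (f x) (g x))"
  using assms(3,4)
proof (induction k arbitrary: f g)
  case 0
  then show ?case using bounded_bilinear.continuous_on[OF assms(2)] by simp
next
  case (Suc k)
  have d: "((\<lambda>x. p (f x) (g x)) has_derivative
     (\<lambda>v. p (f x) (frechet_derivative g (at x) v) + p (frechet_derivative f (at x) v) (g x))) (at x)"
    if "x \<in> S" for x
    by (rule bounded_bilinear.FDERIV[OF assms(2)]) (use Suc.prems that in \<open>auto intro!: frechet_derivativeI\<close>)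
  have "Ck_on k S (\<lambda>x. frechet_derivative (\<lambda>x. p (f x) (g x)) (at x) v)" for v
  proof (rule Ck_on_cong[OF assms(1)])
    show "Ck_on k S (\<lambda>x. p (f x) (frechet_derivative g (at x) v) + p (frechet_derivative f (at x) v) (g x))"
      using Suc.prems Suc.prems[THEN Ck_on_Suc_imp] by (intro Ck_on_add[OF assms(1)] Suc.IH) auto
  qed (use frechet_derivative_at[OF d] in \<open>auto dest: fun_cong\<close>)
  then show ?case using d by (auto simp: differentiable_def)
qed

lemma Ck_on_sum:
  assumes "open S" "\<And>i. i \<in> I \<Longrightarrow> Ck_on k S (f i)"
  shows "Ck_on k S (\<lambda>x. \<Sum>i\<in>I. f i x)"
proof (cases "finite I")
  case True
  then show ?thesis using assms(2)
    by (induction I) (auto simp: Ck_on_const intro!: Ck_on_add[OF assms(1)])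
qed (simp add: Ck_on_const)

text \<open>By the chain rule and an expansion in a basis of the intermediate space, the derivative of the
  composition is a finite sum of products to which the induction hypothesis applies.\<close>

lemma Ck_on_compose:
  fixes f :: "'a::euclidean_space \<Rightarrow> 'b::euclidean_space" and g :: "'b \<Rightarrow> 'c::real_normed_vector"
  assumes "open S" "f ` S \<subseteq> T" "Ck_on k T g" "Ck_on k S f"
  shows "Ck_on k S (\<lambda>x. g (f x))"
  using assms(3,4)
proof (induction k arbitrary: g)
  case 0
  then show ?case using assms(2) continuous_on_compose2[of T g S f] by auto
next
  case (Suc k)
  have d: "((\<lambda>x. g (f x)) has_derivative
     (\<lambda>v. frechet_derivative g (at (f x)) (frechet_derivative f (at x) v))) (at x)" if "x \<in> S" for x
    using diff_chain_at[OF frechet_derivativeI frechet_derivativeI, of f x g] Suc.prems that assms(2)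
    by (auto simp: o_def)
  have e: "frechet_derivative g (at (f x)) w = (\<Sum>b\<in>Basis. (w \<bullet> b) *\<^sub>R frechet_derivative g (at (f x)) b)"
    if "x \<in> S" for x w
  proof -
    have l: "linear (frechet_derivative g (at (f x)))"
      using Suc.prems(1) that assms(2) linear_frechet_derivative by auto
    have "frechet_derivative g (at (f x)) w = frechet_derivative g (at (f x)) (\<Sum>b\<in>Basis. (w \<bullet> b) *\<^sub>R b)"
      by (simp add: euclidean_representation)
    then show ?thesis using l by (simp add: linear_sum linear_scale)
  qed
  have "Ck_on k S (\<lambda>x. frechet_derivative (\<lambda>x. g (f x)) (at x) v)" for v
  proof (rule Ck_on_cong[OF assms(1)])
    show "Ck_on k S (\<lambda>x. \<Sum>b\<in>Basis. (frechet_derivative f (at x) v \<bullet> b) *\<^sub>R frechet_derivative g (at (f x)) b)"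
    proof (intro Ck_on_sum[OF assms(1)] Ck_on_bilinear[OF assms(1) bounded_bilinear_scaleR] Suc.IH
        Ck_on_compose_linear[OF assms(1) bounded_linear_inner_left])
      show "Ck_on k S f" using Suc.prems(2) by (rule Ck_on_Suc_imp)
    qed (use Suc.prems in auto)
  next
    fix x assume "x \<in> S"
    then show "(\<Sum>b\<in>Basis. (frechet_derivative f (at x) v \<bullet> b) *\<^sub>R frechet_derivative g (at (f x)) b)
       = frechet_derivative (\<lambda>x. g (f x)) (at x) v"
      using frechet_derivative_at[OF d, of x] e[of x "frechet_derivative f (at x) v"] by metis
  qed
  then show ?case using d by (auto simp: differentiable_def)
qed

lemma smooth_on_differentiable: "smooth_on S f \<Longrightarrow> x \<in> S \<Longrightarrow> f differentiable at x"
  unfolding smooth_on_def by (metis Ck_on.simps(2))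

lemma smooth_on_pd: "smooth_on S f \<Longrightarrow> smooth_on S (\<lambda>x. pd f x b)"
  unfolding smooth_on_def pd_def by (metis Ck_on.simps(2))

lemma smooth_on_continuous: "smooth_on S f \<Longrightarrow> continuous_on S f"
  unfolding smooth_on_def by (metis Ck_on.simps(1))

lemma smooth_on_cong:
  assumes "open S" "\<And>x. x \<in> S \<Longrightarrow> f x = g x"
  shows "smooth_on S f \<longleftrightarrow> smooth_on S g"
  unfolding smooth_on_def using Ck_on_cong[OF assms(1), of f g] Ck_on_cong[OF assms(1), of g f] assms(2)
  by metis

lemma smooth_on_subset: "smooth_on S f \<Longrightarrow> T \<subseteq> S \<Longrightarrow> smooth_on T f"
  unfolding smooth_on_def using Ck_on_subset by blast

lemma smooth_on_compose:
  fixes f :: "'a::euclidean_space \<Rightarrow> 'b::euclidean_space"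
  assumes "open S" "smooth_on T g" "smooth_on S f" "f ` S \<subseteq> T"
  shows "smooth_on S (\<lambda>x. g (f x))"
  using assms unfolding smooth_on_def by (blast intro: Ck_on_compose)

lemma smooth_on_linear: "bounded_linear h \<Longrightarrow> smooth_on S h"
  unfolding smooth_on_def by (blast intro: Ck_on_linear)

lemma smooth_on_compose_linear:
  "bounded_linear h \<Longrightarrow> open S \<Longrightarrow> smooth_on S f \<Longrightarrow> smooth_on S (\<lambda>x. h (f x))"
  unfolding smooth_on_def by (blast intro: Ck_on_compose_linear)

named_theorems smooth_intros

lemma smooth_on_const [smooth_intros]: "smooth_on S (\<lambda>x. c)"
  unfolding smooth_on_def by (blast intro: Ck_on_const)

lemma smooth_on_ident [smooth_intros]: "smooth_on S (\<lambda>x. x)"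
  by (rule smooth_on_linear) (rule bounded_linear_ident)

lemma smooth_on_add [smooth_intros]:
  "open S \<Longrightarrow> smooth_on S f \<Longrightarrow> smooth_on S g \<Longrightarrow> smooth_on S (\<lambda>x. f x + g x)"
  unfolding smooth_on_def by (blast intro: Ck_on_add)

lemma smooth_on_uminus [smooth_intros]: "open S \<Longrightarrow> smooth_on S f \<Longrightarrow> smooth_on S (\<lambda>x. - f x)"
  by (rule smooth_on_compose_linear[OF bounded_linear_minus[OF bounded_linear_ident]])

lemma smooth_on_diff [smooth_intros]:
  "open S \<Longrightarrow> smooth_on S f \<Longrightarrow> smooth_on S g \<Longrightarrow> smooth_on S (\<lambda>x. f x - g x)"
  using smooth_on_add[OF _ _ smooth_on_uminus, of S f g] by simp

lemma smooth_on_scaleR [smooth_intros]: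
  "open S \<Longrightarrow> smooth_on S f \<Longrightarrow> smooth_on S g \<Longrightarrow> smooth_on S (\<lambda>x. f x *\<^sub>R g x)"
  unfolding smooth_on_def by (blast intro: Ck_on_bilinear[OF _ bounded_bilinear_scaleR])

lemma smooth_on_mult [smooth_intros]:
  fixes f g :: "'a::euclidean_space \<Rightarrow> real"
  shows "open S \<Longrightarrow> smooth_on S f \<Longrightarrow> smooth_on S g \<Longrightarrow> smooth_on S (\<lambda>x. f x * g x)"
  using smooth_on_scaleR[of S f g] by simp

lemma smooth_on_divide_const [smooth_intros]:
  fixes f :: "'a::euclidean_space \<Rightarrow> real"
  shows "open S \<Longrightarrow> smooth_on S f \<Longrightarrow> smooth_on S (\<lambda>x. f x / c)"
  using smooth_on_mult[OF _ _ smooth_on_const[of S "1 / c"]] by simp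

lemma smooth_on_sum [smooth_intros]:
  "open S \<Longrightarrow> (\<And>i. i \<in> I \<Longrightarrow> smooth_on S (f i)) \<Longrightarrow> smooth_on S (\<lambda>x. \<Sum>i\<in>I. f i x)"
  unfolding smooth_on_def by (blast intro: Ck_on_sum)

lemma smooth_on_fst [smooth_intros]: "open S \<Longrightarrow> smooth_on S f \<Longrightarrow> smooth_on S (\<lambda>x. fst (f x))"
  by (rule smooth_on_compose_linear[OF bounded_linear_fst])

lemma smooth_on_snd [smooth_intros]: "open S \<Longrightarrow> smooth_on S f \<Longrightarrow> smooth_on S (\<lambda>x. snd (f x))"
  by (rule smooth_on_compose_linear[OF bounded_linear_snd])

lemma smooth_on_nth [smooth_intros]: "open S \<Longrightarrow> smooth_on S f \<Longrightarrow> smooth_on S (\<lambda>x. f x $ i)"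
  by (rule smooth_on_compose_linear[OF bounded_linear_vec_nth])

lemma smooth_on_Pair [smooth_intros]:
  assumes "open S" "smooth_on S f" "smooth_on S g"
  shows "smooth_on S (\<lambda>x. (f x, g x))"
proof -
  have "smooth_on S (\<lambda>x. (f x, 0) + (0, g x))"
    by (intro smooth_on_add assms smooth_on_compose_linear[of "\<lambda>y. (y, 0)"] smooth_on_compose_linear[of "\<lambda>y. (0, y)"]
        bounded_linear_Pair bounded_linear_ident bounded_linear_zero)
  then show ?thesis by simp
qed

lemma smooth_on_vec_lambda [smooth_intros]:
  fixes f :: "'i::finite \<Rightarrow> 'a::euclidean_space \<Rightarrow> 'b::real_normed_vector"
  assumes "open S" "\<And>i. smooth_on S (f i)"
  shows "smooth_on S (\<lambda>x. \<chi> i. f i x)"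
proof -
  have b: "bounded_linear (axis j :: 'b \<Rightarrow> 'b ^ 'i)" for j
    by (rule bounded_linear_intro[where K = 1])
      (auto simp: axis_def vec_eq_iff norm_vec_def L2_set_def if_distrib[of norm] if_distrib[of "\<lambda>x. x ^ 2"] cong: if_cong)
  have "smooth_on S (\<lambda>x. \<Sum>i\<in>UNIV. axis i (f i x))"
    by (intro smooth_on_sum assms smooth_on_compose_linear[OF b])
  moreover have "(\<Sum>i\<in>UNIV. axis i (f i x)) = (\<chi> i. f i x)" for x
    by (simp add: vec_eq_iff axis_def if_distrib cong: if_cong)
  ultimately show ?thesis by simp
qed

lemma smooth_on_compose_UNIV:
  fixes f :: "'a::euclidean_space \<Rightarrow> 'b::euclidean_space"
  assumes "open S" "smooth_on T g" "smooth_on S f" "\<And>x. x \<in> S \<Longrightarrow> f x \<in> T"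
  shows "smooth_on S (\<lambda>x. g (f x))"
  using assms smooth_on_compose[of S T g f] by auto

text \<open>The mean value theorem, applied once in each of the two directions. Exchanging the roles of the
  directions leaves the second difference unchanged, which is what makes second derivatives symmetric.\<close>

lemma second_difference:
  fixes f :: "'a::euclidean_space \<Rightarrow> real"
  assumes f: "smooth_on S f" and "h > 0"
    and S: "\<And>s t. 0 \<le> s \<Longrightarrow> s \<le> h \<Longrightarrow> 0 \<le> t \<Longrightarrow> t \<le> h \<Longrightarrow> z + s *\<^sub>R u + t *\<^sub>R v \<in> S"
  shows "\<exists>s t. 0 \<le> s \<and> s \<le> h \<and> 0 \<le> t \<and> t \<le> h \<and>
    f (z + h *\<^sub>R u + h *\<^sub>R v) - f (z + h *\<^sub>R u) - f (z + h *\<^sub>R v) + f z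
      = h * h * pd (\<lambda>y. pd f y u) (z + s *\<^sub>R u + t *\<^sub>R v) v"
proof -
  have dline: "((\<lambda>s. g (p + s *\<^sub>R w)) has_real_derivative pd g (p + s *\<^sub>R w) w) (at s)"
    if "smooth_on S g" "p + s *\<^sub>R w \<in> S" for g :: "'a \<Rightarrow> real" and p w s
  proof -
    have d: "(g has_derivative pd g (p + s *\<^sub>R w)) (at (p + s *\<^sub>R w))"
      using that by (intro pd_works smooth_on_differentiable)
    have "((\<lambda>s. p + s *\<^sub>R w) has_derivative (\<lambda>h. h *\<^sub>R w)) (at s)"
      by (auto intro!: derivative_eq_intros)
    from diff_chain_at[OF this d] have "((\<lambda>s. g (p + s *\<^sub>R w)) has_derivative (\<lambda>h. pd g (p + s *\<^sub>R w) (h *\<^sub>R w))) (at s)"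
      by (simp add: o_def)
    moreover have "(\<lambda>h. pd g (p + s *\<^sub>R w) (h *\<^sub>R w)) = (*) (pd g (p + s *\<^sub>R w) w)"
      using has_derivative_linear[OF d] by (auto simp: linear_scale)
    ultimately show ?thesis by (simp add: has_field_derivative_def)
  qed
  have swap: "z + h *\<^sub>R v + s *\<^sub>R u = z + s *\<^sub>R u + h *\<^sub>R v" for s by (simp add: algebra_simps)
  \<comment> \<open>the increment in the direction of v, as a function of the u-parameter\<close>
  have "\<exists>s>0. s < h \<and> (f (z + h *\<^sub>R v + h *\<^sub>R u) - f (z + h *\<^sub>R u))
      - (f (z + h *\<^sub>R v + 0 *\<^sub>R u) - f (z + 0 *\<^sub>R u))
      = (h - 0) * (pd f (z + h *\<^sub>R v + s *\<^sub>R u) u - pd f (z + s *\<^sub>R u) u)"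
  proof (rule MVT2[OF \<open>h > 0\<close>])
    fix s assume s: "0 \<le> s" "s \<le> h"
    show "((\<lambda>s. f (z + h *\<^sub>R v + s *\<^sub>R u) - f (z + s *\<^sub>R u)) has_real_derivative
        pd f (z + h *\<^sub>R v + s *\<^sub>R u) u - pd f (z + s *\<^sub>R u) u) (at s)"
      using S[of s 0] S[of s h] s \<open>h > 0\<close> by (intro DERIV_diff dline f) (auto simp: swap)
  qed
  then obtain s where s: "0 < s" "s < h"
    and e1: "f (z + h *\<^sub>R u + h *\<^sub>R v) - f (z + h *\<^sub>R u) - f (z + h *\<^sub>R v) + f z
      = h * (pd f (z + s *\<^sub>R u + h *\<^sub>R v) u - pd f (z + s *\<^sub>R u) u)"
    by (auto simp: algebra_simps)
  have "\<exists>t>0. t < h \<and> pd f (z + s *\<^sub>R u + h *\<^sub>R v) u - pd f (z + s *\<^sub>R u + 0 *\<^sub>R v) u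
      = (h - 0) * pd (\<lambda>y. pd f y u) (z + s *\<^sub>R u + t *\<^sub>R v) v"
    by (rule MVT2[OF \<open>h > 0\<close>]) (use S s in \<open>auto intro!: dline smooth_on_pd f\<close>)
  then obtain t where "0 < t" "t < h" "pd f (z + s *\<^sub>R u + h *\<^sub>R v) u - pd f (z + s *\<^sub>R u) u
      = h * pd (\<lambda>y. pd f y u) (z + s *\<^sub>R u + t *\<^sub>R v) v"
    by auto
  then show ?thesis using s e1 by (intro exI[of _ s] exI[of _ t]) auto
qed

lemma pd_commute:
  fixes f :: "'a::euclidean_space \<Rightarrow> real"
  assumes "open S" and f: "smooth_on S f" and "z \<in> S"
  shows "pd (\<lambda>y. pd f y u) z v = pd (\<lambda>y. pd f y v) z u"
proof -
  define F where "F = (\<lambda>y. pd (\<lambda>y. pd f y u) y v)"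
  define G where "G = (\<lambda>y. pd (\<lambda>y. pd f y v) y u)"
  have "smooth_on S F" "smooth_on S G" unfolding F_def G_def by (intro smooth_on_pd f)+
  then have c: "isCont F z" "isCont G z"
    using smooth_on_continuous assms continuous_on_eq_continuous_at by blast+
  have "\<bar>F z - G z\<bar> \<le> 0 + \<epsilon>" if "\<epsilon> > 0" for \<epsilon>
  proof -
    obtain d1 where d1: "d1 > 0" "\<And>y. dist y z < d1 \<Longrightarrow> dist (F y) (F z) < \<epsilon> / 2"
      using c(1) \<open>\<epsilon> > 0\<close> unfolding continuous_at_eps_delta by (metis half_gt_zero)
    obtain d2 where d2: "d2 > 0" "\<And>y. dist y z < d2 \<Longrightarrow> dist (G y) (G z) < \<epsilon> / 2"
      using c(2) \<open>\<epsilon> > 0\<close> unfolding continuous_at_eps_delta by (metis half_gt_zero)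
    obtain d3 where d3: "d3 > 0" "ball z d3 \<subseteq> S" using assms open_contains_ball by blast
    define d where "d = min d1 (min d2 d3)"
    \<comment> \<open>so small that the parallelogram spanned by h u and h v stays within distance d of z\<close>
    define h where "h = d / (2 * (norm u + norm v + 1))"
    have "d > 0" using d1 d2 d3 by (simp add: d_def)
    then have "h > 0" unfolding h_def by (intro divide_pos_pos) (auto intro: add_nonneg_pos)
    have near: "dist (z + s *\<^sub>R u + t *\<^sub>R v) z < d" if "0 \<le> s" "s \<le> h" "0 \<le> t" "t \<le> h" for s t
    proof -
      have "dist (z + s *\<^sub>R u + t *\<^sub>R v) z = norm (s *\<^sub>R u + t *\<^sub>R v)"
        by (simp add: dist_norm algebra_simps)
      also have "\<dots> \<le> s * norm u + t * norm v"
        using norm_triangle_ineq[of "s *\<^sub>R u" "t *\<^sub>R v"] that by simp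
      also have "\<dots> \<le> h * norm u + h * norm v" using that by (intro add_mono mult_right_mono) auto
      also have "\<dots> \<le> h * (norm u + norm v + 1)" using \<open>h > 0\<close> by (simp add: algebra_simps)
      also have "\<dots> = d / 2"
        unfolding h_def using add_nonneg_pos[of "norm u + norm v" 1] by (simp add: field_simps)
      also have "\<dots> < d" using \<open>d > 0\<close> by simp
      finally show ?thesis .
    qed
    have inS: "z + s *\<^sub>R u + t *\<^sub>R v \<in> S" if "0 \<le> s" "s \<le> h" "0 \<le> t" "t \<le> h" for s t
      using near[OF that] d3(2) by (auto simp: d_def dist_commute)
    have inS': "z + s *\<^sub>R v + t *\<^sub>R u \<in> S" if "0 \<le> s" "s \<le> h" "0 \<le> t" "t \<le> h" for s t
      using inS[of t s] that by (simp add: algebra_simps)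
    obtain s t where st: "0 \<le> s" "s \<le> h" "0 \<le> t" "t \<le> h"
      and 1: "f (z + h *\<^sub>R u + h *\<^sub>R v) - f (z + h *\<^sub>R u) - f (z + h *\<^sub>R v) + f z = h * h * F (z + s *\<^sub>R u + t *\<^sub>R v)"
      using second_difference[OF f \<open>h > 0\<close> inS] unfolding F_def by blast
    obtain s' t' where st': "0 \<le> s'" "s' \<le> h" "0 \<le> t'" "t' \<le> h"
      and 2: "f (z + h *\<^sub>R v + h *\<^sub>R u) - f (z + h *\<^sub>R v) - f (z + h *\<^sub>R u) + f z = h * h * G (z + s' *\<^sub>R v + t' *\<^sub>R u)"
      using second_difference[OF f \<open>h > 0\<close> inS'] unfolding G_def by blast
    have "h * h * F (z + s *\<^sub>R u + t *\<^sub>R v) = h * h * G (z + t' *\<^sub>R u + s' *\<^sub>R v)"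
      using 1 2 by (simp add: algebra_simps)
    then have "F (z + s *\<^sub>R u + t *\<^sub>R v) = G (z + t' *\<^sub>R u + s' *\<^sub>R v)" using \<open>h > 0\<close> by simp
    moreover have "dist (F (z + s *\<^sub>R u + t *\<^sub>R v)) (F z) < \<epsilon> / 2"
      using near[OF st] by (intro d1) (simp add: d_def)
    moreover have "dist (G (z + t' *\<^sub>R u + s' *\<^sub>R v)) (G z) < \<epsilon> / 2"
      using near[of t' s'] st' by (intro d2) (simp add: d_def)
    ultimately show ?thesis by (simp add: dist_real_def abs_if split: if_splits)
  qed
  then have "\<bar>F z - G z\<bar> \<le> 0" using field_le_epsilon by blast
  then show ?thesis by (simp add: F_def G_def)
qed


section \<open>Velocities in charts\<close>

text \<open>The fibre component of the tangent map of \<open>\<phi>\<close>. Its own derivative in the direction \<open>(v, a)\<close> is the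
  acceleration of the image of a curve with velocity \<open>v\<close> and acceleration \<open>a\<close>; in this way no second
  derivative of a transition map has to be written out.\<close>

definition dlift :: "('a::real_normed_vector \<Rightarrow> 'b::real_normed_vector) \<Rightarrow> 'a \<times> 'a \<Rightarrow> 'b" where
  "dlift \<phi> = (\<lambda>(x, v). pd \<phi> x v)"

lemma dlift_simp [simp]: "dlift \<phi> (x, v) = pd \<phi> x v"
  by (simp add: dlift_def)

lemma pd_basis_expansion:
  fixes f :: "'a::euclidean_space \<Rightarrow> 'b::real_normed_vector"
  assumes "f differentiable at x"
  shows "pd f x v = (\<Sum>b\<in>Basis. (v \<bullet> b) *\<^sub>R pd f x b)"
proof -
  have "pd f x v = pd f x (\<Sum>b\<in>Basis. (v \<bullet> b) *\<^sub>R b)" by (simp add: euclidean_representation)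
  then show ?thesis using linear_pd[OF assms] by (simp add: linear_sum linear_scale)
qed

lemma smooth_on_inner_const [smooth_intros]:
  "open S \<Longrightarrow> smooth_on S f \<Longrightarrow> smooth_on S (\<lambda>x. f x \<bullet> b)"
  by (rule smooth_on_compose_linear[OF bounded_linear_inner_left])

lemma smooth_on_pd_compose:
  fixes \<phi> :: "'a::euclidean_space \<Rightarrow> 'b::real_normed_vector" and f g :: "'c::euclidean_space \<Rightarrow> 'a"
  assumes "open S" "smooth_on T \<phi>" "smooth_on S f" "smooth_on S g" "\<And>x. x \<in> S \<Longrightarrow> f x \<in> T"
  shows "smooth_on S (\<lambda>x. pd \<phi> (f x) (g x))"
proof -
  have "smooth_on S (\<lambda>x. \<Sum>b\<in>Basis. (g x \<bullet> b) *\<^sub>R pd \<phi> (f x) b)"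
    by (intro smooth_intros assms(1,4) smooth_on_compose_UNIV[OF assms(1) smooth_on_pd[OF assms(2)] assms(3,5)])
  moreover have "(\<Sum>b\<in>Basis. (g x \<bullet> b) *\<^sub>R pd \<phi> (f x) b) = pd \<phi> (f x) (g x)" if "x \<in> S" for x
    by (rule pd_basis_expansion[symmetric, OF smooth_on_differentiable[OF assms(2) assms(5)[OF that]]])
  ultimately show ?thesis
    using smooth_on_cong[OF assms(1), of "\<lambda>x. \<Sum>b\<in>Basis. (g x \<bullet> b) *\<^sub>R pd \<phi> (f x) b" "\<lambda>x. pd \<phi> (f x) (g x)"]
    by blast
qed

lemma smooth_on_dlift:
  assumes "open T" "smooth_on T \<phi>"
  shows "smooth_on (T \<times> UNIV) (dlift \<phi>)"
  unfolding dlift_def case_prod_beta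
  by (rule smooth_on_pd_compose[OF _ assms(2)]) (auto intro!: smooth_intros open_Times assms(1))

lemma vector_derivative_eq_pd:
  "x differentiable at s \<Longrightarrow> vector_derivative x (at s) = pd x s 1"
  by (simp add: pd_def frechet_derivative_eq_vector_derivative)

lemma vector_derivative_cong_open:
  assumes "open S" "s \<in> S" "\<And>y. y \<in> S \<Longrightarrow> f y = g y"
  shows "vector_derivative f (at s) = vector_derivative g (at s)"
  unfolding vector_derivative_def has_vector_derivative_def
  using has_derivative_cong_open[OF assms] by simp

lemma has_vector_derivative_pd:
  "x differentiable at s \<Longrightarrow> (x has_vector_derivative pd x s 1) (at s)"
  by (metis vector_derivative_works vector_derivative_eq_pd)

lemma has_vector_derivative_chain:
  assumes "(x has_vector_derivative x') (at s)" "\<phi> differentiable at (x s)"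
  shows "((\<lambda>s. \<phi> (x s)) has_vector_derivative pd \<phi> (x s) x') (at s)"
proof -
  have p: "(\<phi> has_derivative pd \<phi> (x s)) (at (x s))" by (rule pd_works[OF assms(2)])
  from diff_chain_at[OF assms(1)[unfolded has_vector_derivative_def] p]
  show ?thesis using has_derivative_linear[OF p]
    by (simp add: has_vector_derivative_def o_def linear_scale)
qed

lemma curve_coord_0: "curve_coord c 0 \<gamma> = snd c (\<gamma> 0)"
  by (simp add: curve_coord_def)

lemma curve_coord_1: "curve_coord c 1 \<gamma> = vector_derivative (snd c \<circ> \<gamma>) (at 0)"
  by (simp add: curve_coord_def)

lemma curve_coord_2:
  "curve_coord c 2 \<gamma> = vector_derivative (\<lambda>s. vector_derivative (snd c \<circ> \<gamma>) (at s)) (at 0)"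
  by (simp add: curve_coord_def numeral_2_eq_2)

text \<open>The charts on the spaces of velocities are described here in terms of curves: every coordinate
  vector is realized by a curve, and the coordinates of a jet in two charts are related by the chain
  rule. The topology and smooth structure of these spaces enter only through these facts.\<close>

locale manifold =
  fixes X :: "'p topology" and \<A> :: "('p, 'e::euclidean_space) chart set"
  assumes mfd: "smooth_manifold X \<A>"
begin

lemma topological_chart: "c \<in> \<A> \<Longrightarrow> topological_chart X c"
  using mfd by (simp add: smooth_manifold_def)

lemma open_chart_image: "c \<in> \<A> \<Longrightarrow> open (chart_image c)"
  using topological_chart by (auto simp: topological_chart_def)

lemma chart_homeo:
  assumes "c \<in> \<A>"
  shows "homeomorphic_map (subtopology X (fst c)) (top_of_set (chart_image c)) (snd c)"
    "topspace (subtopology X (fst c)) = fst c"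
  using topological_chart[OF assms] openin_subset[of X "fst c"]
  by (auto simp: topological_chart_def)

lemma chart_inj: "c \<in> \<A> \<Longrightarrow> inj_on (snd c) (fst c)"
  using homeomorphic_imp_injective_map[OF chart_homeo(1)] chart_homeo(2) by simp

lemma open_overlap:
  assumes "c \<in> \<A>" "d \<in> \<A>"
  shows "open (overlap c d)"
proof -
  have "openin (subtopology X (fst c)) (fst c \<inter> fst d)"
    using topological_chart[OF assms(2)] by (auto simp: topological_chart_def openin_subtopology_Int2)
  then have "openin (top_of_set (chart_image c)) (snd c ` (fst c \<inter> fst d))"
    using homeomorphic_imp_open_map[OF chart_homeo(1)[OF assms(1)]] unfolding open_map_def by blast
  then show ?thesis
    unfolding overlap_def using open_chart_image[OF assms(1)] openin_open_trans by blast
qed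

lemma chart_inv_image:
  assumes "x \<in> chart_image c"
  shows "chart_inv c x \<in> fst c" "snd c (chart_inv c x) = x"
  using assms unfolding chart_image_def chart_inv_def
  by (auto intro: inv_into_into f_inv_into_f)

lemma chart_inv_chart: "c \<in> \<A> \<Longrightarrow> p \<in> fst c \<Longrightarrow> chart_inv c (snd c p) = p"
  unfolding chart_inv_def using chart_inj by (simp add: inv_into_f_f)

lemma transition_at: "c \<in> \<A> \<Longrightarrow> p \<in> fst c \<Longrightarrow> transition c d (snd c p) = snd d p"
  unfolding transition_def by (simp add: chart_inv_chart)

lemma mem_overlap_iff:
  assumes "c \<in> \<A>" "p \<in> fst c"
  shows "snd c p \<in> overlap c d \<longleftrightarrow> p \<in> fst d"
  using chart_inj[OF assms(1)] assms(2) unfolding overlap_def by (auto dest: inj_onD)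

lemma overlap_subset: "overlap c d \<subseteq> chart_image c"
  unfolding overlap_def chart_image_def by auto

lemma transition_in_overlap:
  assumes "c \<in> \<A>" "x \<in> overlap c d"
  shows "transition c d x \<in> overlap d c"
  using assms(2) transition_at[OF assms(1), of _ d] unfolding overlap_def by auto

lemma smooth_transition: "c \<in> \<A> \<Longrightarrow> d \<in> \<A> \<Longrightarrow> smooth_on (overlap c d) (transition c d)"
  using mfd by (auto simp: smooth_manifold_def smoothly_compatible_def)

text \<open>A smooth curve is smooth in some chart near \<open>0\<close>; composing with the transition map, it is smooth
  in every chart around its starting point.\<close>

lemma curve_in_chart:
  assumes "smooth_curve \<A> \<gamma>" "c \<in> \<A>" "\<gamma> 0 \<in> fst c"
  shows "\<exists>\<delta>>0. \<gamma> ` {-\<delta><..<\<delta>} \<subseteq> fst c \<and> smooth_on {-\<delta><..<\<delta>} (snd c \<circ> \<gamma>)"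
proof -
  obtain b \<delta> where b: "b \<in> \<A>" "\<delta> > 0" "\<gamma> ` {-\<delta><..<\<delta>} \<subseteq> fst b" "smooth_on {-\<delta><..<\<delta>} (snd b \<circ> \<gamma>)"
    using assms(1) unfolding smooth_curve_def by blast
  have "\<gamma> 0 \<in> fst b" using b by auto
  then have "(snd b \<circ> \<gamma>) 0 \<in> overlap b c" using mem_overlap_iff b assms by auto
  moreover have "isCont (snd b \<circ> \<gamma>) 0"
    using smooth_on_continuous[OF b(4)] \<open>\<delta> > 0\<close>
    by (simp add: continuous_on_eq_continuous_at del: o_apply)
  ultimately have "\<forall>\<^sub>F s in at 0. (snd b \<circ> \<gamma>) s \<in> overlap b c"
    using topological_tendstoD[OF _ open_overlap[OF b(1) assms(2)]] unfolding isCont_def by blast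
  then obtain \<eta> where e: "\<eta> > 0" "\<And>s. s \<noteq> 0 \<Longrightarrow> \<bar>s\<bar> < \<eta> \<Longrightarrow> (snd b \<circ> \<gamma>) s \<in> overlap b c"
    unfolding eventually_at by (auto simp: dist_real_def)
  define \<theta> where "\<theta> = min \<delta> \<eta>"
  have \<theta>: "\<theta> > 0" "{-\<theta><..<\<theta>} \<subseteq> {-\<delta><..<\<delta>}" using e(1) b(2) by (auto simp: \<theta>_def)
  have o: "(snd b \<circ> \<gamma>) s \<in> overlap b c" if "s \<in> {-\<theta><..<\<theta>}" for s
    using that e(2)[of s] \<open>(snd b \<circ> \<gamma>) 0 \<in> overlap b c\<close> by (cases "s = 0") (auto simp: \<theta>_def)
  have m: "\<gamma> s \<in> fst b" if "s \<in> {-\<theta><..<\<theta>}" for s using that b(3) \<theta>(2) by blast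
  have "\<gamma> ` {-\<theta><..<\<theta>} \<subseteq> fst c"
  proof (rule image_subsetI)
    fix s assume "s \<in> {-\<theta><..<\<theta>}"
    then show "\<gamma> s \<in> fst c" using o[of s] m[of s] mem_overlap_iff[OF b(1), of "\<gamma> s" c] by simp
  qed
  moreover have "smooth_on {-\<theta><..<\<theta>} (\<lambda>s. transition b c ((snd b \<circ> \<gamma>) s))"
    by (rule smooth_on_compose_UNIV[OF _ smooth_transition[OF b(1) assms(2)] smooth_on_subset[OF b(4) \<theta>(2)] o]) auto
  then have "smooth_on {-\<theta><..<\<theta>} (snd c \<circ> \<gamma>)"
    using smooth_on_cong[of "{-\<theta><..<\<theta>}" "\<lambda>s. transition b c ((snd b \<circ> \<gamma>) s)" "snd c \<circ> \<gamma>"]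
      transition_at[OF b(1)] m by auto
  ultimately show ?thesis using \<theta>(1) by blast
qed

lemma curve_coord_transition:
  assumes "smooth_curve \<A> \<gamma>" "c \<in> \<A>" "d \<in> \<A>" "\<gamma> 0 \<in> fst c" "\<gamma> 0 \<in> fst d"
  defines "\<phi> \<equiv> transition c d"
  shows "curve_coord d 0 \<gamma> = \<phi> (curve_coord c 0 \<gamma>)"
    and "curve_coord d 1 \<gamma> = pd \<phi> (curve_coord c 0 \<gamma>) (curve_coord c 1 \<gamma>)"
    and "curve_coord d 2 \<gamma> = pd (dlift \<phi>) (curve_coord c 0 \<gamma>, curve_coord c 1 \<gamma>)
           (curve_coord c 1 \<gamma>, curve_coord c 2 \<gamma>)"
proof -
  show "curve_coord d 0 \<gamma> = \<phi> (curve_coord c 0 \<gamma>)"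
    using transition_at[OF assms(2,4)] by (simp add: curve_coord_0 \<phi>_def)
  obtain \<delta>1 where d1: "\<delta>1 > 0" "\<gamma> ` {-\<delta>1<..<\<delta>1} \<subseteq> fst c" "smooth_on {-\<delta>1<..<\<delta>1} (snd c \<circ> \<gamma>)"
    using curve_in_chart[OF assms(1,2,4)] by blast
  obtain \<delta>2 where d2: "\<delta>2 > 0" "\<gamma> ` {-\<delta>2<..<\<delta>2} \<subseteq> fst d"
    using curve_in_chart[OF assms(1,3,5)] by blast
  define I where "I = {- min \<delta>1 \<delta>2 <..< min \<delta>1 \<delta>2}"
  define x where "x = snd c \<circ> \<gamma>"
  have sub: "I \<subseteq> {-\<delta>1<..<\<delta>1}" "I \<subseteq> {-\<delta>2<..<\<delta>2}" by (auto simp: I_def)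
  have I: "open I" "0 \<in> I" "\<gamma> ` I \<subseteq> fst c" "\<gamma> ` I \<subseteq> fst d" "smooth_on I x"
    using d1(1) d2(1) image_mono[OF sub(1), of \<gamma>] image_mono[OF sub(2), of \<gamma>] d1(2) d2(2)
      smooth_on_subset[OF d1(3) sub(1)]
    by (auto simp: I_def x_def)
  have W: "x s \<in> overlap c d" if "s \<in> I" for s using that I(3,4) by (auto simp: x_def overlap_def)
  have sm: "smooth_on (overlap c d) \<phi>" unfolding \<phi>_def by (rule smooth_transition[OF assms(2,3)])
  have dx: "(x has_vector_derivative pd x s 1) (at s)" if "s \<in> I" for s
    by (rule has_vector_derivative_pd[OF smooth_on_differentiable[OF I(5) that]])
  have y1: "vector_derivative (snd d \<circ> \<gamma>) (at s) = pd \<phi> (x s) (pd x s 1)" if "s \<in> I" for s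
  proof -
    have "vector_derivative (snd d \<circ> \<gamma>) (at s) = vector_derivative (\<lambda>s. \<phi> (x s)) (at s)"
      by (rule vector_derivative_cong_open[OF I(1) that])
        (use I(3) transition_at[OF assms(2), of _ d] in \<open>auto simp: \<phi>_def x_def\<close>)
    also have "\<dots> = pd \<phi> (x s) (pd x s 1)"
      by (intro vector_derivative_at has_vector_derivative_chain dx that smooth_on_differentiable[OF sm W])
    finally show ?thesis .
  qed
  have c0: "curve_coord c 0 \<gamma> = x 0" by (simp add: curve_coord_0 x_def)
  have c1: "curve_coord c 1 \<gamma> = pd x 0 1"
    unfolding curve_coord_1 x_def[symmetric] using dx[OF I(2)] by (rule vector_derivative_at)
  have c2: "curve_coord c 2 \<gamma> = pd (\<lambda>s. pd x s 1) 0 1"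
  proof -
    have "curve_coord c 2 \<gamma> = vector_derivative (\<lambda>s. pd x s 1) (at 0)"
      unfolding curve_coord_2 x_def[symmetric]
      by (rule vector_derivative_cong_open[OF I(1,2)]) (rule vector_derivative_at[OF dx])
    also have "\<dots> = pd (\<lambda>s. pd x s 1) 0 1"
      by (rule vector_derivative_eq_pd[OF smooth_on_differentiable[OF smooth_on_pd[OF I(5)] I(2)]])
    finally show ?thesis .
  qed
  show "curve_coord d 1 \<gamma> = pd \<phi> (curve_coord c 0 \<gamma>) (curve_coord c 1 \<gamma>)"
    unfolding c0 c1 unfolding curve_coord_1 by (rule y1[OF I(2)])
  have "curve_coord d 2 \<gamma> = vector_derivative (\<lambda>s. dlift \<phi> (x s, pd x s 1)) (at 0)"
    unfolding curve_coord_2 by (rule vector_derivative_cong_open[OF I(1,2)]) (simp add: y1)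
  also have "\<dots> = pd (dlift \<phi>) (x 0, pd x 0 1) (pd x 0 1, pd (\<lambda>s. pd x s 1) 0 1)"
  proof (rule vector_derivative_at, rule has_vector_derivative_chain)
    show "((\<lambda>s. (x s, pd x s 1)) has_vector_derivative (pd x 0 1, pd (\<lambda>s. pd x s 1) 0 1)) (at 0)"
      by (intro has_vector_derivative_Pair dx I has_vector_derivative_pd
          smooth_on_differentiable[OF smooth_on_pd[OF I(5)] I(2)])
    show "dlift \<phi> differentiable at (x 0, pd x 0 1)"
      using smooth_on_differentiable[OF smooth_on_dlift[OF open_overlap[OF assms(2,3)] sm]] W[OF I(2)] by auto
  qed
  finally show "curve_coord d 2 \<gamma> = pd (dlift \<phi>) (curve_coord c 0 \<gamma>, curve_coord c 1 \<gamma>)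
           (curve_coord c 1 \<gamma>, curve_coord c 2 \<gamma>)"
    by (simp only: c0 c1 c2)
qed

text \<open>The curve is a quadratic polynomial in the given chart.\<close>

lemma curve_with_coords:
  assumes "c \<in> \<A>" "x \<in> chart_image c"
  shows "\<exists>\<gamma>. smooth_curve \<A> \<gamma> \<and> \<gamma> 0 \<in> fst c \<and>
    curve_coord c 0 \<gamma> = x \<and> curve_coord c 1 \<gamma> = v \<and> curve_coord c 2 \<gamma> = a"
proof -
  define p where "p = (\<lambda>s::real. x + s *\<^sub>R v + (s * s / 2) *\<^sub>R a)"
  define \<gamma> where "\<gamma> = (\<lambda>s. chart_inv c (p s))"
  have p1: "(p has_vector_derivative v + s *\<^sub>R a) (at s)" for s
    unfolding p_def by (auto intro!: derivative_eq_intros)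
  have p2: "((\<lambda>s::real. v + s *\<^sub>R a) has_vector_derivative a) (at s)" for s
    by (auto intro!: derivative_eq_intros)
  have "isCont p 0" using p1 has_vector_derivative_continuous by blast
  moreover have "p 0 \<in> chart_image c" using assms(2) by (simp add: p_def)
  ultimately have "\<forall>\<^sub>F s in at 0. p s \<in> chart_image c"
    using topological_tendstoD[OF _ open_chart_image[OF assms(1)]] unfolding isCont_def by blast
  then obtain \<delta> where "\<delta> > 0" "\<And>s. s \<noteq> 0 \<Longrightarrow> \<bar>s\<bar> < \<delta> \<Longrightarrow> p s \<in> chart_image c"
    unfolding eventually_at by (auto simp: dist_real_def)
  then have \<delta>: "\<delta> > 0" "p s \<in> chart_image c" if "s \<in> {-\<delta><..<\<delta>}" for s
    using \<open>p 0 \<in> chart_image c\<close> that by (cases "s = 0"; simp add: abs_less_iff)+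
  have eq: "(snd c \<circ> \<gamma>) s = p s" if "s \<in> {-\<delta><..<\<delta>}" for s
    using chart_inv_image(2)[OF \<delta>(2)[OF that]] by (simp add: \<gamma>_def)
  have "smooth_on {-\<delta><..<\<delta>} p"
    unfolding p_def by (intro smooth_intros) auto
  then have "smooth_on {-\<delta><..<\<delta>} (snd c \<circ> \<gamma>)"
    using smooth_on_cong[of "{-\<delta><..<\<delta>}" "snd c \<circ> \<gamma>" p] eq by auto
  moreover have im: "\<gamma> ` {-\<delta><..<\<delta>} \<subseteq> fst c" using chart_inv_image(1)[OF \<delta>(2)] by (auto simp: \<gamma>_def)
  ultimately have "smooth_curve \<A> \<gamma>" unfolding smooth_curve_def using assms(1) \<open>\<delta> > 0\<close> by blast
  moreover have "\<gamma> 0 \<in> fst c" using im \<open>\<delta> > 0\<close> by auto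
  moreover have "curve_coord c 0 \<gamma> = x" using eq[of 0] \<open>\<delta> > 0\<close> by (simp add: curve_coord_0 p_def)
  moreover have v: "vector_derivative (snd c \<circ> \<gamma>) (at s) = v + s *\<^sub>R a" if "s \<in> {-\<delta><..<\<delta>}" for s
    using vector_derivative_cong_open[OF open_greaterThanLessThan that, of "snd c \<circ> \<gamma>" p] eq
      vector_derivative_at[OF p1] by simp
  then have "curve_coord c 1 \<gamma> = v" using \<open>\<delta> > 0\<close> by (simp only: curve_coord_1) simp
  moreover have "curve_coord c 2 \<gamma> = a"
    unfolding curve_coord_2
    using vector_derivative_cong_open[of "{-\<delta><..<\<delta>}" 0 "\<lambda>s. vector_derivative (snd c \<circ> \<gamma>) (at s)" "\<lambda>s. v + s *\<^sub>R a"]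
      v vector_derivative_at[OF p2] \<open>\<delta> > 0\<close> by simp
  ultimately show ?thesis by blast
qed

lemma jet_self: "smooth_curve \<A> \<gamma> \<Longrightarrow> \<gamma> \<in> jet \<A> k \<gamma>"
  by (simp add: jet_def)

lemma jet_coord_jet:
  assumes "smooth_curve \<A> \<gamma>" "c \<in> \<A>" "\<gamma> 0 \<in> fst c" "i \<le> k"
  shows "jet_coord c i (jet \<A> k \<gamma>) = curve_coord c i \<gamma>"
proof -
  have "(SOME \<delta>. \<delta> \<in> jet \<A> k \<gamma>) \<in> jet \<A> k \<gamma>" 
    by (rule someI[of "\<lambda>\<delta>. \<delta> \<in> jet \<A> k \<gamma>"]) (rule jet_self[OF assms(1)])
  then show ?thesis unfolding jet_coord_def using assms by (simp add: jet_def)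
qed

text \<open>A jet determines its base point, because it consists of curves with the same starting point.\<close>

lemma jet_in_jets_over:
  assumes "smooth_curve \<A> \<gamma>"
  shows "jet \<A> k \<gamma> \<in> jets_over \<A> k V \<longleftrightarrow> \<gamma> 0 \<in> V"
proof
  assume "jet \<A> k \<gamma> \<in> jets_over \<A> k V"
  then obtain \<delta> where "\<delta> 0 \<in> V" "jet \<A> k \<gamma> = jet \<A> k \<delta>" by (auto simp: jets_over_def)
  then show "\<gamma> 0 \<in> V" using jet_self[OF assms, of k] by (auto simp: jet_def)
qed (use assms in \<open>auto simp: jets_over_def\<close>)

lemma rt1_coords:
  assumes "smooth_curve \<A> \<gamma>" "c \<in> \<A>" "\<gamma> 0 \<in> fst c"
  shows "snd (rt1 \<A> c) (t, jet \<A> 1 \<gamma>) = (t, curve_coord c 0 \<gamma>, curve_coord c 1 \<gamma>)"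
  using jet_coord_jet[OF assms] by (simp add: rt1_def)

lemma rt2_coords:
  assumes "smooth_curve \<A> \<gamma>" "c \<in> \<A>" "\<gamma> 0 \<in> fst c"
  shows "snd (rt2 \<A> c) (t, jet \<A> 2 \<gamma>) = (t, curve_coord c 0 \<gamma>, curve_coord c 1 \<gamma>, curve_coord c 2 \<gamma>)"
  using jet_coord_jet[OF assms] by (simp add: rt2_def)

lemma curve_over_overlap:
  assumes "c \<in> \<A>" "\<gamma> 0 \<in> fst c" "curve_coord c 0 \<gamma> \<in> overlap c d"
  shows "\<gamma> 0 \<in> fst d"
  using mem_overlap_iff[OF assms(1,2)] assms(3) by (simp add: curve_coord_0)

lemma overlap_rt1:
  assumes "c \<in> \<A>" "d \<in> \<A>"
  shows "overlap (rt1 \<A> c) (rt1 \<A> d) = UNIV \<times> overlap c d \<times> UNIV"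
proof (rule set_eqI, clarify)
  fix t x v
  show "(t, x, v) \<in> overlap (rt1 \<A> c) (rt1 \<A> d) \<longleftrightarrow> (t, x, v) \<in> UNIV \<times> overlap c d \<times> UNIV"
  proof
    assume "(t, x, v) \<in> overlap (rt1 \<A> c) (rt1 \<A> d)"
    then obtain \<gamma> s where g: "smooth_curve \<A> \<gamma>" "\<gamma> 0 \<in> fst c" "(t, x, v) = snd (rt1 \<A> c) (s, jet \<A> 1 \<gamma>)"
      "jet \<A> 1 \<gamma> \<in> jets_over \<A> 1 (fst d)"
      by (auto simp: overlap_def rt1_def jets_over_def[of _ _ "fst c"])
    then show "(t, x, v) \<in> UNIV \<times> overlap c d \<times> UNIV"
      using rt1_coords[of \<gamma> c s] assms jet_in_jets_over[OF g(1)] by (auto simp: curve_coord_0 overlap_def)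
  next
    assume "(t, x, v) \<in> UNIV \<times> overlap c d \<times> UNIV"
    then have x: "x \<in> overlap c d" by auto
    obtain \<gamma> where g: "smooth_curve \<A> \<gamma>" "\<gamma> 0 \<in> fst c" "curve_coord c 0 \<gamma> = x" "curve_coord c 1 \<gamma> = v"
      using curve_with_coords[OF assms(1) subsetD[OF overlap_subset x], of v] by blast
    then have "\<gamma> 0 \<in> fst d" using curve_over_overlap[OF assms(1)] x by auto
    then have "(t, jet \<A> 1 \<gamma>) \<in> fst (rt1 \<A> c) \<inter> fst (rt1 \<A> d)" using g by (auto simp: rt1_def jet_in_jets_over)
    moreover have "(t, x, v) = snd (rt1 \<A> c) (t, jet \<A> 1 \<gamma>)" using rt1_coords assms g by simp
    ultimately show "(t, x, v) \<in> overlap (rt1 \<A> c) (rt1 \<A> d)" unfolding overlap_def by blast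
  qed
qed

lemma overlap_rt2:
  assumes "c \<in> \<A>" "d \<in> \<A>"
  shows "overlap (rt2 \<A> c) (rt2 \<A> d) = UNIV \<times> overlap c d \<times> UNIV \<times> UNIV"
proof (rule set_eqI, clarify)
  fix t x v a
  show "(t, x, v, a) \<in> overlap (rt2 \<A> c) (rt2 \<A> d) \<longleftrightarrow> (t, x, v, a) \<in> UNIV \<times> overlap c d \<times> UNIV \<times> UNIV"
  proof
    assume "(t, x, v, a) \<in> overlap (rt2 \<A> c) (rt2 \<A> d)"
    then obtain \<gamma> s where g: "smooth_curve \<A> \<gamma>" "\<gamma> 0 \<in> fst c" "(t, x, v, a) = snd (rt2 \<A> c) (s, jet \<A> 2 \<gamma>)"
      "jet \<A> 2 \<gamma> \<in> jets_over \<A> 2 (fst d)"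
      by (auto simp: overlap_def rt2_def jets_over_def[of _ _ "fst c"])
    then show "(t, x, v, a) \<in> UNIV \<times> overlap c d \<times> UNIV \<times> UNIV"
      using rt2_coords[of \<gamma> c s] assms jet_in_jets_over[OF g(1)] by (auto simp: curve_coord_0 overlap_def)
  next
    assume "(t, x, v, a) \<in> UNIV \<times> overlap c d \<times> UNIV \<times> UNIV"
    then have x: "x \<in> overlap c d" by auto
    obtain \<gamma> where g: "smooth_curve \<A> \<gamma>" "\<gamma> 0 \<in> fst c" "curve_coord c 0 \<gamma> = x" "curve_coord c 1 \<gamma> = v"
        "curve_coord c 2 \<gamma> = a"
      using curve_with_coords[OF assms(1) subsetD[OF overlap_subset x], of v a] by blast
    then have "\<gamma> 0 \<in> fst d" using curve_over_overlap[OF assms(1)] x by auto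
    then have "(t, jet \<A> 2 \<gamma>) \<in> fst (rt2 \<A> c) \<inter> fst (rt2 \<A> d)" using g by (auto simp: rt2_def jet_in_jets_over)
    moreover have "(t, x, v, a) = snd (rt2 \<A> c) (t, jet \<A> 2 \<gamma>)" using rt2_coords assms g by simp
    ultimately show "(t, x, v, a) \<in> overlap (rt2 \<A> c) (rt2 \<A> d)" unfolding overlap_def by blast
  qed
qed

text \<open>The image of a chart is its overlap with itself, so the description of the overlaps covers it.\<close>

lemma chart_image_overlap: "chart_image c = overlap c c"
  by (simp add: chart_image_def overlap_def)

lemma chart_image_rt1: "c \<in> \<A> \<Longrightarrow> chart_image (rt1 \<A> c) = UNIV \<times> chart_image c \<times> UNIV"
  unfolding chart_image_overlap by (rule overlap_rt1)

lemma chart_image_rt2: "c \<in> \<A> \<Longrightarrow> chart_image (rt2 \<A> c) = UNIV \<times> chart_image c \<times> UNIV \<times> UNIV"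
  unfolding chart_image_overlap by (rule overlap_rt2)

lemma rt1_inv:
  assumes "c \<in> \<A>" "x \<in> chart_image c"
  obtains \<gamma> where "smooth_curve \<A> \<gamma>" "\<gamma> 0 \<in> fst c" "chart_inv (rt1 \<A> c) (t, x, v) = (t, jet \<A> 1 \<gamma>)"
    "curve_coord c 0 \<gamma> = x" "curve_coord c 1 \<gamma> = v"
proof -
  have z: "(t, x, v) \<in> chart_image (rt1 \<A> c)" using assms by (simp add: chart_image_rt1)
  have "chart_inv (rt1 \<A> c) (t, x, v) \<in> fst (rt1 \<A> c)"
    and e: "snd (rt1 \<A> c) (chart_inv (rt1 \<A> c) (t, x, v)) = (t, x, v)"
    using z unfolding chart_image_def chart_inv_def by (auto intro: inv_into_into f_inv_into_f)
  then obtain \<gamma> s where g: "smooth_curve \<A> \<gamma>" "\<gamma> 0 \<in> fst c" "chart_inv (rt1 \<A> c) (t, x, v) = (s, jet \<A> 1 \<gamma>)"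
    by (auto simp: rt1_def jets_over_def)
  then show ?thesis using that[of \<gamma>] e rt1_coords[OF g(1) assms(1) g(2)] by simp
qed

lemma rt2_inv:
  assumes "c \<in> \<A>" "x \<in> chart_image c"
  obtains \<gamma> where "smooth_curve \<A> \<gamma>" "\<gamma> 0 \<in> fst c" "chart_inv (rt2 \<A> c) (t, x, v, a) = (t, jet \<A> 2 \<gamma>)"
    "curve_coord c 0 \<gamma> = x" "curve_coord c 1 \<gamma> = v" "curve_coord c 2 \<gamma> = a"
proof -
  have z: "(t, x, v, a) \<in> chart_image (rt2 \<A> c)" using assms by (simp add: chart_image_rt2)
  have "chart_inv (rt2 \<A> c) (t, x, v, a) \<in> fst (rt2 \<A> c)"
    and e: "snd (rt2 \<A> c) (chart_inv (rt2 \<A> c) (t, x, v, a)) = (t, x, v, a)"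
    using z unfolding chart_image_def chart_inv_def by (auto intro: inv_into_into f_inv_into_f)
  then obtain \<gamma> s where g: "smooth_curve \<A> \<gamma>" "\<gamma> 0 \<in> fst c" "chart_inv (rt2 \<A> c) (t, x, v, a) = (s, jet \<A> 2 \<gamma>)"
    by (auto simp: rt2_def jets_over_def)
  then show ?thesis using that[of \<gamma>] e rt2_coords[OF g(1) assms(1) g(2)] by simp
qed

text \<open>The value of the inverse chart is the jet of some curve, and \<open>curve_coord_transition\<close> gives the
  coordinates of this curve in the other chart.\<close>

lemma transition_rt1:
  assumes "c \<in> \<A>" "d \<in> \<A>" "x \<in> overlap c d"
  shows "transition (rt1 \<A> c) (rt1 \<A> d) (t, x, v) = (t, transition c d x, pd (transition c d) x v)"
proof -
  obtain \<gamma> where g: "smooth_curve \<A> \<gamma>" "\<gamma> 0 \<in> fst c" "chart_inv (rt1 \<A> c) (t, x, v) = (t, jet \<A> 1 \<gamma>)"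
    "curve_coord c 0 \<gamma> = x" "curve_coord c 1 \<gamma> = v"
    by (rule rt1_inv[OF assms(1) subsetD[OF overlap_subset assms(3)]])
  then have d: "\<gamma> 0 \<in> fst d" using curve_over_overlap[OF assms(1)] assms(3) by auto
  note k = curve_coord_transition[OF g(1) assms(1,2) g(2) d, unfolded g(4-)]
  show ?thesis
    unfolding transition_def[of "rt1 \<A> c"] o_apply g(3) rt1_coords[OF g(1) assms(2) d] k ..
qed

lemma transition_rt2:
  assumes "c \<in> \<A>" "d \<in> \<A>" "x \<in> overlap c d"
  shows "transition (rt2 \<A> c) (rt2 \<A> d) (t, x, v, a)
    = (t, transition c d x, pd (transition c d) x v, pd (dlift (transition c d)) (x, v) (v, a))"
proof -
  obtain \<gamma> where g: "smooth_curve \<A> \<gamma>" "\<gamma> 0 \<in> fst c" "chart_inv (rt2 \<A> c) (t, x, v, a) = (t, jet \<A> 2 \<gamma>)"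
    "curve_coord c 0 \<gamma> = x" "curve_coord c 1 \<gamma> = v" "curve_coord c 2 \<gamma> = a"
    by (rule rt2_inv[OF assms(1) subsetD[OF overlap_subset assms(3)]])
  then have d: "\<gamma> 0 \<in> fst d" using curve_over_overlap[OF assms(1)] assms(3) by auto
  note k = curve_coord_transition[OF g(1) assms(1,2) g(2) d, unfolded g(4-)]
  show ?thesis
    unfolding transition_def[of "rt2 \<A> c"] o_apply g(3) rt2_coords[OF g(1) assms(2) d] k ..
qed

end


section \<open>Derivatives of directional derivatives\<close>

text \<open>The directional derivative is bilinear in the sense that it is smooth in the point and linear in the
  direction, so a product rule holds.\<close>

lemma has_derivative_dlift:
  fixes F :: "'a::euclidean_space \<Rightarrow> 'b::real_normed_vector"
  assumes "open T" "smooth_on T F" "x \<in> T"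
  shows "(dlift F has_derivative (\<lambda>h. pd (\<lambda>y. pd F y v) x (fst h) + pd F x (snd h))) (at (x, v))"
proof -
  have e: "(\<Sum>b\<in>Basis. (u \<bullet> b) *\<^sub>R pd F y b) = pd F y u" if "y \<in> T" for y u
    by (rule pd_basis_expansion[OF smooth_on_differentiable[OF assms(2) that], symmetric])
  have d: "((\<lambda>y. pd F y b) has_derivative pd (\<lambda>y. pd F y b) x) (at x)" for b
    by (rule pd_works[OF smooth_on_differentiable[OF smooth_on_pd[OF assms(2)] assms(3)]])
  have d': "((\<lambda>z. pd F (fst z) b) has_derivative (\<lambda>h. pd (\<lambda>y. pd F y b) x (fst h))) (at (x, v))" for b
    using diff_chain_at[of fst fst "(x, v)" "\<lambda>y. pd F y b", OF has_derivative_fst[OF has_derivative_ident]] d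
    by (simp add: o_def)
  have s: "pd (\<lambda>y. pd F y v) x \<xi> = (\<Sum>b\<in>Basis. (v \<bullet> b) *\<^sub>R pd (\<lambda>y. pd F y b) x \<xi>)" for \<xi>
  proof -
    have "pd (\<lambda>y. pd F y v) x \<xi> = pd (\<lambda>y. \<Sum>b\<in>Basis. (v \<bullet> b) *\<^sub>R pd F y b) x \<xi>"
      by (rule pd_cong_open[OF assms(1,3)]) (rule e[symmetric])
    also have "\<dots> = (\<Sum>b\<in>Basis. (v \<bullet> b) *\<^sub>R pd (\<lambda>y. pd F y b) x \<xi>)"
      by (rule fun_cong[OF pd_eq]) (intro has_derivative_sum has_derivative_scaleR_right d)
    finally show ?thesis .
  qed
  have "((\<lambda>z. \<Sum>b\<in>Basis. (snd z \<bullet> b) *\<^sub>R pd F (fst z) b) has_derivative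
      (\<lambda>h. \<Sum>b\<in>Basis. (snd (x, v) \<bullet> b) *\<^sub>R pd (\<lambda>y. pd F y b) x (fst h) + (snd h \<bullet> b) *\<^sub>R pd F (fst (x, v)) b)) (at (x, v))"
    by (intro has_derivative_sum has_derivative_scaleR d' has_derivative_inner_left has_derivative_snd has_derivative_ident)
  then have h: "((\<lambda>z. \<Sum>b\<in>Basis. (snd z \<bullet> b) *\<^sub>R pd F (fst z) b) has_derivative
      (\<lambda>h. pd (\<lambda>y. pd F y v) x (fst h) + pd F x (snd h))) (at (x, v))"
    by (simp add: sum.distrib s[symmetric] e[OF assms(3)])
  have c: "(\<Sum>b\<in>Basis. (snd z \<bullet> b) *\<^sub>R pd F (fst z) b) = dlift F z" if "z \<in> T \<times> UNIV" for z
    using that e[of "fst z" "snd z"] by (auto simp: dlift_def)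
  have "open (T \<times> (UNIV :: 'a set))" "(x, v) \<in> T \<times> UNIV" using assms by (auto intro: open_Times)
  from has_derivative_transform_within_open[OF h this c] show ?thesis .
qed

lemma pd_dlift:
  fixes F :: "'a::euclidean_space \<Rightarrow> 'b::real_normed_vector"
  assumes "open T" "smooth_on T F" "x \<in> T"
  shows "pd (dlift F) (x, v) (\<xi>, \<zeta>) = pd (\<lambda>y. pd F y v) x \<xi> + pd F x \<zeta>"
  using pd_eq[OF has_derivative_dlift[OF assms]] by simp

lemma has_derivative_pd_compose:
  fixes F :: "'a::euclidean_space \<Rightarrow> 'b::real_normed_vector"
  assumes "open T" "smooth_on T F" "f z \<in> T"
    and "(f has_derivative f') (at z)" "(g has_derivative g') (at z)"
  shows "((\<lambda>z. pd F (f z) (g z)) has_derivative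
    (\<lambda>h. pd (\<lambda>y. pd F y (g z)) (f z) (f' h) + pd F (f z) (g' h))) (at z)"
  using diff_chain_at[OF has_derivative_Pair[OF assms(4,5)] has_derivative_dlift[OF assms(1-3)]]
  by (simp add: o_def)

lemma has_derivative_compose_pd:
  assumes "smooth_on T F" "f z \<in> T" "(f has_derivative f') (at z)"
  shows "((\<lambda>z. F (f z)) has_derivative (\<lambda>h. pd F (f z) (f' h))) (at z)"
  using diff_chain_at[OF assms(3) pd_works[OF smooth_on_differentiable[OF assms(1,2)]]]
  by (simp add: o_def)

lemma vec_expansion: "(v :: real ^ 'm::finite) = (\<Sum>j\<in>UNIV. (v $ j) *\<^sub>R axis j 1)"
  by (simp add: vec_eq_iff axis_def if_distrib cong: if_cong)

lemma linear_vec_expansion: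
  fixes h :: "real ^ 'm::finite \<Rightarrow> 'b::real_vector"
  assumes "linear h"
  shows "h v = (\<Sum>j\<in>UNIV. (v $ j) *\<^sub>R h (axis j 1))"
  by (subst vec_expansion) (simp add: linear_sum[OF assms] linear_scale[OF assms])

lemma linear_vec_expansion_real:
  fixes h :: "real ^ 'm::finite \<Rightarrow> real"
  assumes "linear h"
  shows "(\<Sum>j\<in>UNIV. h (axis j 1) * v $ j) = h v"
  using linear_vec_expansion[OF assms, of v] by (simp add: mult.commute)

section \<open>Total derivatives as directional derivatives\<close>

text \<open>Coordinates on \<open>\<real>\<close> times the velocities of order \<open>1\<close>, \<open>2\<close> and \<open>3\<close>.\<close>

type_synonym 'm coords1 = "real \<times> 'm rn \<times> 'm rn"
type_synonym 'm coords2 = "real \<times> 'm rn \<times> 'm rn \<times> 'm rn"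
type_synonym 'm coords3 = "real \<times> 'm rn \<times> 'm rn \<times> 'm rn \<times> 'm rn"

text \<open>The total derivative is the derivative in the direction \<open>(1, v, a, b)\<close>; this replaces the sums of
  partial derivatives by one linear map.\<close>

lemma td2_eq:
  fixes F :: "'m::finite coords2 \<Rightarrow> real"
  assumes "F differentiable at (t, x, v, a)"
  shows "td2 F (t, x, v, a, b) = pd F (t, x, v, a) (1, v, a, b)"
proof -
  define D where "D = pd F (t, x, v, a)"
  have l: "linear D" unfolding D_def by (rule linear_pd[OF assms])
  have "linear (\<lambda>u. D (0, u, 0, 0))" "linear (\<lambda>u. D (0, 0, u, 0))" "linear (\<lambda>u. D (0, 0, 0, u))"
    by (rule linear_compose[OF _ l, unfolded o_def]; auto intro!: linearI)+
  then have "td2 F (t, x, v, a, b) = D (1, 0, 0, 0) + D (0, v, 0, 0) + D (0, 0, a, 0) + D (0, 0, 0, b)"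
    using linear_vec_expansion_real[of "\<lambda>u. D (0, u, 0, 0)"] linear_vec_expansion_real[of "\<lambda>u. D (0, 0, u, 0)"]
      linear_vec_expansion_real[of "\<lambda>u. D (0, 0, 0, u)"] by (simp add: D_def)
  then show ?thesis by (simp add: linear_add[OF l, symmetric] D_def[symmetric])
qed

lemma td3_eq:
  fixes F :: "'m::finite coords3 \<Rightarrow> real"
  assumes "F differentiable at (t, x, v, a, b)"
  shows "td3 F (t, x, v, a, b, w) = pd F (t, x, v, a, b) (1, v, a, b, w)"
proof -
  define D where "D = pd F (t, x, v, a, b)"
  have l: "linear D" unfolding D_def by (rule linear_pd[OF assms])
  have "linear (\<lambda>u. D (0, u, 0, 0, 0))" "linear (\<lambda>u. D (0, 0, u, 0, 0))"
    "linear (\<lambda>u. D (0, 0, 0, u, 0))" "linear (\<lambda>u. D (0, 0, 0, 0, u))"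
    by (rule linear_compose[OF _ l, unfolded o_def]; auto intro!: linearI)+
  then have "td3 F (t, x, v, a, b, w)
      = D (1, 0, 0, 0, 0) + D (0, v, 0, 0, 0) + D (0, 0, a, 0, 0) + D (0, 0, 0, b, 0) + D (0, 0, 0, 0, w)"
    using linear_vec_expansion_real[of "\<lambda>u. D (0, u, 0, 0, 0)"] linear_vec_expansion_real[of "\<lambda>u. D (0, 0, u, 0, 0)"]
      linear_vec_expansion_real[of "\<lambda>u. D (0, 0, 0, u, 0)"] linear_vec_expansion_real[of "\<lambda>u. D (0, 0, 0, 0, u)"]
    by (simp add: D_def)
  then show ?thesis by (simp add: linear_add[OF l, symmetric] D_def[symmetric])
qed

section \<open>Helmholtz conditions\<close>

text \<open>Derivative operators that return \<open>0\<close> outside the open set \<open>S\<close>. With this convention identities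
  between smooth functions on \<open>S\<close>, such as the commutation of derivatives, are equations between
  functions and can be rewritten under further derivatives.\<close>

definition dr :: "'a::euclidean_space set \<Rightarrow> 'a \<Rightarrow> ('a \<Rightarrow> real) \<Rightarrow> 'a \<Rightarrow> real" where
  "dr S b F = (\<lambda>z. if z \<in> S then pd F z b else 0)"

text \<open>The operator \<open>\<partial>/\<partial>t + v\<^sup>j \<partial>/\<partial>x\<^sup>j\<close>, the part of the total derivative without accelerations.\<close>

definition D0 :: "('m::finite coords1) set \<Rightarrow> ('m coords1 \<Rightarrow> real) \<Rightarrow> 'm coords1 \<Rightarrow> real" where
  "D0 S F = (\<lambda>z. if z \<in> S then pd F z (1, snd (snd z), 0) else 0)"

abbreviation eX :: "'m::finite \<Rightarrow> 'm coords1" where "eX i \<equiv> (0, axis i 1, 0)"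
abbreviation eV :: "'m::finite \<Rightarrow> 'm coords1" where "eV i \<equiv> (0, 0, axis i 1)"

lemma dr_in: "z \<in> S \<Longrightarrow> dr S b F z = pd F z b"
  by (simp add: dr_def)

lemma D0_in: "z \<in> S \<Longrightarrow> D0 S F z = pd F z (1, snd (snd z), 0)"
  by (simp add: D0_def)

lemma smooth_dr:
  assumes "open S" "smooth_on S F"
  shows "smooth_on S (dr S b F)"
  using smooth_on_pd[OF assms(2), of b] smooth_on_cong[OF assms(1), of "\<lambda>z. pd F z b" "dr S b F"]
  by (simp add: dr_in)

lemma smooth_D0:
  assumes "open S" "smooth_on S F"
  shows "smooth_on S (D0 S F)"
proof -
  have "smooth_on S (\<lambda>z. pd F z (1, snd (snd z), 0))"
    by (rule smooth_on_pd_compose[OF assms(1,2)]) (intro smooth_intros assms(1) | simp)+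
  then show ?thesis
    using smooth_on_cong[OF assms(1), of "\<lambda>z. pd F z (1, snd (snd z), 0)" "D0 S F"] by (simp add: D0_in)
qed

lemma pd_diff:
  assumes "F differentiable at z" "G differentiable at z"
  shows "pd (\<lambda>z. F z - G z) z b = pd F z b - pd G z b"
  using pd_eq[OF has_derivative_diff[OF pd_works[OF assms(1)] pd_works[OF assms(2)]]] by simp

lemma pd_add:
  assumes "F differentiable at z" "G differentiable at z"
  shows "pd (\<lambda>z. F z + G z) z b = pd F z b + pd G z b"
  using pd_eq[OF has_derivative_add[OF pd_works[OF assms(1)] pd_works[OF assms(2)]]] by simp

lemma dr_diff:
  assumes "smooth_on S F" "smooth_on S G"
  shows "dr S b (\<lambda>z. F z - G z) = (\<lambda>z. dr S b F z - dr S b G z)"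
  using assms by (auto simp: dr_def pd_diff smooth_on_differentiable)

lemma dr_add:
  assumes "smooth_on S F" "smooth_on S G"
  shows "dr S b (\<lambda>z. F z + G z) = (\<lambda>z. dr S b F z + dr S b G z)"
  using assms by (auto simp: dr_def pd_add smooth_on_differentiable)

lemma D0_diff:
  assumes "smooth_on S F" "smooth_on S G"
  shows "D0 S (\<lambda>z. F z - G z) = (\<lambda>z. D0 S F z - D0 S G z)"
  using assms by (auto simp: D0_def pd_diff smooth_on_differentiable)

lemma D0_add:
  assumes "smooth_on S F" "smooth_on S G"
  shows "D0 S (\<lambda>z. F z + G z) = (\<lambda>z. D0 S F z + D0 S G z)"
  using assms by (auto simp: D0_def pd_add smooth_on_differentiable)

lemma pd_cmult:
  fixes F :: "'a::euclidean_space \<Rightarrow> real"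
  assumes "F differentiable at z"
  shows "pd (\<lambda>z. c * F z) z b = c * pd F z b"
  using pd_eq[OF has_derivative_mult_right[OF pd_works[OF assms], of c]] by simp

lemma dr_cmult: "smooth_on S F \<Longrightarrow> dr S b (\<lambda>z. c * F z) = (\<lambda>z. c * dr S b F z)"
  by (auto simp: dr_def pd_cmult smooth_on_differentiable)

lemma D0_cmult: "smooth_on S F \<Longrightarrow> D0 S (\<lambda>z. c * F z) = (\<lambda>z. c * D0 S F z)"
  by (auto simp: D0_def pd_cmult smooth_on_differentiable)

lemma smooth_on_cmult:
  fixes F :: "'a::euclidean_space \<Rightarrow> real"
  shows "open S \<Longrightarrow> smooth_on S F \<Longrightarrow> smooth_on S (\<lambda>z. c * F z)"
  by (intro smooth_on_mult smooth_on_const)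

lemma dr_commute:
  assumes "open S" "smooth_on S F"
  shows "dr S b (dr S c F) = dr S c (dr S b F)"
proof
  fix z
  have "pd (dr S c F) z b = pd (\<lambda>y. pd F y c) z b" if "z \<in> S" for b c
    by (rule pd_cong_open[OF assms(1) that]) (simp add: dr_in)
  then show "dr S b (dr S c F) z = dr S c (dr S b F) z"
    using pd_commute[OF assms, of z] by (auto simp: dr_def)
qed

text \<open>The coefficients \<open>v\<^sup>j\<close> of the operator are not constant along the fibres; differentiating them gives
  the second summand.\<close>

lemma dr_D0:
  assumes "open S" "smooth_on S F"
  shows "dr S b (D0 S F) = (\<lambda>z. D0 S (dr S b F) z + dr S (0, snd (snd b), 0) F z)"
proof
  fix z
  show "dr S b (D0 S F) z = D0 S (dr S b F) z + dr S (0, snd (snd b), 0) F z"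
  proof (cases "z \<in> S")
    case True
    have "pd (D0 S F) z b = pd (\<lambda>z. pd F z (1, snd (snd z), 0)) z b"
      by (rule pd_cong_open[OF assms(1) True]) (simp add: D0_in)
    also have "\<dots> = pd (\<lambda>y. pd F y (1, snd (snd z), 0)) z b + pd F z (0, snd (snd b), 0)"
    proof (rule fun_cong[OF pd_eq, THEN trans])
      show "((\<lambda>z. pd F z (1, snd (snd z), 0)) has_derivative
         (\<lambda>h. pd (\<lambda>y. pd F y (1, snd (snd z), 0)) z h + pd F z (0, snd (snd h), 0))) (at z)"
        by (rule has_derivative_pd_compose[OF assms, of "\<lambda>z. z", OF True])
          (auto intro!: derivative_eq_intros)
    qed simp
    also have "pd (\<lambda>y. pd F y (1, snd (snd z), 0)) z b = pd (\<lambda>y. pd F y b) z (1, snd (snd z), 0)"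
      by (rule pd_commute[OF assms True])
    also have "\<dots> = pd (dr S b F) z (1, snd (snd z), 0)"
      by (rule pd_cong_open[OF assms(1) True]) (simp add: dr_in)
    finally show ?thesis using True by (simp add: dr_in D0_in)
  qed (simp add: dr_def D0_def)
qed

lemma dr_eX_D0:
  assumes "open S" "smooth_on S F"
  shows "dr S (eX i) (D0 S F) = D0 S (dr S (eX i) F)"
proof -
  have "dr S (0, 0, 0) F = (\<lambda>z. 0)"
    using linear_0[OF linear_pd[OF smooth_on_differentiable[OF assms(2)]]] by (auto simp: dr_def zero_prod_def)
  then show ?thesis using dr_D0[OF assms, of "eX i"] by simp
qed

lemma dr_eV_D0:
  assumes "open S" "smooth_on S F"
  shows "dr S (eV i) (D0 S F) = (\<lambda>z. D0 S (dr S (eV i) F) z + dr S (eX i) F z)"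
  using dr_D0[OF assms, of "eV i"] by simp

text \<open>For a Lagrange function \<open>P + Q\<^sub>j a\<^sup>j\<close> whose coefficients \<open>Q\<close> have no fibre curl, the Euler-Lagrange
  expressions are \<open>A\<^sub>i + B\<^sub>i\<^sub>j a\<^sup>j\<close> with the \<open>A\<close> and \<open>B\<close> below; \<open>R\<^sub>i\<close> is the momentum
  \<open>\<partial>L/\<partial>v\<^sup>i - d/dt \<partial>L/\<partial>a\<^sup>i\<close>. The Helmholtz conditions are then consequences of
  the commutation rules alone: base derivatives are moved inside fibre derivatives, the operator
  \<open>D0\<close> outside both, and indices are sorted.\<close>

context
  fixes S :: "('m::finite coords1) set" and P :: "'m coords1 \<Rightarrow> real"
    and Q :: "'m \<Rightarrow> 'm coords1 \<Rightarrow> real"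
    and R A :: "'m \<Rightarrow> 'm coords1 \<Rightarrow> real" and B :: "'m \<Rightarrow> 'm \<Rightarrow> 'm coords1 \<Rightarrow> real"
  assumes S: "open S" and P: "smooth_on S P" and Q: "\<And>i. smooth_on S (Q i)"
    and curl: "\<And>i j. dr S (eV i) (Q j) = dr S (eV j) (Q i)"
    and R_def: "R = (\<lambda>i z. dr S (eV i) P z - D0 S (Q i) z)"
    and A_def: "A = (\<lambda>i z. dr S (eX i) P z - D0 S (R i) z)"
    and B_def: "B = (\<lambda>i j z. dr S (eX i) (Q j) z - dr S (eV j) (R i) z)"
begin

lemmas helmholtz_simps = R_def A_def B_def P Q smooth_dr[OF S] smooth_D0[OF S] smooth_on_diff[OF S] smooth_on_add[OF S]
  dr_diff dr_add D0_diff D0_add smooth_on_cmult[OF S] dr_cmult D0_cmult dr_eX_D0[OF S] dr_eV_D0[OF S]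

lemma dr_eX_eV: "smooth_on S F \<Longrightarrow> dr S (eX i) (dr S (eV j) F) = dr S (eV j) (dr S (eX i) F)"
  by (rule dr_commute[OF S])

lemma dr_eX_eX: "smooth_on S F \<Longrightarrow> dr S (eX i) (dr S (eX j) F) = dr S (eX j) (dr S (eX i) F)"
  by (rule dr_commute[OF S])

lemma dr_eV_eV: "smooth_on S F \<Longrightarrow> dr S (eV i) (dr S (eV j) F) = dr S (eV j) (dr S (eV i) F)"
  by (rule dr_commute[OF S])

lemma dr_eV_eX_curl: "dr S (eV i) (dr S (eX k) (Q j)) = dr S (eV j) (dr S (eX k) (Q i))"
  by (metis dr_eX_eV Q curl)

lemmas dr_permute = dr_eX_eV dr_eX_eX dr_eV_eV curl dr_eV_eX_curl

lemma smooth_helmholtz_coeffs: "smooth_on S (A i)" "smooth_on S (B i j)"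
  by (auto simp: helmholtz_simps)

lemma helmholtz_B_sym: "B i j = B j i"
  by (rule ext) (simp add: helmholtz_simps dr_permute)

lemma helmholtz_dB_sym: "dr S (eV l) (B i j) = dr S (eV j) (B i l)"
  by (rule ext) (simp add: helmholtz_simps dr_permute)

lemma helmholtz_dA_sym: "dr S (eV j) (A i) z + dr S (eV i) (A j) z = 2 * D0 S (B i j) z"
  by (simp add: helmholtz_simps dr_permute)

lemma helmholtz_dA_antisym:
  "dr S (eV l) (dr S (eV j) (A i)) z - dr S (eV l) (dr S (eV i) (A j)) z = 2 * (dr S (eX j) (B i l) z - dr S (eX i) (B j l) z)"
  by (simp add: helmholtz_simps dr_permute)

end


declare td2.simps [simp del] td3.simps [simp del] euler_lagrange.simps [simp del]

lemma td2_has_derivative: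
  fixes F :: "'m::finite coords2 \<Rightarrow> real"
  assumes "(F has_derivative D) (at (t, x, v, a))"
  shows "td2 F (t, x, v, a, b) = D (1, v, a, b)"
  using td2_eq[OF differentiableI[OF assms]] pd_eq[OF assms] by simp

lemma td3_has_derivative:
  fixes F :: "'m::finite coords3 \<Rightarrow> real"
  assumes "(F has_derivative D) (at (t, x, v, a, b))"
  shows "td3 F (t, x, v, a, b, w) = D (1, v, a, b, w)"
  using td3_eq[OF differentiableI[OF assms]] pd_eq[OF assms] by simp

lemma pd_const [simp]: "pd (\<lambda>_. c) z b = 0"
  by (simp add: pd_def)

section \<open>The structure of a second-order Lagrangian\<close>

lemmas has_derivative_nth = bounded_linear.has_derivative[OF bounded_linear_vec_nth]

text \<open>The total derivative splits into \<open>D0\<close> and the part that is linear in the acceleration.\<close>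

lemma pd_total:
  assumes "F differentiable at (t, x, v)" "(t, x, v) \<in> S"
  shows "pd F (t, x, v) (1, v, a) = D0 S F (t, x, v) + (\<Sum>j\<in>UNIV. a $ j * dr S (eV j) F (t, x, v))"
proof -
  have l: "linear (pd F (t, x, v))" by (rule linear_pd[OF assms(1)])
  have "linear (\<lambda>u. pd F (t, x, v) (0, 0, u))"
    by (rule linear_compose[OF _ l, unfolded o_def]) (auto intro!: linearI)
  then have "pd F (t, x, v) (0, 0, a) = (\<Sum>j\<in>UNIV. a $ j * dr S (eV j) F (t, x, v))"
    using linear_vec_expansion_real[of "\<lambda>u. pd F (t, x, v) (0, 0, u)" a] assms(2)
    by (simp add: dr_in mult.commute)
  then show ?thesis
    using linear_add[OF l, of "(1, v, 0)" "(0, 0, a)"] assms(2) by (simp add: D0_in)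
qed

lemma has_derivative_affine:
  fixes F :: "'m::finite coords1 \<Rightarrow> real" and H :: "'m \<Rightarrow> 'm coords1 \<Rightarrow> real"
  assumes "F differentiable at (t, x, v)" "\<And>j. H j differentiable at (t, x, v)"
  shows "((\<lambda>(t, x, v, a). F (t, x, v) + (\<Sum>j\<in>UNIV. a $ j * H j (t, x, v))) has_derivative
    (\<lambda>(\<tau>, \<xi>, \<eta>, \<zeta>). pd F (t, x, v) (\<tau>, \<xi>, \<eta>)
      + (\<Sum>j\<in>UNIV. a $ j * pd (H j) (t, x, v) (\<tau>, \<xi>, \<eta>) + \<zeta> $ j * H j (t, x, v)))) (at (t, x, v, a))"
proof -
  define q where "q = (\<lambda>z :: 'm coords2. (fst z, fst (snd z), fst (snd (snd z))))"
  define z where "z = (t, x, v, a)"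
  have q: "(q has_derivative q) (at z)" unfolding q_def by (auto intro!: derivative_eq_intros)
  have c: "((\<lambda>y. K (q y)) has_derivative (\<lambda>h. pd K (q z) (q h))) (at z)"
    if "K differentiable at (t, x, v)" for K :: "'m coords1 \<Rightarrow> real"
    using diff_chain_at[OF q, of K] pd_works[OF that] by (simp add: o_def q_def z_def)
  have "((\<lambda>z. F (q z) + (\<Sum>j\<in>UNIV. snd (snd (snd z)) $ j * H j (q z))) has_derivative
    (\<lambda>h. pd F (q z) (q h)
      + (\<Sum>j\<in>UNIV. snd (snd (snd z)) $ j * pd (H j) (q z) (q h) + snd (snd (snd h)) $ j * H j (q z)))) (at z)"
    by (intro has_derivative_add has_derivative_sum has_derivative_mult c assms
        has_derivative_nth has_derivative_snd has_derivative_ident)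
  then show ?thesis by (simp add: q_def z_def case_prod_unfold)
qed

lemma has_derivative_forget_last:
  fixes K :: "'a::real_normed_vector \<times> 'b::real_normed_vector \<times> 'c::real_normed_vector \<times> 'd::real_normed_vector \<Rightarrow> 'f::real_normed_vector"
    and b :: "'e::real_normed_vector"
  assumes "(K has_derivative D) (at (t, x, v, a))"
  shows "((\<lambda>(t, x, v, a, b). K (t, x, v, a)) has_derivative (\<lambda>(\<tau>, \<xi>, \<eta>, \<zeta>, \<beta>). D (\<tau>, \<xi>, \<eta>, \<zeta>))) (at (t, x, v, a, b))"
proof -
  define q where "q = (\<lambda>z :: 'a \<times> 'b \<times> 'c \<times> 'd \<times> 'e. (fst z, fst (snd z), fst (snd (snd z)), fst (snd (snd (snd z)))))"
  have q: "(q has_derivative q) (at (t, x, v, a, b))" unfolding q_def by (auto intro!: derivative_eq_intros)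
  have qz: "q (t, x, v, a, b) = (t, x, v, a)" by (simp add: q_def)
  show ?thesis
    using diff_chain_at[OF q assms[folded qz]] by (simp add: q_def o_def case_prod_unfold)
qed

text \<open>The left-hand side does not contain the fourth derivative \<open>w\<close>, and \<open>w\<close> enters the Euler-Lagrange
  expression only through \<open>(\<partial>\<^sup>2L / \<partial>a\<^sup>i \<partial>a\<^sup>j) w\<^sup>j\<close>. Hence this Hessian vanishes,
  and \<open>L\<close> is affine on each fibre.\<close>

lemma lagrangian_affine:
  fixes L :: "'m::finite coords2 \<Rightarrow> real"
  assumes U: "open U" and L: "smooth_on (UNIV \<times> U \<times> UNIV \<times> UNIV) L"
    and EL: "\<And>t x v a b w i. x \<in> U \<Longrightarrow> e (x, v, a) $ i = euler_lagrange i L (t, x, v, a, b, w)"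
    and x: "x \<in> U"
  shows "L (t, x, v, a) = L (t, x, v, 0) + (\<Sum>j\<in>UNIV. a $ j * pd L (t, x, v, 0) (0, 0, 0, axis j 1))"
    and "pd L (t, x, v, a) (0, 0, 0, axis i 1) = pd L (t, x, v, 0) (0, 0, 0, axis i 1)"
proof -
  define S where "S = (UNIV :: real set) \<times> U \<times> (UNIV :: 'm rn set) \<times> (UNIV :: 'm rn set)"
  have S: "open S" unfolding S_def by (intro open_Times open_UNIV U)
  note L = L[folded S_def]
  define G where "G = (\<lambda>i z. pd L z (0, 0, 0, axis i 1))"
  have G: "smooth_on S (G i)" for i unfolding G_def by (rule smooth_on_pd[OF L])
  have Sx: "(t, x, v, a) \<in> S" if "x \<in> U" for t x v a using that by (simp add: S_def)
  have G0: "pd (G i) (t, x, v, a) (0, 0, 0, w) = 0" if x: "x \<in> U" for i t x v a w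
  proof -
    define b where "b = (0 :: 'm rn)"
    define q where "q = (\<lambda>z :: 'm coords3. (fst z, fst (snd z), fst (snd (snd z)), fst (snd (snd (snd z)))))"
    define p where "p = (\<lambda>z :: 'm coords3. (1 :: real, fst (snd (snd z)), fst (snd (snd (snd z))), snd (snd (snd (snd z)))))"
    define y where "y = (t, x, v, a, b)"
    have "(q has_derivative q) (at y)" unfolding q_def by (auto intro!: derivative_eq_intros)
    moreover have "(p has_derivative (\<lambda>h. (0, snd (p h)))) (at y)"
      unfolding p_def by (auto intro!: derivative_eq_intros)
    moreover have qy: "q y \<in> S" using x by (simp add: y_def q_def S_def)
    ultimately have "((\<lambda>y. pd (G i) (q y) (p y)) has_derivative
        (\<lambda>h. pd (\<lambda>z. pd (G i) z (p y)) (q y) (q h) + pd (G i) (q y) (0, snd (p h)))) (at y)"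
      by (intro has_derivative_pd_compose[OF S G])
    moreover have "td2 (G i) z = pd (G i) (q z) (p z)" if "z \<in> UNIV \<times> U \<times> UNIV \<times> UNIV \<times> UNIV" for z
      using that td2_eq[OF smooth_on_differentiable[OF G Sx]] by (auto simp: q_def p_def)
    moreover have "open ((UNIV :: real set) \<times> U \<times> (UNIV :: 'm rn set) \<times> (UNIV :: 'm rn set) \<times> (UNIV :: 'm rn set))"
      by (intro open_Times open_UNIV U)
    moreover have "y \<in> UNIV \<times> U \<times> UNIV \<times> UNIV \<times> UNIV" using x by (simp add: y_def)
    ultimately have d: "(td2 (G i) has_derivative
        (\<lambda>h. pd (\<lambda>z. pd (G i) z (p y)) (q y) (q h) + pd (G i) (q y) (0, snd (p h)))) (at y)"
      using has_derivative_cong_open[of "UNIV \<times> U \<times> UNIV \<times> UNIV \<times> UNIV" y "td2 (G i)" "\<lambda>y. pd (G i) (q y) (p y)"]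
      by blast
    have "td3 (td2 (G i)) (t, x, v, a, b, w) = pd (td2 (G i)) y (1, v, a, b, w)" for w
      using td3_eq[of "td2 (G i)" t x v a b w] d by (auto simp: differentiable_def y_def)
    \<comment> \<open>the last summand is the only one that contains w\<close>
    then have td3: "td3 (td2 (G i)) (t, x, v, a, b, w)
        = pd (\<lambda>z. pd (G i) z (p y)) (q y) (1, v, a, b) + pd (G i) (t, x, v, a) (0, a, b, w)" for w
      using pd_eq[OF d] by (simp add: p_def q_def y_def)
    have "td3 (td2 (G i)) (t, x, v, a, b, w) = td3 (td2 (G i)) (t, x, v, a, b, 0)"
      using EL[OF x, of v a i t b w] EL[OF x, of v a i t b 0] by (simp add: G_def euler_lagrange.simps)
    then have "pd (G i) (t, x, v, a) (0, a, b, w) - pd (G i) (t, x, v, a) (0, a, b, 0) = 0"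
      using td3 by simp
    then show ?thesis
      using linear_diff[OF linear_pd[OF smooth_on_differentiable[OF G Sx[OF x]]], of i t v a "(0, a, b, w)" "(0, a, b, 0)"] by simp
  qed
  have line: "((\<lambda>s. K (t, x, v, s *\<^sub>R a)) has_real_derivative pd K (t, x, v, s *\<^sub>R a) (0, 0, 0, a)) (at s)"
    if "smooth_on S K" for K :: "'m coords2 \<Rightarrow> real" and s v a
  proof -
    have "((\<lambda>s. (t, x, v, s *\<^sub>R a)) has_vector_derivative (0, 0, 0, a)) (at s)"
      by (intro has_vector_derivative_Pair has_vector_derivative_const) (auto intro!: derivative_eq_intros)
    from has_vector_derivative_chain[OF this smooth_on_differentiable[OF that Sx[OF x]]]
    show ?thesis by (simp add: has_real_derivative_iff_has_vector_derivative)
  qed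
  have Gc: "G i (t, x, v, s *\<^sub>R a) = G i (t, x, v, 0)" for i v a s
  proof -
    have "\<forall>s. ((\<lambda>s. G i (t, x, v, s *\<^sub>R a)) has_real_derivative 0) (at s)"
      using line[OF G] G0[OF x] by simp
    from DERIV_isconst_all[OF this, of s 0] show ?thesis by simp
  qed
  show "pd L (t, x, v, a) (0, 0, 0, axis i 1) = pd L (t, x, v, 0) (0, 0, 0, axis i 1)"
    using Gc[where v = v and s = 1 and a = a] by (simp add: G_def)
  define \<sigma> where "\<sigma> = (\<Sum>j\<in>UNIV. a $ j * G j (t, x, v, 0))"
  have "pd L (t, x, v, s *\<^sub>R a) (0, 0, 0, a) = \<sigma>" for s
  proof -
    have l: "linear (\<lambda>u. pd L (t, x, v, s *\<^sub>R a) (0, 0, 0, u))"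
      by (rule linear_compose[OF _ linear_pd[OF smooth_on_differentiable[OF L Sx[OF x]]], unfolded o_def])
        (auto intro!: linearI)
    show ?thesis
      using linear_vec_expansion_real[OF l, of a] Gc unfolding \<sigma>_def G_def by (simp add: mult.commute)
  qed
  \<comment> \<open>the slope is constant along the line, so L is affine on it\<close>
  then have "\<forall>s. ((\<lambda>s. L (t, x, v, s *\<^sub>R a) - s * \<sigma>) has_real_derivative 0) (at s)"
    using line[OF L, where v = v and a = a] by (auto intro!: derivative_eq_intros)
  from DERIV_isconst_all[OF this, of 1 0]
  show "L (t, x, v, a) = L (t, x, v, 0) + (\<Sum>j\<in>UNIV. a $ j * pd L (t, x, v, 0) (0, 0, 0, axis j 1))"
    by (simp add: \<sigma>_def G_def)
qed


text \<open>With \<open>L = P + Q\<^sub>j a\<^sup>j\<close> the third derivative \<open>b\<close> enters linearly with the fibre curl of \<open>Q\<close> as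
  its coefficient; since the components are independent of \<open>b\<close>, the curl vanishes. The remaining
  terms are collected by powers of the acceleration.\<close>

lemma variational_structure:
  fixes L :: "'m::finite coords2 \<Rightarrow> real"
  assumes U: "open U" and L: "smooth_on (UNIV \<times> U \<times> UNIV \<times> UNIV) L"
    and EL: "\<And>t x v a b w i. x \<in> U \<Longrightarrow> e (x, v, a) $ i = euler_lagrange i L (t, x, v, a, b, w)"
  defines "S \<equiv> UNIV \<times> U \<times> UNIV"
  shows "\<exists>P Q. smooth_on S P \<and> (\<forall>i. smooth_on S (Q i)) \<and>
    (\<forall>i j. dr S (eV i) (Q j) = dr S (eV j) (Q i)) \<and>
    (\<forall>t x v a i. x \<in> U \<longrightarrow> e (x, v, a) $ i
       = dr S (eX i) P (t, x, v) - D0 S (\<lambda>z. dr S (eV i) P z - D0 S (Q i) z) (t, x, v)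
         + (\<Sum>j\<in>UNIV. a $ j * (dr S (eX i) (Q j) (t, x, v) - dr S (eV j) (\<lambda>z. dr S (eV i) P z - D0 S (Q i) z) (t, x, v))))"
proof -
  define S4 where "S4 = (UNIV :: real set) \<times> U \<times> (UNIV :: 'm rn set) \<times> (UNIV :: 'm rn set)"
  define S5 where "S5 = (UNIV :: real set) \<times> U \<times> (UNIV :: 'm rn set) \<times> (UNIV :: 'm rn set) \<times> (UNIV :: 'm rn set)"
  have S: "open S" "open S4" "open S5" unfolding S_def S4_def S5_def by (intro open_Times open_UNIV U)+
  have Sx: "(t, x, v) \<in> S" "(t, x, v, a) \<in> S4" "(t, x, v, a, b) \<in> S5" if "x \<in> U" for t x v a b
    using that by (auto simp: S_def S4_def S5_def)
  define P where "P = (\<lambda>(t, x, v). L (t, x, v, 0))"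
  define Q where "Q = (\<lambda>j (t, x, v). pd L (t, x, v, 0) (0, 0, 0, axis j 1))"
  have emb: "smooth_on S (\<lambda>(t, x, v). (t, x, v, 0 :: 'm rn))"
    unfolding case_prod_unfold by (intro smooth_intros S)
  have K: "smooth_on S (\<lambda>(t, x, v). K (t, x, v, 0))" if "smooth_on S4 K" for K :: "'m coords2 \<Rightarrow> real"
  proof -
    have "smooth_on S (\<lambda>z. K ((\<lambda>(t, x, v). (t, x, v, 0)) z))"
      by (rule smooth_on_compose_UNIV[OF S(1) that emb]) (auto simp: S_def S4_def)
    then show ?thesis unfolding case_prod_unfold .
  qed
  have P: "smooth_on S P" unfolding P_def by (rule K[OF L[folded S4_def]])
  have Q: "smooth_on S (Q i)" for i unfolding Q_def by (rule K[OF smooth_on_pd[OF L[folded S4_def]]])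
  have dif: "K differentiable at (t, x, v)" if "smooth_on S K" "x \<in> U" for K :: "_ \<Rightarrow> real" and t x v
    using smooth_on_differentiable that Sx by blast
  note sm = P Q smooth_dr[OF S(1)] smooth_D0[OF S(1)] smooth_on_diff[OF S(1)]
  define G where "G = (\<lambda>i z. pd L z (0, 0, 0, axis i 1))"
  define N where "N = (\<lambda>i z. pd L z (0, 0, axis i 1, 0))"
  have Lz: "L z = (\<lambda>(t, x, v, a). P (t, x, v) + (\<Sum>j\<in>UNIV. a $ j * Q j (t, x, v))) z" if "z \<in> S4" for z
    using that lagrangian_affine(1)[OF U L EL, of "fst (snd z)" "fst z" "fst (snd (snd z))" "snd (snd (snd z))"]
    by (simp only: S4_def P_def Q_def mem_Times_iff prod.case case_prod_unfold fst_conv snd_conv prod.collapse simp_thms)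
  have Gz: "G i z = (\<lambda>(t, x, v, a). Q i (t, x, v) + (\<Sum>j\<in>UNIV. a $ j * 0)) z" if "z \<in> S4" for z i
    using that lagrangian_affine(2)[OF U L EL, of "fst (snd z)" "fst z" "fst (snd (snd z))" "snd (snd (snd z))"]
    by (simp add: S4_def G_def Q_def mem_Times_iff case_prod_unfold)
  have dL: "pd L (t, x, v, a) (\<tau>, \<xi>, \<eta>, \<zeta>) = pd P (t, x, v) (\<tau>, \<xi>, \<eta>)
      + (\<Sum>j\<in>UNIV. a $ j * pd (Q j) (t, x, v) (\<tau>, \<xi>, \<eta>) + \<zeta> $ j * Q j (t, x, v))"
    if "x \<in> U" for t x v a \<tau> \<xi> \<eta> \<zeta>
    using pd_cong_open[OF S(2) Sx(2)[OF that] Lz]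
      pd_eq[OF has_derivative_affine[OF dif[OF P that] dif[OF Q that]]] by simp
  have Lx: "pd L (t, x, v, a) (0, axis i 1, 0, 0)
      = dr S (eX i) P (t, x, v) + (\<Sum>j\<in>UNIV. a $ j * dr S (eX i) (Q j) (t, x, v))" if "x \<in> U" for t x v a i
    by (simp add: dL[OF that] dr_in Sx[OF that])
  have Nz: "N i z = (\<lambda>(t, x, v, a). dr S (eV i) P (t, x, v) + (\<Sum>j\<in>UNIV. a $ j * dr S (eV i) (Q j) (t, x, v))) z"
    if "z \<in> S4" for z i
    using that by (auto simp: S4_def N_def dL dr_in Sx)
  have tdN: "td2 (N i) (t, x, v, a, b) = pd (dr S (eV i) P) (t, x, v) (1, v, a)
      + (\<Sum>j\<in>UNIV. a $ j * pd (dr S (eV i) (Q j)) (t, x, v) (1, v, a) + b $ j * dr S (eV i) (Q j) (t, x, v))"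
    if "x \<in> U" for t x v a b i
  proof -
    have "(N i has_derivative (\<lambda>(\<tau>, \<xi>, \<eta>, \<zeta>). pd (dr S (eV i) P) (t, x, v) (\<tau>, \<xi>, \<eta>)
      + (\<Sum>j\<in>UNIV. a $ j * pd (dr S (eV i) (Q j)) (t, x, v) (\<tau>, \<xi>, \<eta>) + \<zeta> $ j * dr S (eV i) (Q j) (t, x, v))))
      (at (t, x, v, a))"
      by (rule iffD2[OF has_derivative_cong_open[OF S(2) Sx(2)[OF that] Nz], rotated])
        (rule has_derivative_affine[OF dif[OF sm(3)[OF P] that] dif[OF sm(3)[OF Q] that]], assumption)
    from td2_has_derivative[OF this] show ?thesis by simp
  qed
  have tdG: "td2 (G i) (t, x, v, a, b) = D0 S (Q i) (t, x, v) + (\<Sum>j\<in>UNIV. a $ j * dr S (eV j) (Q i) (t, x, v))"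
    if "x \<in> U" for t x v a b i
  proof -
    have "(G i has_derivative (\<lambda>(\<tau>, \<xi>, \<eta>, \<zeta>). pd (Q i) (t, x, v) (\<tau>, \<xi>, \<eta>)
      + (\<Sum>j\<in>UNIV. a $ j * pd (\<lambda>_. 0) (t, x, v) (\<tau>, \<xi>, \<eta>) + \<zeta> $ j * 0))) (at (t, x, v, a))"
      by (rule iffD2[OF has_derivative_cong_open[OF S(2) Sx(2)[OF that] Gz], rotated])
        (rule has_derivative_affine[OF dif[OF Q that], of "\<lambda>_ _. 0"], simp, assumption)
    from td2_has_derivative[OF this] have "td2 (G i) (t, x, v, a, b) = pd (Q i) (t, x, v) (1, v, a)"
      by simp
    then show ?thesis using pd_total[OF dif[OF Q that] Sx(1)[OF that]] by simp
  qed
  have tdtdG: "td3 (td2 (G i)) (t, x, v, a, b, w) = pd (D0 S (Q i)) (t, x, v) (1, v, a)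
      + (\<Sum>j\<in>UNIV. a $ j * pd (dr S (eV j) (Q i)) (t, x, v) (1, v, a) + b $ j * dr S (eV j) (Q i) (t, x, v))"
    if "x \<in> U" for t x v a b w i
  proof -
    have tz: "td2 (G i) z = (\<lambda>(t, x, v, a, b). D0 S (Q i) (t, x, v) + (\<Sum>j\<in>UNIV. a $ j * dr S (eV j) (Q i) (t, x, v))) z"
      if "z \<in> S5" for z
      using that tdG by (auto simp: S5_def)
    have "(td2 (G i) has_derivative (\<lambda>(\<tau>, \<xi>, \<eta>, \<zeta>, \<beta>). pd (D0 S (Q i)) (t, x, v) (\<tau>, \<xi>, \<eta>)
      + (\<Sum>j\<in>UNIV. a $ j * pd (dr S (eV j) (Q i)) (t, x, v) (\<tau>, \<xi>, \<eta>) + \<zeta> $ j * dr S (eV j) (Q i) (t, x, v))))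
      (at (t, x, v, a, b))"
      by (rule iffD2[OF has_derivative_cong_open[OF S(3) Sx(3)[OF that] tz], rotated])
        (rule has_derivative_forget_last[OF has_derivative_affine[OF dif[OF sm(4)[OF Q] that] dif[OF sm(3)[OF Q] that]], unfolded prod.case], assumption)
    from td3_has_derivative[OF this] show ?thesis by simp
  qed
  have E: "e (x, v, a) $ i = dr S (eX i) P (t, x, v) + (\<Sum>j\<in>UNIV. a $ j * dr S (eX i) (Q j) (t, x, v))
      - (pd (dr S (eV i) P) (t, x, v) (1, v, a)
      + (\<Sum>j\<in>UNIV. a $ j * pd (dr S (eV i) (Q j)) (t, x, v) (1, v, a) + b $ j * dr S (eV i) (Q j) (t, x, v)))
      + (pd (D0 S (Q i)) (t, x, v) (1, v, a)
      + (\<Sum>j\<in>UNIV. a $ j * pd (dr S (eV j) (Q i)) (t, x, v) (1, v, a) + b $ j * dr S (eV j) (Q i) (t, x, v)))"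
    if "x \<in> U" for t x v a b i
    using EL[OF that, of v a i t b 0] Lx[OF that] tdN[OF that, of i] tdtdG[OF that, of i]
    unfolding G_def N_def by (simp add: euler_lagrange.simps)
  have curl: "dr S (eV i) (Q j) = dr S (eV j) (Q i)" for i j
  proof
    fix z show "dr S (eV i) (Q j) z = dr S (eV j) (Q i) z"
    proof (cases "z \<in> S")
      case True
      then obtain t x v where z: "z = (t, x, v)" "x \<in> U" by (auto simp: S_def)
      \<comment> \<open>compare b = 0 with b = the j-th unit vector at a = 0\<close>
      show ?thesis using E[OF z(2), of v 0 i t 0] E[OF z(2), of v 0 i t "axis j 1"]
        by (simp add: z(1) axis_def if_distrib[of "\<lambda>r. r * _"] cong: if_cong)
    qed (simp add: dr_def)
  qed
  have "e (x, v, a) $ i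
       = dr S (eX i) P (t, x, v) - D0 S (\<lambda>z. dr S (eV i) P z - D0 S (Q i) z) (t, x, v)
         + (\<Sum>j\<in>UNIV. a $ j * (dr S (eX i) (Q j) (t, x, v) - dr S (eV j) (\<lambda>z. dr S (eV i) P z - D0 S (Q i) z) (t, x, v)))"
    if "x \<in> U" for t x v a i
  proof -
    define R where "R = (\<lambda>z. dr S (eV i) P z - D0 S (Q i) z)"
    have "e (x, v, a) $ i = dr S (eX i) P (t, x, v) + (\<Sum>j\<in>UNIV. a $ j * dr S (eX i) (Q j) (t, x, v))
        - (pd (dr S (eV i) P) (t, x, v) (1, v, a) - pd (D0 S (Q i)) (t, x, v) (1, v, a))"
      using E[OF that, of v a i t 0] by (simp add: curl[of i])
    also have "pd (dr S (eV i) P) (t, x, v) (1, v, a) - pd (D0 S (Q i)) (t, x, v) (1, v, a) = pd R (t, x, v) (1, v, a)"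
      unfolding R_def by (intro pd_diff[symmetric] dif sm that)
    also have "\<dots> = D0 S R (t, x, v) + (\<Sum>j\<in>UNIV. a $ j * dr S (eV j) R (t, x, v))"
      by (rule pd_total[OF dif Sx(1)[OF that]]) (unfold R_def, intro sm, rule that)
    finally show ?thesis by (simp add: R_def[symmetric] right_diff_distrib sum_subtractf)
  qed
  then show ?thesis using P Q curl by blast
qed


text \<open>The Lagrange function may depend on \<open>t\<close>, but \<open>A\<close> and \<open>B\<close> do not, since they are determined by the
  values of \<open>e\<close>. So the conditions descend to functions of \<open>(x, v)\<close>, and \<open>D0\<close> becomes the base
  derivative in the direction \<open>v\<close>.\<close>

lemma helmholtz_conditions:
  fixes L :: "'m::finite coords2 \<Rightarrow> real"
  assumes U: "open U" and L: "smooth_on (UNIV \<times> U \<times> UNIV \<times> UNIV) L"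
    and EL: "\<And>t x v a b w i. x \<in> U \<Longrightarrow> e (x, v, a) $ i = euler_lagrange i L (t, x, v, a, b, w)"
  obtains \<alpha> :: "'m \<Rightarrow> 'm rn \<times> 'm rn \<Rightarrow> real" and \<beta> :: "'m \<Rightarrow> 'm \<Rightarrow> 'm rn \<times> 'm rn \<Rightarrow> real" where
    "\<And>i. smooth_on (U \<times> UNIV) (\<alpha> i)" "\<And>i j. smooth_on (U \<times> UNIV) (\<beta> i j)"
    "\<And>x v a i. x \<in> U \<Longrightarrow> e (x, v, a) $ i = \<alpha> i (x, v) + (\<Sum>j\<in>UNIV. \<beta> i j (x, v) * a $ j)"
    "\<And>i j. \<beta> i j = \<beta> j i"
    "\<And>x v i j l. x \<in> U \<Longrightarrow> pd (\<beta> i j) (x, v) (0, axis l 1) = pd (\<beta> i l) (x, v) (0, axis j 1)"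
    "\<And>x v i j. x \<in> U \<Longrightarrow> pd (\<alpha> i) (x, v) (0, axis j 1) + pd (\<alpha> j) (x, v) (0, axis i 1) = 2 * pd (\<beta> i j) (x, v) (v, 0)"
    "\<And>x v i j l. x \<in> U \<Longrightarrow> pd (\<lambda>z. pd (\<alpha> i) z (0, axis j 1)) (x, v) (0, axis l 1) - pd (\<lambda>z. pd (\<alpha> j) z (0, axis i 1)) (x, v) (0, axis l 1)
       = 2 * (pd (\<beta> i l) (x, v) (axis j 1, 0) - pd (\<beta> j l) (x, v) (axis i 1, 0))"
proof -
  define S where "S = (UNIV :: real set) \<times> U \<times> (UNIV :: 'm rn set)"
  define T where "T = U \<times> (UNIV :: 'm rn set)"
  have S: "open S" "open T" unfolding S_def T_def by (intro open_Times open_UNIV U)+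
  have Sx: "(t, x, v) \<in> S" "(x, v) \<in> T" if "x \<in> U" for t x v using that by (auto simp: S_def T_def)
  obtain P Q where P: "smooth_on S P" and Q: "\<And>i. smooth_on S (Q i)"
    and curl: "\<And>i j. dr S (eV i) (Q j) = dr S (eV j) (Q i)"
    and E: "\<And>t x v a i. x \<in> U \<Longrightarrow> e (x, v, a) $ i
       = dr S (eX i) P (t, x, v) - D0 S (\<lambda>z. dr S (eV i) P z - D0 S (Q i) z) (t, x, v)
         + (\<Sum>j\<in>UNIV. a $ j * (dr S (eX i) (Q j) (t, x, v) - dr S (eV j) (\<lambda>z. dr S (eV i) P z - D0 S (Q i) z) (t, x, v)))"
    using variational_structure[OF assms] unfolding S_def by blast
  define R where "R = (\<lambda>i z. dr S (eV i) P z - D0 S (Q i) z)"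
  define A where "A = (\<lambda>i z. dr S (eX i) P z - D0 S (R i) z)"
  define B where "B = (\<lambda>i j z. dr S (eX i) (Q j) z - dr S (eV j) (R i) z)"
  note hyps = S(1) P Q curl R_def A_def B_def
  have E: "e (x, v, a) $ i = A i (t, x, v) + (\<Sum>j\<in>UNIV. a $ j * B i j (t, x, v))" if "x \<in> U" for t x v a i
    unfolding A_def B_def R_def by (rule E[OF that])
  define \<alpha> where "\<alpha> = (\<lambda>i (x, v). A i (0, x, v))"
  define \<beta> where "\<beta> = (\<lambda>i j (x, v). B i j (0, x, v))"
  have A: "A i z = \<alpha> i (snd z)" and B: "B i j z = \<beta> i j (snd z)" if zS: "z \<in> S" for z i j
  proof -
    obtain t x v where z: "z = (t, x, v)" and x: "x \<in> U" using zS by (cases z) (auto simp: S_def)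
    show A: "A i z = \<alpha> i (snd z)"
      using E[OF x, of v 0 i t] E[OF x, of v 0 i 0] by (simp add: z \<alpha>_def)
    show "B i j z = \<beta> i j (snd z)"
      using E[OF x, of v "axis j 1" i t] E[OF x, of v "axis j 1" i 0] A
      by (simp add: z \<alpha>_def \<beta>_def axis_def if_distrib[of "\<lambda>r. r * _"] cong: if_cong)
  qed
  have emb: "smooth_on T (\<lambda>z. (0 :: real, z))" by (intro smooth_intros S)
  have lift: "smooth_on T (\<lambda>z. K (0, z))" if "smooth_on S K" for K :: "_ \<Rightarrow> real"
    by (rule smooth_on_compose_UNIV[OF S(2) that emb]) (auto simp: S_def T_def)
  have sA: "smooth_on T (\<alpha> i)" and sB: "smooth_on T (\<beta> i j)" for i j
    using lift[OF smooth_helmholtz_coeffs(1)[OF hyps]] lift[OF smooth_helmholtz_coeffs(2)[OF hyps]] by (simp_all add: \<alpha>_def \<beta>_def case_prod_unfold)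
  have pdsnd: "pd K (t, x, v) (\<tau>, \<xi>, \<eta>) = pd k (x, v) (\<xi>, \<eta>)"
    if k: "smooth_on T k" and eq: "\<And>z. z \<in> S \<Longrightarrow> K z = k (snd z)" and x: "x \<in> U"
    for K :: "'m coords1 \<Rightarrow> real" and k t x v \<tau> \<xi> \<eta>
  proof -
    have "pd K (t, x, v) (\<tau>, \<xi>, \<eta>) = pd (\<lambda>z. k (snd z)) (t, x, v) (\<tau>, \<xi>, \<eta>)"
      by (rule pd_cong_open[OF S(1) Sx(1)[OF x] eq])
    also have "\<dots> = pd k (x, v) (\<xi>, \<eta>)"
    proof (rule fun_cong[OF pd_eq, THEN trans])
      show "((\<lambda>z. k (snd z)) has_derivative (\<lambda>h. pd k (snd (t, x, v)) (snd h))) (at (t, x, v))"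
        by (rule has_derivative_compose_pd[OF k]) (auto intro!: derivative_eq_intros simp: Sx x)
    qed simp
    finally show ?thesis .
  qed
  have dA: "dr S (0, b) (A i) z = (\<lambda>y. pd (\<alpha> i) y b) (snd z)" if "z \<in> S" for z b i
    using that pdsnd[OF sA A] by (cases b) (auto simp: S_def dr_in)
  have dB: "dr S (0, b) (B i j) z = (\<lambda>y. pd (\<beta> i j) y b) (snd z)" if "z \<in> S" for z b i j
    using that pdsnd[OF sB B] by (cases b) (auto simp: S_def dr_in)
  have ddA: "dr S (0, b) (dr S (0, c) (A i)) (t, x, v) = pd (\<lambda>y. pd (\<alpha> i) y c) (x, v) b" if x: "x \<in> U" for t x v b c i
    using pdsnd[of "\<lambda>y. pd (\<alpha> i) y c" "dr S (0, c) (A i)" x t v 0 "fst b" "snd b", OF smooth_on_pd[OF sA] dA x] Sx[OF x]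
    by (simp add: dr_in[of _ S "(0, b)"])
  have DB: "D0 S (B i j) (0, x, v) = pd (\<beta> i j) (x, v) (v, 0)" if "x \<in> U" for x v i j
    using pdsnd[OF sB B that] Sx[OF that] by (simp add: D0_in)
  show thesis
  proof (rule that[of \<alpha> \<beta>])
    show "smooth_on (U \<times> UNIV) (\<alpha> i)" "smooth_on (U \<times> UNIV) (\<beta> i j)" for i j
      using sA sB by (simp_all add: T_def)
    show "\<beta> i j = \<beta> j i" for i j
      using helmholtz_B_sym[OF hyps, of i j] by (simp add: \<beta>_def)
    fix x v i j l assume x: "x \<in> U"
    note z = Sx(1)[OF x, of 0 v]
    show "e (x, v, a) $ i = \<alpha> i (x, v) + (\<Sum>j\<in>UNIV. \<beta> i j (x, v) * a $ j)" for a
      using E[OF x, of v a i 0] by (simp add: \<alpha>_def \<beta>_def mult.commute)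
    show "pd (\<beta> i j) (x, v) (0, axis l 1) = pd (\<beta> i l) (x, v) (0, axis j 1)"
      using helmholtz_dB_sym[OF hyps, of l i j, THEN fun_cong, of "(0, x, v)"] dB[OF z] by simp
    show "pd (\<alpha> i) (x, v) (0, axis j 1) + pd (\<alpha> j) (x, v) (0, axis i 1) = 2 * pd (\<beta> i j) (x, v) (v, 0)"
      using helmholtz_dA_sym[OF hyps, of j i "(0, x, v)"] dA[OF z] DB[OF x] by simp
    show "pd (\<lambda>z. pd (\<alpha> i) z (0, axis j 1)) (x, v) (0, axis l 1) - pd (\<lambda>z. pd (\<alpha> j) z (0, axis i 1)) (x, v) (0, axis l 1)
       = 2 * (pd (\<beta> i l) (x, v) (axis j 1, 0) - pd (\<beta> j l) (x, v) (axis i 1, 0))"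
      using helmholtz_dA_antisym[OF hyps, of l j i "(0, x, v)"] ddA[OF x] dB[OF z] by simp
  qed
qed


section \<open>Homogeneous variational source forms in one chart\<close>

lemma pd_expand_fst:
  fixes g :: "'m::finite rn \<times> 'm rn \<Rightarrow> real"
  assumes "g differentiable at z"
  shows "(\<Sum>j\<in>UNIV. v $ j * pd g z (axis j 1, 0)) = pd g z (v, 0)"
proof -
  have "linear (\<lambda>u. pd g z (u, 0))"
    by (rule linear_compose[OF _ linear_pd[OF assms], unfolded o_def]) (auto intro!: linearI)
  from linear_vec_expansion_real[OF this, of v] show ?thesis by (simp add: mult.commute)
qed

lemma pd_expand_snd:
  fixes g :: "'m::finite rn \<times> 'm rn \<Rightarrow> real"
  assumes "g differentiable at z"
  shows "(\<Sum>j\<in>UNIV. v $ j * pd g z (0, axis j 1)) = pd g z (0, v)"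
proof -
  have "linear (\<lambda>u. pd g z (0, u))"
    by (rule linear_compose[OF _ linear_pd[OF assms], unfolded o_def]) (auto intro!: linearI)
  from linear_vec_expansion_real[OF this, of v] show ?thesis by (simp add: mult.commute)
qed

lemma pd_split:
  fixes g :: "'a::euclidean_space \<times> 'b::euclidean_space \<Rightarrow> real"
  assumes "g differentiable at z"
  shows "pd g z (v, a) = pd g z (v, 0) + pd g z (0, a)"
  using linear_add[OF linear_pd[OF assms], of "(v, 0)" "(0, a)"] by simp

text \<open>Differentiate the homogeneity identity along the fibre and interchange the two derivatives.\<close>

lemma pd_euler:
  fixes g :: "'m::finite rn \<times> 'm rn \<Rightarrow> real"
  assumes "open T" "smooth_on T g" "(x, v) \<in> T"
    and "\<And>x v. (x, v) \<in> T \<Longrightarrow> pd g (x, v) (0, v) = k * g (x, v)"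
  shows "pd (\<lambda>y. pd g y (0, u)) (x, v) (0, v) = (k - 1) * pd g (x, v) (0, u)"
proof -
  have "((\<lambda>z. pd g z (0, snd z)) has_derivative
      (\<lambda>h. pd (\<lambda>y. pd g y (0, snd (x, v))) (x, v) h + pd g (x, v) (0, snd h))) (at (x, v))"
    by (rule has_derivative_pd_compose[OF assms(1,2), of "\<lambda>z. z"]) (use assms(3) in \<open>auto intro!: derivative_eq_intros\<close>)
  from fun_cong[OF pd_eq[OF this], of "(0, u)"]
  have "pd (\<lambda>y. pd g y (0, v)) (x, v) (0, u) + pd g (x, v) (0, u) = pd (\<lambda>z. pd g z (0, snd z)) (x, v) (0, u)"
    by simp
  also have "\<dots> = pd (\<lambda>z. k * g z) (x, v) (0, u)"
    by (rule pd_cong_open[OF assms(1,3)]) (use assms(4) in auto)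
  also have "\<dots> = k * pd g (x, v) (0, u)"
    by (rule pd_cmult[OF smooth_on_differentiable[OF assms(2,3)]])
  finally show ?thesis
    using pd_commute[OF assms(1-3), of "(0, u)" "(0, v)"] by (simp add: algebra_simps)
qed

text \<open>For \<open>e = A + B a\<close> this is \<open>B\<^sub>i\<^sub>j v\<^sup>i v\<^sup>j\<close>. It is written as a difference of values of \<open>e\<close> because its
  behaviour under a change of chart and its smoothness are then visible without knowledge of \<open>B\<close>.\<close>

definition energy :: "('m::finite rn \<times> 'm rn \<times> 'm rn \<Rightarrow> 'm rn) \<Rightarrow> 'm rn \<times> 'm rn \<Rightarrow> real" where
  "energy e = (\<lambda>(x, v). (e (x, v, v) - e (x, v, 0)) \<bullet> v)"

text \<open>Comparing coefficients of \<open>a\<close> in the homogeneity condition, \<open>\<alpha>\<close> has degree \<open>k\<close> and \<open>\<beta>\<close>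
  degree \<open>k - 2\<close> in the velocities. Total symmetry of the fibre derivative of \<open>\<beta>\<close> gives the first
  and second fibre derivatives of the energy. With the abbreviations \<open>Xi\<close> for its base derivative and
  \<open>Y\<close> for \<open>v\<^sup>j v\<^sup>l \<partial>\<beta>\<^sub>i\<^sub>j / \<partial>x\<^sup>l\<close>, contracting the antisymmetric Helmholtz condition with
  \<open>v\<^sup>j v\<^sup>l\<close> yields \<open>(k - 1) (k \<alpha>\<^sub>i - Y) = Y - Xi\<close>, which is the claim for the part
  without accelerations.\<close>

lemma variational_homogeneous_chart:
  fixes L :: "'m::finite coords2 \<Rightarrow> real"
  assumes U: "open U" and L: "smooth_on (UNIV \<times> U \<times> UNIV \<times> UNIV) L"
    and EL: "\<And>t x v a b w i. x \<in> U \<Longrightarrow> e (x, v, a) $ i = euler_lagrange i L (t, x, v, a, b, w)"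
    and hom: "\<And>x v a i. x \<in> U \<Longrightarrow> homogeneous_at k (\<lambda>w. e w $ i) (x, v, a)"
    and k: "k \<noteq> 0" "k \<noteq> 1" and x: "x \<in> U"
  shows "e (x, v, a) $ i = - 1 / (k * (k - 1)) *
    (pd (energy e) (x, v) (axis i 1, 0) - pd (\<lambda>y. pd (energy e) y (0, axis i 1)) (x, v) (v, a))"
    and "pd (energy e) (x, v) (0, v) = k * energy e (x, v)"
proof -
  define T where "T = U \<times> (UNIV :: 'm rn set)"
  have T: "open T" unfolding T_def by (intro open_Times open_UNIV U)
  obtain \<alpha> :: "'m \<Rightarrow> 'm rn \<times> 'm rn \<Rightarrow> real" and \<beta> :: "'m \<Rightarrow> 'm \<Rightarrow> 'm rn \<times> 'm rn \<Rightarrow> real" where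
    sm: "\<And>i. smooth_on T (\<alpha> i)" "\<And>i j. smooth_on T (\<beta> i j)"
    and e: "\<And>x v a i. x \<in> U \<Longrightarrow> e (x, v, a) $ i = \<alpha> i (x, v) + (\<Sum>j\<in>UNIV. \<beta> i j (x, v) * a $ j)"
    and sym: "\<And>i j. \<beta> i j = \<beta> j i"
    and d\<beta>: "\<And>x v i j l. x \<in> U \<Longrightarrow> pd (\<beta> i j) (x, v) (0, axis l 1) = pd (\<beta> i l) (x, v) (0, axis j 1)"
    and d\<alpha>: "\<And>x v i j. x \<in> U \<Longrightarrow> pd (\<alpha> i) (x, v) (0, axis j 1) + pd (\<alpha> j) (x, v) (0, axis i 1) = 2 * pd (\<beta> i j) (x, v) (v, 0)"
    and dd\<alpha>: "\<And>x v i j l. x \<in> U \<Longrightarrow> pd (\<lambda>z. pd (\<alpha> i) z (0, axis j 1)) (x, v) (0, axis l 1) - pd (\<lambda>z. pd (\<alpha> j) z (0, axis i 1)) (x, v) (0, axis l 1)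
       = 2 * (pd (\<beta> i l) (x, v) (axis j 1, 0) - pd (\<beta> j l) (x, v) (axis i 1, 0))"
    by (rule helmholtz_conditions[OF U L EL, folded T_def], assumption, rule that, assumption+)
  have Tx: "(x, v) \<in> T" if "x \<in> U" for x v using that by (simp add: T_def)
  have dif: "\<alpha> i differentiable at (x, v)" "\<beta> i j differentiable at (x, v)" if "x \<in> U" for x v i j
    using smooth_on_differentiable[OF sm(1) Tx[OF that]] smooth_on_differentiable[OF sm(2) Tx[OF that]] by auto
  have hom\<alpha>\<beta>: "pd (\<alpha> i) (x, v) (0, v) + (\<Sum>j\<in>UNIV. a $ j * pd (\<beta> i j) (x, v) (0, v)) + 2 * (\<Sum>j\<in>UNIV. \<beta> i j (x, v) * a $ j)
      = k * (\<alpha> i (x, v) + (\<Sum>j\<in>UNIV. \<beta> i j (x, v) * a $ j))" if x: "x \<in> U" for x v a i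
  proof -
    define q where "q = (\<lambda>w :: 'm rn \<times> 'm rn \<times> 'm rn. (fst w, fst (snd w)))"
    have q: "(q has_derivative q) (at w)" for w unfolding q_def by (auto intro!: derivative_eq_intros)
    have c: "((\<lambda>w. g (q w)) has_derivative (\<lambda>h. pd g (q (x, v, a)) (q h))) (at (x, v, a))" if "smooth_on T g" for g :: "_ \<Rightarrow> real"
      by (rule has_derivative_compose_pd[OF that _ q]) (simp add: q_def Tx x)
    have d: "((\<lambda>w. \<alpha> i (q w) + (\<Sum>j\<in>UNIV. \<beta> i j (q w) * snd (snd w) $ j)) has_derivative
        (\<lambda>h. pd (\<alpha> i) (q (x, v, a)) (q h) + (\<Sum>j\<in>UNIV. \<beta> i j (q (x, v, a)) * snd (snd h) $ j
           + pd (\<beta> i j) (q (x, v, a)) (q h) * snd (snd (x, v, a)) $ j))) (at (x, v, a))"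
      by (intro has_derivative_add has_derivative_sum has_derivative_mult c sm
          has_derivative_nth has_derivative_snd has_derivative_ident)
    have "open (U \<times> (UNIV :: 'm rn set) \<times> (UNIV :: 'm rn set))" by (intro open_Times open_UNIV U)
    moreover have "(x, v, a) \<in> U \<times> UNIV \<times> UNIV" using x by simp
    ultimately have pe: "pd (\<lambda>w. e w $ i) (x, v, a) (\<xi>, \<eta>, \<zeta>) = pd (\<alpha> i) (x, v) (\<xi>, \<eta>)
        + (\<Sum>j\<in>UNIV. \<beta> i j (x, v) * \<zeta> $ j + pd (\<beta> i j) (x, v) (\<xi>, \<eta>) * a $ j)" for \<xi> \<eta> \<zeta>
    proof -
      assume o: "open (U \<times> (UNIV :: 'm rn set) \<times> (UNIV :: 'm rn set))" and m: "(x, v, a) \<in> U \<times> UNIV \<times> UNIV"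
      have "pd (\<lambda>w. e w $ i) (x, v, a) (\<xi>, \<eta>, \<zeta>) = pd (\<lambda>w. \<alpha> i (q w) + (\<Sum>j\<in>UNIV. \<beta> i j (q w) * snd (snd w) $ j)) (x, v, a) (\<xi>, \<eta>, \<zeta>)"
        by (rule pd_cong_open[OF o m]) (auto simp: e q_def)
      then show ?thesis using pd_eq[OF d] by (simp add: q_def)
    qed
    have "(\<Sum>l\<in>UNIV. pd (\<lambda>w. e w $ i) (x, v, a) (0, axis l 1, 0) * v $ l)
        = (\<Sum>l\<in>UNIV. v $ l * pd (\<alpha> i) (x, v) (0, axis l 1)) + (\<Sum>j\<in>UNIV. a $ j * (\<Sum>l\<in>UNIV. v $ l * pd (\<beta> i j) (x, v) (0, axis l 1)))"
      by (simp add: pe algebra_simps sum.distrib sum_distrib_left) (rule sum.swap)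
    moreover have "(\<Sum>l\<in>UNIV. pd (\<lambda>w. e w $ i) (x, v, a) (0, 0, axis l 1) * a $ l) = (\<Sum>j\<in>UNIV. \<beta> i j (x, v) * a $ j)"
      using linear_0[OF linear_pd[OF dif(1)[OF x]]] linear_0[OF linear_pd[OF dif(2)[OF x]]]
      by (simp add: pe axis_def zero_prod_def sum.distrib if_distrib[of "\<lambda>r. _ * r"] cong: if_cong)
    ultimately show ?thesis
      using hom[OF x, of i v a] by (simp add: homogeneous_at_def pd_expand_snd dif x e)
  qed
  have hom\<alpha>: "pd (\<alpha> i) (x, v) (0, v) = k * \<alpha> i (x, v)" if "x \<in> U" for x v i
    using hom\<alpha>\<beta>[OF that, of i v 0] by simp
  \<comment> \<open>the coefficient 2 of the acceleration term lowers the degree by 2\<close>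
  have hom\<beta>: "pd (\<beta> i j) (x, v) (0, v) = (k - 2) * \<beta> i j (x, v)" if "x \<in> U" for x v i j
    using hom\<alpha>\<beta>[OF that, of i v "axis j 1"] hom\<alpha>[OF that, of i v]
    by (simp add: axis_def if_distrib[of "\<lambda>r. r * _"] if_distrib[of "\<lambda>r. _ * r"] algebra_simps cong: if_cong)
  define f where "f = energy e"
  have f: "f z = (\<Sum>i\<in>UNIV. \<Sum>j\<in>UNIV. \<beta> i j z * (snd z $ i * snd z $ j))" if "z \<in> T" for z
    using that by (auto simp: T_def f_def energy_def inner_vec_def e sum_distrib_right sum_distrib_left algebra_simps)
  \<comment> \<open>by symmetry of beta the two terms from differentiating v v coincide\<close>
  have df: "pd f (x, v) (\<xi>, \<eta>) = (\<Sum>i\<in>UNIV. \<Sum>j\<in>UNIV. pd (\<beta> i j) (x, v) (\<xi>, \<eta>) * (v $ i * v $ j)) + 2 * (\<Sum>i\<in>UNIV. \<Sum>j\<in>UNIV. \<beta> i j (x, v) * v $ j * \<eta> $ i)"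
    if x: "x \<in> U" for x v \<xi> \<eta>
  proof -
    have "((\<lambda>z. \<Sum>i\<in>UNIV. \<Sum>j\<in>UNIV. \<beta> i j z * (snd z $ i * snd z $ j)) has_derivative
       (\<lambda>h. \<Sum>i\<in>UNIV. \<Sum>j\<in>UNIV. \<beta> i j (x, v) * (snd (x, v) $ i * snd h $ j + snd h $ i * snd (x, v) $ j)
          + pd (\<beta> i j) (x, v) h * (snd (x, v) $ i * snd (x, v) $ j))) (at (x, v))"
      by (intro has_derivative_sum has_derivative_mult pd_works dif x
          has_derivative_nth has_derivative_snd has_derivative_ident)
    from pd_eq[OF this] have "pd f (x, v) (\<xi>, \<eta>) = (\<Sum>i\<in>UNIV. \<Sum>j\<in>UNIV. \<beta> i j (x, v) * (v $ i * \<eta> $ j + \<eta> $ i * v $ j)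
          + pd (\<beta> i j) (x, v) (\<xi>, \<eta>) * (v $ i * v $ j))"
      using pd_cong_open[OF T Tx[OF x] f, of "\<lambda>z. z"] by (simp add: f)
    moreover have "(\<Sum>i\<in>UNIV. \<Sum>j\<in>UNIV. \<beta> i j (x, v) * (v $ i * \<eta> $ j)) = (\<Sum>i\<in>UNIV. \<Sum>j\<in>UNIV. \<beta> i j (x, v) * v $ j * \<eta> $ i)"
      by (subst sum.swap) (simp add: sym algebra_simps)
    ultimately show ?thesis by (simp add: algebra_simps sum.distrib)
  qed
  have dfv: "pd f (x, v) (0, axis m 1) = k * (\<Sum>j\<in>UNIV. \<beta> m j (x, v) * v $ j)" if x: "x \<in> U" for x v m
  proof -
    have s1: "(\<Sum>j\<in>UNIV. pd (\<beta> i j) (x, v) (0, axis m 1) * (v $ i * v $ j)) = v $ i * ((k - 2) * \<beta> i m (x, v))" for i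
    proof -
      have "(\<Sum>j\<in>UNIV. pd (\<beta> i j) (x, v) (0, axis m 1) * (v $ i * v $ j))
          = v $ i * (\<Sum>j\<in>UNIV. v $ j * pd (\<beta> i m) (x, v) (0, axis j 1))"
        unfolding d\<beta>[OF x, of i _ v m] by (simp add: sum_distrib_left algebra_simps)
      then show ?thesis by (simp add: pd_expand_snd[OF dif(2)[OF x]] hom\<beta>[OF x])
    qed
    have s2: "(\<Sum>i\<in>UNIV. \<Sum>j\<in>UNIV. \<beta> i j (x, v) * v $ j * axis m 1 $ i) = (\<Sum>j\<in>UNIV. \<beta> m j (x, v) * v $ j)"
      by (subst sum.swap) (simp add: axis_def if_distrib cong: if_cong)
    have s3: "(\<Sum>i\<in>UNIV. v $ i * ((k - 2) * \<beta> i m (x, v))) = (k - 2) * (\<Sum>j\<in>UNIV. \<beta> m j (x, v) * v $ j)"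
      by (simp add: sum_distrib_left sym[of _ m] algebra_simps)
    show ?thesis unfolding df[OF x] s1 s2 s3 by (simp add: algebra_simps)
  qed
  have ddf: "pd (\<lambda>y. pd f y (0, axis m 1)) (x, v) (\<xi>, \<eta>)
      = k * (\<Sum>j\<in>UNIV. pd (\<beta> m j) (x, v) (\<xi>, \<eta>) * v $ j + \<beta> m j (x, v) * \<eta> $ j)"
    if x: "x \<in> U" for x v m \<xi> \<eta>
  proof -
    have "pd (\<lambda>y. pd f y (0, axis m 1)) (x, v) (\<xi>, \<eta>) = pd (\<lambda>z. k * (\<Sum>j\<in>UNIV. \<beta> m j z * snd z $ j)) (x, v) (\<xi>, \<eta>)"
      by (rule pd_cong_open[OF T Tx[OF x]]) (auto simp: T_def dfv)
    moreover have d: "((\<lambda>z. k * (\<Sum>j\<in>UNIV. \<beta> m j z * snd z $ j)) has_derivative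
       (\<lambda>h. k * (\<Sum>j\<in>UNIV. \<beta> m j (x, v) * snd h $ j + pd (\<beta> m j) (x, v) h * snd (x, v) $ j))) (at (x, v))"
      by (intro has_derivative_mult_right has_derivative_sum has_derivative_mult pd_works dif x
          has_derivative_nth has_derivative_snd has_derivative_ident)
    ultimately show ?thesis using pd_eq[OF d] by (simp add: add.commute)
  qed
  define Xi where "Xi = (\<Sum>j\<in>UNIV. \<Sum>l\<in>UNIV. pd (\<beta> j l) (x, v) (axis i 1, 0) * (v $ j * v $ l))"
  define Y where "Y = (\<Sum>j\<in>UNIV. v $ j * pd (\<beta> i j) (x, v) (v, 0))"
  have fx: "pd f (x, v) (axis i 1, 0) = Xi" using df[OF x] by (simp add: Xi_def)
  have s0: "(\<Sum>j\<in>UNIV. v $ j * pd (\<beta> i j) (x, v) (0, a)) = (k - 2) * (\<Sum>j\<in>UNIV. \<beta> i j (x, v) * a $ j)"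
  proof -
    have "(\<Sum>j\<in>UNIV. v $ j * pd (\<beta> i j) (x, v) (0, a)) = (\<Sum>j\<in>UNIV. \<Sum>l\<in>UNIV. v $ j * (a $ l * pd (\<beta> i j) (x, v) (0, axis l 1)))"
      by (simp add: pd_expand_snd[OF dif(2)[OF x], of a, symmetric] sum_distrib_left)
    also have "\<dots> = (\<Sum>l\<in>UNIV. \<Sum>j\<in>UNIV. v $ j * (a $ l * pd (\<beta> i j) (x, v) (0, axis l 1)))"
      by (rule sum.swap)
    also have "\<dots> = (\<Sum>l\<in>UNIV. a $ l * (\<Sum>j\<in>UNIV. v $ j * pd (\<beta> i l) (x, v) (0, axis j 1)))"
      by (intro sum.cong refl) (simp add: d\<beta>[OF x, of i _ v] sum_distrib_left algebra_simps)
    also have "\<dots> = (k - 2) * (\<Sum>j\<in>UNIV. \<beta> i j (x, v) * a $ j)"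
      by (simp add: pd_expand_snd[OF dif(2)[OF x]] hom\<beta>[OF x] sum_distrib_left algebra_simps)
    finally show ?thesis .
  qed
  have s1: "(\<Sum>j\<in>UNIV. pd (\<beta> i j) (x, v) (v, a) * v $ j + \<beta> i j (x, v) * a $ j)
      = Y + (\<Sum>j\<in>UNIV. v $ j * pd (\<beta> i j) (x, v) (0, a)) + (\<Sum>j\<in>UNIV. \<beta> i j (x, v) * a $ j)"
    unfolding Y_def pd_split[OF dif(2)[OF x], of _ _ _ v a] by (simp add: sum.distrib algebra_simps)
  have fv: "pd (\<lambda>y. pd f y (0, axis i 1)) (x, v) (v, a) = k * (Y + (k - 1) * (\<Sum>j\<in>UNIV. \<beta> i j (x, v) * a $ j))"
    unfolding ddf[OF x] s1 s0 by (simp add: algebra_simps)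
  have "(\<Sum>j\<in>UNIV. v $ j * (\<Sum>l\<in>UNIV. v $ l * (pd (\<lambda>z. pd (\<alpha> i) z (0, axis j 1)) (x, v) (0, axis l 1)
        - pd (\<lambda>z. pd (\<alpha> j) z (0, axis i 1)) (x, v) (0, axis l 1)))) = 2 * (Y - Xi)"
  proof -
    have "(\<Sum>j\<in>UNIV. v $ j * (\<Sum>l\<in>UNIV. v $ l * pd (\<beta> i l) (x, v) (axis j 1, 0)))
        = (\<Sum>j\<in>UNIV. \<Sum>l\<in>UNIV. v $ l * (v $ j * pd (\<beta> i l) (x, v) (axis j 1, 0)))"
      by (simp add: sum_distrib_left algebra_simps)
    also have "\<dots> = (\<Sum>l\<in>UNIV. \<Sum>j\<in>UNIV. v $ l * (v $ j * pd (\<beta> i l) (x, v) (axis j 1, 0)))"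
      by (rule sum.swap)
    also have "\<dots> = Y"
      unfolding Y_def by (simp add: sum_distrib_left[symmetric] pd_expand_fst[OF dif(2)[OF x]])
    finally have "(\<Sum>j\<in>UNIV. v $ j * (\<Sum>l\<in>UNIV. v $ l * pd (\<beta> i l) (x, v) (axis j 1, 0))) = Y" .
    moreover have "(\<Sum>j\<in>UNIV. v $ j * (\<Sum>l\<in>UNIV. v $ l * pd (\<beta> j l) (x, v) (axis i 1, 0))) = Xi"
      by (simp add: Xi_def sum_distrib_left algebra_simps)
    ultimately show ?thesis
      by (simp add: dd\<alpha>[OF x] right_diff_distrib sum_subtractf sum_distrib_left[symmetric] mult.left_commute[of _ 2])
  qed
  moreover have "(\<Sum>l\<in>UNIV. v $ l * (pd (\<lambda>z. pd (\<alpha> i) z (0, axis j 1)) (x, v) (0, axis l 1)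
        - pd (\<lambda>z. pd (\<alpha> j) z (0, axis i 1)) (x, v) (0, axis l 1)))
      = (k - 1) * (pd (\<alpha> i) (x, v) (0, axis j 1) - pd (\<alpha> j) (x, v) (0, axis i 1))" for j
  proof -
    have "pd (\<lambda>y. pd (\<alpha> i) y (0, u)) (x, v) (0, v) = (k - 1) * pd (\<alpha> i) (x, v) (0, u)" for i u
      by (rule pd_euler[OF T sm(1) Tx[OF x]]) (use hom\<alpha> in \<open>auto simp: T_def\<close>)
    then show ?thesis
      by (simp add: right_diff_distrib sum_subtractf
          pd_expand_snd[OF smooth_on_differentiable[OF smooth_on_pd[OF sm(1)] Tx[OF x]]])
  qed
  moreover have "(\<Sum>j\<in>UNIV. v $ j * (pd (\<alpha> i) (x, v) (0, axis j 1) - pd (\<alpha> j) (x, v) (0, axis i 1)))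
      = 2 * (k * \<alpha> i (x, v)) - 2 * Y"
  proof -
    have s2: "pd (\<alpha> i) (x, v) (0, axis j 1) - pd (\<alpha> j) (x, v) (0, axis i 1)
        = 2 * pd (\<alpha> i) (x, v) (0, axis j 1) - 2 * pd (\<beta> i j) (x, v) (v, 0)" for j
      using d\<alpha>[OF x, of i v j] by simp
    have "(\<Sum>j\<in>UNIV. v $ j * (pd (\<alpha> i) (x, v) (0, axis j 1) - pd (\<alpha> j) (x, v) (0, axis i 1)))
        = 2 * (\<Sum>j\<in>UNIV. v $ j * pd (\<alpha> i) (x, v) (0, axis j 1)) - 2 * Y"
      unfolding s2 by (simp add: Y_def right_diff_distrib sum_subtractf sum_distrib_left mult.left_commute[of _ 2])
    then show ?thesis by (simp add: pd_expand_snd[OF dif(1)[OF x]] hom\<alpha>[OF x])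
  qed
  ultimately have "(k - 1) * (2 * (k * \<alpha> i (x, v)) - 2 * Y) = 2 * (Y - Xi)"
    by (simp add: sum_distrib_left[symmetric] mult.left_commute[of _ "k - 1"])
  then have *: "k * (k - 1) * \<alpha> i (x, v) = k * Y - Xi" by (simp add: algebra_simps)
  have K: "k * (k - 1) \<noteq> 0" using k by simp
  have "- 1 / (k * (k - 1)) * (Xi - k * (Y + (k - 1) * b)) = \<alpha> i (x, v) + b" for b
  proof -
    have "k * (Y + (k - 1) * b) - Xi = k * (k - 1) * (\<alpha> i (x, v) + b)"
      using * by (simp add: algebra_simps)
    then have "(k * (Y + (k - 1) * b) - Xi) / (k * (k - 1)) = \<alpha> i (x, v) + b"
      using K nonzero_mult_div_cancel_left by metis
    moreover have "- 1 / (k * (k - 1)) * (Xi - W) = (W - Xi) / (k * (k - 1))" for W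
      by (simp add: diff_divide_distrib)
    ultimately show ?thesis by simp
  qed
  then show "e (x, v, a) $ i = - 1 / (k * (k - 1)) *
      (pd (energy e) (x, v) (axis i 1, 0) - pd (\<lambda>y. pd (energy e) y (0, axis i 1)) (x, v) (v, a))"
    unfolding f_def[symmetric] fx fv e[OF x] by simp
  show "pd (energy e) (x, v) (0, v) = k * energy e (x, v)"
    unfolding f_def[symmetric] df[OF x] f[OF Tx[OF x]]
    by (simp add: hom\<beta>[OF x] sum_distrib_left sum.distrib[symmetric] algebra_simps)
qed


section \<open>Lagrangians that differ by a total derivative\<close>

text \<open>Every function met in computing the Euler-Lagrange expressions below, the Lagrange function itself,
  its partial derivatives and the total derivative of one of them, has this shape.\<close>

lemma has_derivative_total:
  fixes F G H :: "'m::finite rn \<times> 'm rn \<Rightarrow> real"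
  assumes T: "open T" and F: "smooth_on T F" and G: "smooth_on T G" and H: "smooth_on T H" and x: "(x, v) \<in> T"
  shows "((\<lambda>(t, x, v, a). s * (t * (pd F (x, v) (v, a) + G (x, v))) + q * H (x, v)) has_derivative
    (\<lambda>(\<tau>, \<xi>, \<eta>, \<zeta>). s * (\<tau> * (pd F (x, v) (v, a) + G (x, v))
       + t * (pd (\<lambda>y. pd F y (v, a)) (x, v) (\<xi>, \<eta>) + pd F (x, v) (\<eta>, \<zeta>) + pd G (x, v) (\<xi>, \<eta>)))
       + q * pd H (x, v) (\<xi>, \<eta>))) (at (t, x, v, a))"
proof -
  define p where "p = (\<lambda>z :: 'm coords2. (fst (snd z), fst (snd (snd z))))"
  define g where "g = (\<lambda>z :: 'm coords2. (fst (snd (snd z)), snd (snd (snd z))))"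
  define z where "z = (t, x, v, a)"
  have p: "(p has_derivative p) (at z)" and g: "(g has_derivative g) (at z)"
    unfolding p_def g_def by (auto intro!: derivative_eq_intros)
  have pz: "p z \<in> T" using x by (simp add: z_def p_def)
  have "((\<lambda>z. s * (fst z * (pd F (p z) (g z) + G (p z))) + q * H (p z)) has_derivative
    (\<lambda>h. s * (fst z * ((pd (\<lambda>y. pd F y (g z)) (p z) (p h) + pd F (p z) (g h)) + pd G (p z) (p h))
         + fst h * (pd F (p z) (g z) + G (p z))) + q * pd H (p z) (p h))) (at z)"
    by (intro has_derivative_add has_derivative_mult_right has_derivative_mult has_derivative_fst has_derivative_ident
        has_derivative_pd_compose[OF T F pz p g] has_derivative_compose_pd[OF G pz p] has_derivative_compose_pd[OF H pz p])
  then show ?thesis by (simp add: p_def g_def z_def case_prod_unfold add.commute)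
qed

text \<open>The first summand of \<open>L\<close> is \<open>s\<close> times the total derivative of \<open>t f\<close>, up to \<open>- s f\<close>. As total derivatives
  have no Euler-Lagrange expressions, those of \<open>L\<close> are the ones of \<open>(q - s) f\<close>.\<close>

lemma euler_lagrange_total:
  fixes f :: "'m::finite rn \<times> 'm rn \<Rightarrow> real"
  assumes U: "open U" and f: "smooth_on (U \<times> UNIV) f" and x: "x \<in> U"
    and L: "\<And>t x v a. x \<in> U \<Longrightarrow> L (t, x, v, a) = s * (t * pd f (x, v) (v, a)) + q * f (x, v)"
  shows "euler_lagrange i L (t, x, v, a, b, w) =
    (q - s) * (pd f (x, v) (axis i 1, 0) - pd (\<lambda>y. pd f y (0, axis i 1)) (x, v) (v, a))"
proof -
  define T where "T = U \<times> (UNIV :: 'm rn set)"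
  define S4 where "S4 = (UNIV :: real set) \<times> U \<times> (UNIV :: 'm rn set) \<times> (UNIV :: 'm rn set)"
  define S5 where "S5 = (UNIV :: real set) \<times> U \<times> (UNIV :: 'm rn set) \<times> (UNIV :: 'm rn set) \<times> (UNIV :: 'm rn set)"
  have o: "open T" "open S4" "open S5" unfolding T_def S4_def S5_def by (intro open_Times open_UNIV U)+
  have Sx: "(x, v) \<in> T" "(t, x, v, a) \<in> S4" "(t, x, v, a, b) \<in> S5" if "x \<in> U" for t x v a b
    using that by (auto simp: T_def S4_def S5_def)
  note f = f[folded T_def]
  define f' where "f' = (\<lambda>z. pd f z (axis i 1, 0))"
  define g where "g = (\<lambda>z. pd f z (0, axis i 1))"
  have f': "smooth_on T f'" and g: "smooth_on T g" unfolding f'_def g_def by (rule smooth_on_pd[OF f])+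
  note c = smooth_on_const[of T "0::real"]
  have 0: "pd h (x, v) (0, 0) = 0" if "smooth_on T h" "x \<in> U" for h :: "_ \<Rightarrow> real" and x v
    using linear_0[OF linear_pd[OF smooth_on_differentiable[OF that(1) Sx(1)[OF that(2)]]]] by (simp add: zero_prod_def)
  have Lz: "L z = (\<lambda>(t, x, v, a). s * (t * (pd f (x, v) (v, a) + 0)) + q * f (x, v)) z" if "z \<in> S4" for z
    using that by (auto simp: S4_def L)
  have dL: "pd L (t, x, v, a) (\<tau>, \<xi>, \<eta>, \<zeta>) = s * (\<tau> * pd f (x, v) (v, a)
       + t * (pd (\<lambda>y. pd f y (v, a)) (x, v) (\<xi>, \<eta>) + pd f (x, v) (\<eta>, \<zeta>))) + q * pd f (x, v) (\<xi>, \<eta>)"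
    if "x \<in> U" for t x v a \<tau> \<xi> \<eta> \<zeta>
    using pd_cong_open[OF o(2) Sx(2)[OF that] Lz] pd_eq[OF has_derivative_total[OF o(1) f c f Sx(1)[OF that], where s = s and q = q]]
    by simp
  have 1: "pd L (t, x, v, a) (0, axis i 1, 0, 0) = s * (t * pd f' (x, v) (v, a)) + q * f' (x, v)"
    unfolding dL[OF x] using pd_commute[OF o(1) f Sx(1)[OF x, of v], where u = "(v, a)" and v = "(axis i 1, 0)"]
    by (simp add: f'_def 0[OF f x])
  define M where "M = (\<lambda>z. pd L z (0, 0, axis i 1, 0))"
  have Mz: "M z = (\<lambda>(t, x, v, a). s * (t * (pd g (x, v) (v, a) + f' (x, v))) + q * g (x, v)) z" if "z \<in> S4" for z
  proof -
    obtain t x v a where z: "z = (t, x, v, a)" "x \<in> U" using \<open>z \<in> S4\<close> by (cases z) (auto simp: S4_def)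
    show ?thesis unfolding z(1) M_def
      using pd_commute[OF o(1) f Sx(1)[OF z(2), of v], where u = "(v, a)" and v = "(0, axis i 1)"] by (simp add: dL[OF z(2)] g_def f'_def)
  qed
  have "(M has_derivative (\<lambda>(\<tau>, \<xi>, \<eta>, \<zeta>). s * (\<tau> * (pd g (x, v) (v, a) + f' (x, v))
       + t * (pd (\<lambda>y. pd g y (v, a)) (x, v) (\<xi>, \<eta>) + pd g (x, v) (\<eta>, \<zeta>) + pd f' (x, v) (\<xi>, \<eta>)))
       + q * pd g (x, v) (\<xi>, \<eta>))) (at (t, x, v, a))"
    by (rule iffD2[OF has_derivative_cong_open[OF o(2) Sx(2)[OF x] Mz], rotated], rule has_derivative_total[OF o(1) g f' g Sx(1)[OF x]], assumption)
  from td2_has_derivative[OF this] have 2: "td2 M (t, x, v, a, b) = s * (pd g (x, v) (v, a) + f' (x, v)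
       + t * (pd (\<lambda>y. pd g y (v, a)) (x, v) (v, a) + pd g (x, v) (a, b) + pd f' (x, v) (v, a))) + q * pd g (x, v) (v, a)"
    by simp
  define N where "N = (\<lambda>z. pd L z (0, 0, 0, axis i 1))"
  have Nz: "N z = (\<lambda>(t, x, v, a). s * (t * (pd (\<lambda>_. 0) (x, v) (v, a) + g (x, v))) + 0 * g (x, v)) z" if "z \<in> S4" for z
    using that by (auto simp: S4_def N_def dL g_def 0[OF f] 0[OF smooth_on_pd[OF f]])
  have tN: "td2 N z = (\<lambda>(t, x, v, a, b). s * (t * (pd g (x, v) (v, a) + 0)) + s * g (x, v)) z" if "z \<in> S5" for z
  proof -
    obtain t x v a b where z: "z = (t, x, v, a, b)" "x \<in> U" using \<open>z \<in> S5\<close> by (cases z) (auto simp: S5_def)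
    have "(N has_derivative (\<lambda>(\<tau>, \<xi>, \<eta>, \<zeta>). s * (\<tau> * (pd (\<lambda>_. 0) (x, v) (v, a) + g (x, v))
       + t * (pd (\<lambda>y. pd (\<lambda>_. 0) y (v, a)) (x, v) (\<xi>, \<eta>) + pd (\<lambda>_. 0) (x, v) (\<eta>, \<zeta>) + pd g (x, v) (\<xi>, \<eta>)))
       + 0 * pd g (x, v) (\<xi>, \<eta>))) (at (t, x, v, a))"
      by (rule iffD2[OF has_derivative_cong_open[OF o(2) Sx(2)[OF z(2)] Nz], rotated], rule has_derivative_total[OF o(1) c g g Sx(1)[OF z(2)]], assumption)
    from td2_has_derivative[OF this] show ?thesis by (simp add: z(1) algebra_simps)
  qed
  have "(td2 N has_derivative (\<lambda>(\<tau>, \<xi>, \<eta>, \<zeta>, \<beta>). s * (\<tau> * (pd g (x, v) (v, a) + 0)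
       + t * (pd (\<lambda>y. pd g y (v, a)) (x, v) (\<xi>, \<eta>) + pd g (x, v) (\<eta>, \<zeta>) + pd (\<lambda>_. 0) (x, v) (\<xi>, \<eta>)))
       + s * pd g (x, v) (\<xi>, \<eta>))) (at (t, x, v, a, b))"
    by (rule iffD2[OF has_derivative_cong_open[OF o(3) Sx(3)[OF x] tN], rotated], rule has_derivative_forget_last[OF has_derivative_total[OF o(1) g c g Sx(1)[OF x]], unfolded prod.case], assumption)
  from td3_has_derivative[OF this] have 3: "td3 (td2 N) (t, x, v, a, b, w) = s * (pd g (x, v) (v, a)
       + t * (pd (\<lambda>y. pd g y (v, a)) (x, v) (v, a) + pd g (x, v) (a, b))) + s * pd g (x, v) (v, a)"
    by simp
  show ?thesis
    unfolding euler_lagrange.simps M_def[symmetric] N_def[symmetric] 1 2 3 f'_def[symmetric] g_def[symmetric]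
    by (simp add: f'_def algebra_simps)
qed


section \<open>The two forms in one chart\<close>

lemma sum_telescope_linorder:
  fixes h :: "'m::{finite,linorder} set \<Rightarrow> real"
  shows "(\<Sum>l\<in>UNIV. h {p. p < l} - h {p. p \<le> l}) = h {} - h UNIV"
proof -
  have "(\<Sum>l\<in>A. h {p\<in>A. p < l} - h {p\<in>A. p \<le> l}) = h {} - h A" if "finite A" for A :: "'m set"
    using that
  proof (induction A rule: finite_linorder_max_induct)
    case (insert b A)
    have "{p \<in> insert b A. p < l} = {p \<in> A. p < l}" "{p \<in> insert b A. p \<le> l} = {p \<in> A. p \<le> l}"
      if "l \<in> A" for l
      using insert.hyps that by auto
    moreover have "{p \<in> insert b A. p < b} = A" "{p \<in> insert b A. p \<le> b} = insert b A"
      using insert.hyps by (auto intro: less_imp_le)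
    moreover have "b \<notin> A" using insert.hyps by auto
    ultimately show ?case using insert by simp
  qed simp
  from this[of UNIV] show ?thesis by simp
qed

text \<open>Here \<open>f\<close> is an arbitrary function of degree \<open>k\<close> in the velocities, and \<open>A\<close>, \<open>B\<close> are the coefficients of
  the Euler-Lagrange expressions of \<open>r f\<close>.\<close>

context
  fixes U :: "'m::{finite,linorder} rn set" and f :: "'m rn \<times> 'm rn \<Rightarrow> real" and k r :: real
  assumes U: "open U" and f: "smooth_on (U \<times> UNIV) f" and k: "k \<noteq> 0" "k \<noteq> 1"
    and euler: "\<And>x v. x \<in> U \<Longrightarrow> pd f (x, v) (0, v) = k * f (x, v)"
    and r: "r = - 1 / (k * (k - 1))"
begin

lemma open_fibred: "open (U \<times> (UNIV :: 'm rn set))"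
  by (intro open_Times open_UNIV U)

lemma r_identities: "r * (k - 1) = - 1 / k" "1 / r = - (k * (k - 1))" "r \<noteq> 0"
  using k by (auto simp: r divide_simps)

lemma euler_fibre: "x \<in> U \<Longrightarrow> pd (\<lambda>y. pd f y (0, u)) (x, v) (0, v) = (k - 1) * pd f (x, v) (0, u)"
  by (rule pd_euler[OF open_fibred f]) (auto simp: euler)

lemma euler_base:
  assumes x: "x \<in> U"
  shows "pd (\<lambda>y. pd f y (u, 0)) (x, v) (0, v) = k * pd f (x, v) (u, 0)"
proof -
  have xT: "(x, v) \<in> U \<times> UNIV" using x by simp
  have "((\<lambda>z. pd f z (0, snd z)) has_derivative
      (\<lambda>h. pd (\<lambda>y. pd f y (0, snd (x, v))) (x, v) h + pd f (x, v) (0, snd h))) (at (x, v))"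
    by (rule has_derivative_pd_compose[OF open_fibred f, of "\<lambda>z. z"]) (use x in \<open>auto intro!: derivative_eq_intros\<close>)
  from fun_cong[OF pd_eq[OF this], of "(u, 0)"]
  have "pd (\<lambda>y. pd f y (0, v)) (x, v) (u, 0) = pd (\<lambda>z. pd f z (0, snd z)) (x, v) (u, 0)"
    using linear_0[OF linear_pd[OF smooth_on_differentiable[OF f xT]]] by (simp add: zero_prod_def)
  also have "\<dots> = pd (\<lambda>z. k * f z) (x, v) (u, 0)"
    by (rule pd_cong_open[OF open_fibred xT]) (auto simp: euler)
  also have "\<dots> = k * pd f (x, v) (u, 0)"
    by (rule pd_cmult[OF smooth_on_differentiable[OF f xT]])
  finally show ?thesis
    using pd_commute[OF open_fibred f xT, where u = "(u, 0)" and v = "(0, v)"] by simp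
qed

text \<open>The term \<open>v\<^sup>j \<partial>A\<^sub>i / \<partial>v\<^sup>j\<close> is \<open>k A\<^sub>i\<close> by homogeneity. The other term of the curl,
  \<open>v\<^sup>j \<partial>A\<^sub>j / \<partial>v\<^sup>i\<close>, is obtained by differentiating the contraction \<open>A\<^sub>j v\<^sup>j\<close>, which is
  \<open>(\<partial>f / \<partial>x\<^sup>j) v\<^sup>j / k\<close>. After cancellation only \<open>\<partial>f / \<partial>x\<^sup>i\<close> is left.\<close>

lemma mu0_formula:
  assumes x: "x \<in> U"
    and A: "\<And>x v i. x \<in> U \<Longrightarrow> A c (x, v) $ i = r * (pd f (x, v) (axis i 1, 0) - pd (\<lambda>y. pd f y (0, axis i 1)) (x, v) (v, 0))"
    and smA: "\<And>i. smooth_on (U \<times> UNIV) (\<lambda>w. A c w $ i)"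
    and eulerA: "\<And>x v i. x \<in> U \<Longrightarrow> pd (\<lambda>w. A c w $ i) (x, v) (0, v) = k * A c (x, v) $ i"
    and B: "\<And>x v i j. x \<in> U \<Longrightarrow> B c (x, v) $ i $ j = - r * pd (\<lambda>y. pd f y (0, axis i 1)) (x, v) (0, axis j 1)"
  shows "mu0 A B c (t, x, v) (\<tau>, \<xi>, \<eta>) = - (t / k) * pd f (x, v) (\<xi>, \<eta>)"
proof -
  define T where "T = U \<times> (UNIV :: 'm rn set)"
  note T = open_fibred[folded T_def] and f = f[folded T_def]
  have xT: "(x, v) \<in> T" using x by (simp add: T_def)
  have difA: "(\<lambda>w. A c w $ i) differentiable at (x, v)" for i
    using smooth_on_differentiable[OF smA] x by simp
  have dif: "f differentiable at (x, v)" "(\<lambda>y. pd f y h) differentiable at (x, v)" for h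
    using smooth_on_differentiable[OF f xT] smooth_on_differentiable[OF smooth_on_pd[OF f] xT] by auto
  have 1: "(\<Sum>j\<in>UNIV. pd (\<lambda>w. A c w $ i) (x, v) (0, axis j 1) * v $ j) = k * A c (x, v) $ i" for i
    using pd_expand_snd[OF difA, of v i] eulerA[OF x] by (simp add: mult.commute)
  have power: "(\<Sum>j\<in>UNIV. A c z $ j * snd z $ j) = pd f z (snd z, 0) / k" if "z \<in> T" for z
  proof -
    obtain x v where z: "z = (x, v)" and x: "x \<in> U" using \<open>z \<in> T\<close> by (cases z) (auto simp: T_def)
    have xT: "(x, v) \<in> T" using x by (simp add: T_def)
    have "(\<Sum>j\<in>UNIV. A c (x, v) $ j * v $ j)
        = r * ((\<Sum>j\<in>UNIV. v $ j * pd f (x, v) (axis j 1, 0)) - (\<Sum>j\<in>UNIV. v $ j * pd (\<lambda>y. pd f y (v, 0)) (x, v) (0, axis j 1)))"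
      using pd_commute[OF T f xT, where v = "(v, 0)"]
      by (simp add: A[OF x] algebra_simps sum_distrib_left sum_subtractf)
    also have "\<dots> = r * (pd f (x, v) (v, 0) - k * pd f (x, v) (v, 0))"
      using pd_expand_fst[OF smooth_on_differentiable[OF f xT], of v]
        pd_expand_snd[OF smooth_on_differentiable[OF smooth_on_pd[OF f] xT], of v]
      by (simp add: euler_base[OF x])
    also have "\<dots> = - (r * (k - 1)) * pd f (x, v) (v, 0)" by (simp add: algebra_simps)
    finally show ?thesis unfolding r_identities(1) by (simp add: z)
  qed
  have 2: "(\<Sum>j\<in>UNIV. pd (\<lambda>w. A c w $ j) (x, v) (0, axis i 1) * v $ j)
      = 2 / k * pd f (x, v) (axis i 1, 0) + (k - 2) * A c (x, v) $ i" for i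
  proof -
    have "((\<lambda>z. \<Sum>j\<in>UNIV. A c z $ j * snd z $ j) has_derivative
        (\<lambda>h. \<Sum>j\<in>UNIV. A c (x, v) $ j * snd h $ j + pd (\<lambda>w. A c w $ j) (x, v) h * snd (x, v) $ j)) (at (x, v))"
      by (intro has_derivative_sum has_derivative_mult pd_works difA
          has_derivative_nth has_derivative_snd has_derivative_ident)
    from fun_cong[OF pd_eq[OF this], of "(0, axis i 1)"]
    have "pd (\<lambda>z. \<Sum>j\<in>UNIV. A c z $ j * snd z $ j) (x, v) (0, axis i 1)
        = A c (x, v) $ i + (\<Sum>j\<in>UNIV. pd (\<lambda>w. A c w $ j) (x, v) (0, axis i 1) * v $ j)"
      by (simp add: sum.distrib axis_def if_distrib[of "\<lambda>r. _ * r"] cong: if_cong)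
    moreover have "pd (\<lambda>z. \<Sum>j\<in>UNIV. A c z $ j * snd z $ j) (x, v) (0, axis i 1)
        = pd (\<lambda>z. 1 / k * pd f z (snd z, 0)) (x, v) (0, axis i 1)"
      by (rule pd_cong_open[OF T xT]) (simp add: power)
    moreover have "\<dots> = 1 / k * (pd (\<lambda>y. pd f y (v, 0)) (x, v) (0, axis i 1) + pd f (x, v) (axis i 1, 0))"
    proof -
      have "((\<lambda>z. pd f z (snd z, 0)) has_derivative
          (\<lambda>h. pd (\<lambda>y. pd f y (snd (x, v), 0)) (x, v) h + pd f (x, v) (snd h, 0))) (at (x, v))"
        by (rule has_derivative_pd_compose[OF T f, of "\<lambda>z. z"]) (use xT in \<open>auto intro!: derivative_eq_intros\<close>)
      from pd_eq[OF has_derivative_mult_right[OF this, of "1 / k"]] show ?thesis by simp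
    qed
    moreover have "pd (\<lambda>y. pd f y (v, 0)) (x, v) (0, axis i 1) = pd f (x, v) (axis i 1, 0) + k * (k - 1) * A c (x, v) $ i"
    proof -
      have "A c (x, v) $ i / r = pd f (x, v) (axis i 1, 0) - pd (\<lambda>y. pd f y (0, axis i 1)) (x, v) (v, 0)"
        using r_identities(3) A[OF x] by simp
      moreover have "A c (x, v) $ i / r = - (k * (k - 1)) * A c (x, v) $ i"
        using r_identities(2) by (metis divide_inverse inverse_eq_divide mult.commute)
      ultimately show ?thesis
        using pd_commute[OF T f xT, where v = "(v, 0)" and u = "(0, axis i 1)"] by simp
    qed
    ultimately have "A c (x, v) $ i + (\<Sum>j\<in>UNIV. pd (\<lambda>w. A c w $ j) (x, v) (0, axis i 1) * v $ j)
        = 1 / k * (pd f (x, v) (axis i 1, 0) + k * (k - 1) * A c (x, v) $ i + pd f (x, v) (axis i 1, 0))"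
      by simp
    also have "\<dots> = 2 / k * pd f (x, v) (axis i 1, 0) + (k - 1) * A c (x, v) $ i"
      using k by (simp add: field_simps)
    finally show ?thesis by (simp add: algebra_simps)
  qed
  have 3: "A c (x, v) $ i - 1 / 2 * (\<Sum>j\<in>UNIV. (pd (\<lambda>w. A c w $ i) (x, v) (0, axis j 1)
        - pd (\<lambda>w. A c w $ j) (x, v) (0, axis i 1)) * v $ j) = pd f (x, v) (axis i 1, 0) / k" for i
    by (simp add: left_diff_distrib sum_subtractf 1 2) (simp add: diff_divide_distrib algebra_simps)
  have 4: "(\<Sum>i\<in>UNIV. B c (x, v) $ i $ j * v $ i) = pd f (x, v) (0, axis j 1) / k" for j
  proof -
    have "(\<Sum>i\<in>UNIV. B c (x, v) $ i $ j * v $ i)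
        = - r * (\<Sum>i\<in>UNIV. v $ i * pd (\<lambda>y. pd f y (0, axis j 1)) (x, v) (0, axis i 1))"
      using pd_commute[OF T f xT, where u = "(0, axis j 1)"]
      by (simp add: B[OF x] sum_distrib_left sum_negf algebra_simps)
    also have "\<dots> = - (r * (k - 1)) * pd f (x, v) (0, axis j 1)"
      by (simp add: pd_expand_snd[OF dif(2)] euler_fibre[OF x])
    finally show ?thesis unfolding r_identities(1) by simp
  qed
  have "mu0 A B c (t, x, v) (\<tau>, \<xi>, \<eta>)
      = - (\<Sum>i\<in>UNIV. pd f (x, v) (axis i 1, 0) / k * t * \<xi> $ i)
        - (\<Sum>i\<in>UNIV. \<Sum>j\<in>UNIV. B c (x, v) $ i $ j * v $ i * t * \<eta> $ j)"
    unfolding mu0.simps 3 ..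
  also have "(\<Sum>i\<in>UNIV. \<Sum>j\<in>UNIV. B c (x, v) $ i $ j * v $ i * t * \<eta> $ j)
      = (\<Sum>j\<in>UNIV. (\<Sum>i\<in>UNIV. B c (x, v) $ i $ j * v $ i) * (t * \<eta> $ j))"
    by (subst sum.swap) (simp add: sum_distrib_right mult.assoc)
  also have "\<dots> = t / k * (\<Sum>j\<in>UNIV. \<eta> $ j * pd f (x, v) (0, axis j 1))"
    unfolding 4 by (simp add: sum_distrib_left algebra_simps)
  also have "(\<Sum>i\<in>UNIV. pd f (x, v) (axis i 1, 0) / k * t * \<xi> $ i) = t / k * (\<Sum>i\<in>UNIV. \<xi> $ i * pd f (x, v) (axis i 1, 0))"
    by (simp add: sum_distrib_left algebra_simps)
  finally show ?thesis
    unfolding pd_expand_fst[OF dif(1)] pd_expand_snd[OF dif(1)] pd_split[OF dif(1), of \<xi> \<eta>]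
    by (simp add: algebra_simps)
qed

text \<open>Each integrand is the derivative of \<open>- r \<partial>f / \<partial>v\<^sup>j\<close> along the \<open>l\<close>-th segment of the path that
  switches on the coordinates of \<open>v\<close> from the last to the first, so the sum over \<open>l\<close> telescopes. The
  contribution of the starting point \<open>v = 0\<close> vanishes because \<open>\<partial>f / \<partial>v\<^sup>j\<close> is homogeneous of
  the nonzero degree \<open>k - 1\<close>.\<close>

lemma kappa_formula:
  assumes x: "x \<in> U"
    and B: "\<And>x v i j. x \<in> U \<Longrightarrow> B c (x, v) $ i $ j = - r * pd (\<lambda>y. pd f y (0, axis i 1)) (x, v) (0, axis j 1)"
  shows "kappa B c (t, x, v) (\<tau>, \<xi>, \<eta>) = r * pd f (x, v) (0, \<xi>)"
proof -
  have xT: "(x, w) \<in> U \<times> UNIV" for w using x by simp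
  define cut where "cut = (\<lambda>D. \<chi> p. if p \<in> D then 0 else v $ p)"
  define h where "h = (\<lambda>j D. - r * pd f (x, cut D) (0, axis j 1))"
  have int: "(LBINT \<nu>=0..ereal (v $ l). B c (x, \<chi> p. if p < l then 0 else if p = l then \<nu> else v $ p) $ j $ l)
      = h j {p. p < l} - h j {p. p \<le> l}" for j l
  proof -
    define w where "w = (\<lambda>\<nu>. \<chi> p. if p < l then 0 else if p = l then \<nu> else v $ p)"
    have w: "((\<lambda>\<nu>. (x, w \<nu>)) has_vector_derivative (0, axis l 1)) (at \<nu>)" for \<nu>
    proof -
      have "w = (\<lambda>\<nu>. w 0 + \<nu> *\<^sub>R axis l 1)"
        by (auto simp: w_def vec_eq_iff fun_eq_iff axis_def)
      moreover have "((\<lambda>\<nu>. w 0 + \<nu> *\<^sub>R axis l 1) has_vector_derivative axis l 1) (at \<nu>)"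
        by (auto intro!: derivative_eq_intros)
      ultimately have "(w has_vector_derivative axis l 1) (at \<nu>)" by simp
      then show ?thesis by (intro has_vector_derivative_Pair has_vector_derivative_const)
    qed
    have along: "((\<lambda>\<nu>. K (x, w \<nu>)) has_vector_derivative pd K (x, w \<nu>) (0, axis l 1)) (at \<nu>)"
      if "smooth_on (U \<times> UNIV) K" for K :: "_ \<Rightarrow> real" and \<nu>
      by (rule has_vector_derivative_chain[OF w smooth_on_differentiable[OF that xT]])
    define G where "G = (\<lambda>\<nu>. - r * pd f (x, w \<nu>) (0, axis j 1))"
    have G: "(G has_vector_derivative B c (x, w \<nu>) $ j $ l) (at \<nu>)" for \<nu>
      unfolding G_def B[OF x] using has_vector_derivative_mult_right[OF along[OF smooth_on_pd[OF f]], of "- r"] by simp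
    have "isCont (\<lambda>\<nu>. B c (x, w \<nu>) $ j $ l) \<nu>" for \<nu>
      unfolding B[OF x]
      using has_vector_derivative_continuous[OF has_vector_derivative_mult_right[OF along[OF smooth_on_pd[OF smooth_on_pd[OF f]]], of "- r"]]
      by simp
    then have "(LBINT \<nu>=ereal 0..ereal (v $ l). B c (x, w \<nu>) $ j $ l) = G (v $ l) - G 0"
      by (intro interval_integral_FTC_finite continuous_at_imp_continuous_on ballI has_vector_derivative_at_within[OF G])
    moreover have "w (v $ l) = cut {p. p < l}" "w 0 = cut {p. p \<le> l}"
      by (auto simp: w_def cut_def vec_eq_iff)
    ultimately show ?thesis by (simp add: G_def h_def w_def zero_ereal_def)
  qed
  have "pd f (x, 0) (0, axis j 1) = 0" for j
  proof -
    have "(k - 1) * pd f (x, 0) (0, axis j 1) = 0"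
      using euler_fibre[OF x, of "axis j 1" 0]
        linear_0[OF linear_pd[OF smooth_on_differentiable[OF smooth_on_pd[OF f] xT]]] by (simp add: zero_prod_def)
    then show ?thesis using k by simp
  qed
  moreover have "cut {} = v" "cut UNIV = 0" by (auto simp: cut_def vec_eq_iff)
  ultimately have sum: "(\<Sum>l\<in>UNIV. h j {p. p < l} - h j {p. p \<le> l}) = - r * pd f (x, v) (0, axis j 1)" for j
    unfolding sum_telescope_linorder by (simp add: h_def)
  have "kappa B c (t, x, v) (\<tau>, \<xi>, \<eta>) = - (\<Sum>j\<in>UNIV. (- r * pd f (x, v) (0, axis j 1)) * \<xi> $ j)"
    unfolding kappa_def prod.case int sum ..
  also have "\<dots> = r * (\<Sum>j\<in>UNIV. \<xi> $ j * pd f (x, v) (0, axis j 1))"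
    by (simp add: sum_distrib_left sum_negf algebra_simps)
  finally show ?thesis unfolding pd_expand_snd[OF smooth_on_differentiable[OF f xT]] .
qed

end


section \<open>Change of chart\<close>

lemma pd_nth:
  fixes F :: "'a::euclidean_space \<Rightarrow> real ^ 'm::finite"
  assumes "F differentiable at z"
  shows "pd F z h $ i = pd (\<lambda>y. F y $ i) z h"
  using pd_eq[OF bounded_linear.has_derivative[OF bounded_linear_vec_nth pd_works[OF assms]], of i] by simp

lemma pd_commute_vec:
  fixes F :: "'a::euclidean_space \<Rightarrow> real ^ 'm::finite"
  assumes "open S" "smooth_on S F" "z \<in> S"
  shows "pd (\<lambda>y. pd F y u) z v = pd (\<lambda>y. pd F y v) z u"
proof -
  have "pd (\<lambda>y. pd F y u) z v $ i = pd (\<lambda>y. pd (\<lambda>y. F y $ i) y u) z v" for u v i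
    using pd_nth[OF smooth_on_differentiable[OF smooth_on_pd[OF assms(2)] assms(3)]]
      pd_cong_open[OF assms(1,3), of "\<lambda>y. pd F y u $ i"] pd_nth[OF smooth_on_differentiable[OF assms(2)]]
    by simp
  then show ?thesis
    using pd_commute[OF assms(1) smooth_on_nth[OF assms(1,2)] assms(3), of _ u v] by (simp add: vec_eq_iff)
qed

lemma has_derivative_velocity_map:
  fixes \<phi> :: "'a::euclidean_space \<Rightarrow> 'a"
  assumes W: "open W" and \<phi>: "smooth_on W \<phi>" and x: "x \<in> W"
  shows "((\<lambda>z. (\<phi> (fst z), pd \<phi> (fst z) (snd z))) has_derivative
    (\<lambda>h. (pd \<phi> x (fst h), pd (dlift \<phi>) (x, v) h))) (at (x, v))"
proof -
  have "((\<lambda>z. \<phi> (fst z)) has_derivative (\<lambda>h. pd \<phi> (fst (x, v)) (fst h))) (at (x, v))"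
    by (rule has_derivative_compose_pd[OF \<phi>]) (auto intro!: derivative_eq_intros simp: x)
  moreover have "(dlift \<phi> has_derivative pd (dlift \<phi>) (x, v)) (at (x, v))"
    by (rule pd_works[OF smooth_on_differentiable[OF smooth_on_dlift[OF W \<phi>]]]) (simp add: x)
  then have "((\<lambda>z. pd \<phi> (fst z) (snd z)) has_derivative pd (dlift \<phi>) (x, v)) (at (x, v))"
    by (simp add: dlift_def case_prod_unfold)
  ultimately show ?thesis using has_derivative_Pair by fastforce
qed

context
  fixes \<phi> :: "'m::finite rn \<Rightarrow> 'm rn" and W T and f f' :: "'m rn \<times> 'm rn \<Rightarrow> real"
  assumes W: "open W" and \<phi>: "smooth_on W \<phi>" and T: "open T" and f': "smooth_on T f'"
    and maps: "\<And>x v. x \<in> W \<Longrightarrow> (\<phi> x, pd \<phi> x v) \<in> T"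
    and eq: "\<And>x v. x \<in> W \<Longrightarrow> f (x, v) = f' (\<phi> x, pd \<phi> x v)"
begin

lemma open_fibred_overlap: "open (W \<times> (UNIV :: 'm rn set))"
  by (intro open_Times open_UNIV W)

lemma pd_velocity_map:
  assumes x: "x \<in> W"
  shows "pd f (x, v) h = pd f' (\<phi> x, pd \<phi> x v) (pd \<phi> x (fst h), pd (dlift \<phi>) (x, v) h)"
proof -
  have xW: "(x, v) \<in> W \<times> UNIV" using x by simp
  have "pd f (x, v) h = pd (\<lambda>z. f' (\<phi> (fst z), pd \<phi> (fst z) (snd z))) (x, v) h"
    by (rule pd_cong_open[OF open_fibred_overlap xW]) (auto simp: eq)
  moreover have "((\<lambda>z. f' (\<phi> (fst z), pd \<phi> (fst z) (snd z))) has_derivative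
      (\<lambda>h. pd f' (\<phi> (fst (x, v)), pd \<phi> (fst (x, v)) (snd (x, v))) (pd \<phi> x (fst h), pd (dlift \<phi>) (x, v) h))) (at (x, v))"
    by (rule has_derivative_compose_pd[OF f' _ has_derivative_velocity_map[OF W \<phi> x]]) (simp add: maps[OF x])
  from pd_eq[OF this] show ?thesis using calculation by simp
qed

lemma dlift_vertical: "x \<in> W \<Longrightarrow> pd (dlift \<phi>) (x, v) (0, \<eta>) = pd \<phi> x \<eta>"
  using pd_dlift[OF W \<phi>, of x v 0 \<eta>]
    linear_0[OF linear_pd[OF smooth_on_differentiable[OF smooth_on_pd[OF \<phi>, of v]]], of x] by simp

lemma pd_velocity_map_vertical: "x \<in> W \<Longrightarrow> pd f (x, v) (0, \<eta>) = pd f' (\<phi> x, pd \<phi> x v) (0, pd \<phi> x \<eta>)"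
  using linear_0[OF linear_pd[OF smooth_on_differentiable[OF \<phi>]]] by (simp add: pd_velocity_map dlift_vertical)

text \<open>Both terms on the left produce an additional summand with the second derivative of \<open>\<phi>\<close> in the
  directions \<open>v\<close> and \<open>\<xi>\<close>; by its symmetry the two cancel.\<close>

lemma euler_lagrange_natural:
  assumes x: "x \<in> W"
  shows "pd f (x, v) (\<xi>, 0) - pd (\<lambda>y. pd f y (0, \<xi>)) (x, v) (v, a)
    = pd f' (\<phi> x, pd \<phi> x v) (pd \<phi> x \<xi>, 0)
      - pd (\<lambda>y. pd f' y (0, pd \<phi> x \<xi>)) (\<phi> x, pd \<phi> x v) (pd \<phi> x v, pd (dlift \<phi>) (x, v) (v, a))"
proof -
  have xW: "(x, v) \<in> W \<times> UNIV" using x by simp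
  define z where "z = (\<phi> x, pd \<phi> x v)"
  have z: "z \<in> T" unfolding z_def by (rule maps[OF x])
  \<comment> \<open>the second derivative of the coordinate change in the directions v and xi\<close>
  define D where "D = pd (\<lambda>y. pd \<phi> y \<xi>) x v"
  have D: "pd (dlift \<phi>) (x, v) (\<xi>, 0) = D"
    using pd_dlift[OF W \<phi> x, of v \<xi> 0] pd_commute_vec[OF W \<phi> x, of v \<xi>]
      linear_0[OF linear_pd[OF smooth_on_differentiable[OF \<phi> x]]] by (simp add: D_def)
  have 1: "pd f (x, v) (\<xi>, 0) = pd f' z (pd \<phi> x \<xi>, 0) + pd f' z (0, D)"
    unfolding pd_velocity_map[OF x] D z_def[symmetric] fst_conv
    by (rule pd_split[OF smooth_on_differentiable[OF f' z]])
  have "pd (\<lambda>y. pd f y (0, \<xi>)) (x, v) (v, a)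
      = pd (\<lambda>y. pd f' (\<phi> (fst y), pd \<phi> (fst y) (snd y)) (0, pd \<phi> (fst y) \<xi>)) (x, v) (v, a)"
    by (rule pd_cong_open[OF open_fibred_overlap xW]) (auto simp: pd_velocity_map_vertical)
  moreover have "((\<lambda>y. pd f' (\<phi> (fst y), pd \<phi> (fst y) (snd y)) (0, pd \<phi> (fst y) \<xi>)) has_derivative
      (\<lambda>h. pd (\<lambda>y. pd f' y (0, pd \<phi> (fst (x, v)) \<xi>)) (\<phi> (fst (x, v)), pd \<phi> (fst (x, v)) (snd (x, v)))
             (pd \<phi> x (fst h), pd (dlift \<phi>) (x, v) h)
        + pd f' (\<phi> (fst (x, v)), pd \<phi> (fst (x, v)) (snd (x, v))) (0, pd (\<lambda>y. pd \<phi> y \<xi>) x (fst h)))) (at (x, v))"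
  proof (rule has_derivative_pd_compose[OF T f' _ has_derivative_velocity_map[OF W \<phi> x]])
    have "((\<lambda>y. pd \<phi> (fst y) \<xi>) has_derivative (\<lambda>h. pd (\<lambda>y. pd \<phi> y \<xi>) (fst (x, v)) (fst h))) (at (x, v))"
      by (rule has_derivative_compose_pd[OF smooth_on_pd[OF \<phi>]]) (auto intro!: derivative_eq_intros simp: x)
    then show "((\<lambda>y. (0, pd \<phi> (fst y) \<xi>)) has_derivative (\<lambda>h. (0, pd (\<lambda>y. pd \<phi> y \<xi>) x (fst h)))) (at (x, v))"
      by (auto intro: has_derivative_Pair)
  qed (simp add: maps[OF x])
  from pd_eq[OF this] have "pd (\<lambda>y. pd f' (\<phi> (fst y), pd \<phi> (fst y) (snd y)) (0, pd \<phi> (fst y) \<xi>)) (x, v) (v, a)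
      = pd (\<lambda>y. pd f' y (0, pd \<phi> x \<xi>)) z (pd \<phi> x v, pd (dlift \<phi>) (x, v) (v, a)) + pd f' z (0, D)"
    by (simp add: z_def D_def)
  ultimately show ?thesis using 1 by (simp add: z_def)
qed

end

locale homogeneous_variational = manifold X \<A>
  for X :: "'p topology" and \<A> :: "('p, real ^ 'm::{finite,linorder}) chart set" +
  fixes k r :: real and \<epsilon> e
  assumes k: "k \<noteq> 0" "k \<noteq> 1" and r: "r = - 1 / (k * (k - 1))"
    and source: "source_form \<A> \<epsilon> e" and locvar: "locally_variational X \<A> e"
    and hom: "homogeneous_coeffs \<A> k e"
begin

abbreviation en where "en c \<equiv> energy (e c)"

lemma open_prod: "c \<in> \<A> \<Longrightarrow> open (chart_image c \<times> (UNIV :: 'm rn set))"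
  by (intro open_Times open_UNIV open_chart_image)

lemma wedge_dt:
  assumes "fst Z = 0" "fst Y = 1"
  shows "(\<Sum>i\<in>UNIV. u $ i * wedge (contact i z) fst Z Y) = u \<bullet> fst (snd Z)"
  using assms by (cases z; cases Z; cases Y) (simp add: wedge_def inner_vec_def)

text \<open>Inserting \<open>\<partial>/\<partial>t\<close> into the second slot of the source form leaves the covector with components \<open>e\<close>.\<close>

lemma source_contract:
  assumes "c \<in> \<A>" "x \<in> chart_image c" "fst Z = 0" "fst Y = 1"
  shows "\<epsilon> c (t, x, v, a) Z Y = e c (x, v, a) \<bullet> fst (snd Z)"
proof -
  have "(t, x, v, a) \<in> chart_image (rt2 \<A> c)" using assms by (simp add: chart_image_rt2)
  then have "\<epsilon> c (t, x, v, a) Z Y = (\<Sum>i\<in>UNIV. e c (x, v, a) $ i * wedge (contact i (t, x, v, a)) fst Z Y)"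
    using source assms(1) unfolding source_form_def by blast
  then show ?thesis using wedge_dt[OF assms(3,4)] by simp
qed

lemma smooth_e:
  assumes c: "c \<in> \<A>"
  shows "smooth_on (chart_image c \<times> UNIV \<times> UNIV) (\<lambda>w. e c w $ i)"
proof -
  define S where "S = chart_image c \<times> (UNIV :: 'm rn set) \<times> (UNIV :: 'm rn set)"
  have S: "open S" unfolding S_def by (intro open_Times open_UNIV open_chart_image c)
  have "smooth_on (chart_image (rt2 \<A> c)) (\<lambda>z. \<epsilon> c z (0, axis i 1, 0, 0) (1, 0, 0, 0))"
    using source c unfolding source_form_def form2_def by blast
  moreover have "smooth_on S (\<lambda>w. (0 :: real, w))" by (intro smooth_intros S)
  ultimately have "smooth_on S (\<lambda>w. \<epsilon> c (0, w) (0, axis i 1, 0, 0) (1, 0, 0, 0))"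
    by (rule smooth_on_compose_UNIV[OF S]) (auto simp: chart_image_rt2 c S_def)
  moreover have "\<epsilon> c (0, w) (0, axis i 1, 0, 0) (1, 0, 0, 0) = e c w $ i" if "w \<in> S" for w
  proof -
    obtain x v a where w: "w = (x, v, a)" "x \<in> chart_image c" using \<open>w \<in> S\<close> by (cases w) (auto simp: S_def)
    show ?thesis
      using source_contract[OF c w(2), of "(0, axis i 1, 0, 0)" "(1, 0, 0, 0)" 0 v a]
      by (simp add: w(1) inner_axis)
  qed
  ultimately show ?thesis
    unfolding S_def[symmetric]
    using smooth_on_cong[OF S, of "\<lambda>w. \<epsilon> c (0, w) (0, axis i 1, 0, 0) (1, 0, 0, 0)" "\<lambda>w. e c w $ i"] by simp
qed

lemma transition_rt2_derivative:
  fixes t :: real and x v a :: "'m rn"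
  assumes c: "c \<in> \<A>" and d: "d \<in> \<A>" and x: "x \<in> overlap c d"
  defines "D \<equiv> frechet_derivative (transition (rt2 \<A> c) (rt2 \<A> d)) (at (t, x, v, a))"
  shows "fst (D h) = fst h" and "fst (snd (D h)) = pd (transition c d) x (fst (snd h))"
proof -
  define W where "W = overlap c d"
  define \<phi> where "\<phi> = transition c d"
  have W: "open W" "smooth_on W \<phi>" "x \<in> W"
    using open_overlap[OF c d] smooth_transition[OF c d] x by (auto simp: W_def \<phi>_def)
  define S where "S = (UNIV :: real set) \<times> W \<times> (UNIV :: 'm rn set) \<times> (UNIV :: 'm rn set)"
  have S: "open S" unfolding S_def by (intro open_Times open_UNIV W)
  define z where "z = (t, x, v, a)"
  have z: "z \<in> S" by (simp add: z_def S_def W)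
  define g where "g = (\<lambda>z :: 'm coords2. (pd \<phi> (fst (snd z)) (fst (snd (snd z))),
      pd (dlift \<phi>) (fst (snd z), fst (snd (snd z))) (fst (snd (snd z)), snd (snd (snd z)))))"
  define \<tau> where "\<tau> = transition (rt2 \<A> c) (rt2 \<A> d)"
  have \<tau>: "\<tau> y = (fst y, \<phi> (fst (snd y)), g y)" if "y \<in> S" for y
    using that transition_rt2[OF c d] by (auto simp: S_def W_def \<tau>_def \<phi>_def g_def)
  have "smooth_on S g" unfolding g_def
    by (intro smooth_on_Pair smooth_on_pd_compose[OF S W(2)] smooth_on_pd_compose[OF S smooth_on_dlift[OF W(1,2)]] smooth_intros S)
      (auto simp: S_def)
  then have "(g has_derivative pd g z) (at z)" by (intro pd_works smooth_on_differentiable[OF _ z])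
  moreover have "((\<lambda>y. \<phi> (fst (snd y))) has_derivative (\<lambda>h. pd \<phi> (fst (snd z)) (fst (snd h)))) (at z)"
    by (rule has_derivative_compose_pd[OF W(2)]) (auto intro!: derivative_eq_intros simp: z_def W)
  moreover have "(fst has_derivative fst) (at z)" by (auto intro!: derivative_eq_intros)
  ultimately have "((\<lambda>y. (fst y, \<phi> (fst (snd y)), g y)) has_derivative
      (\<lambda>h. (fst h, pd \<phi> (fst (snd z)) (fst (snd h)), pd g z h))) (at z)"
    by (intro has_derivative_Pair)
  then have "(\<tau> has_derivative (\<lambda>h. (fst h, pd \<phi> (fst (snd z)) (fst (snd h)), pd g z h))) (at z)"
    using has_derivative_cong_open[OF S z, of \<tau> "\<lambda>y. (fst y, \<phi> (fst (snd y)), g y)"] \<tau> by blast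
  then have "D = (\<lambda>h. (fst h, pd \<phi> x (fst (snd h)), pd g z h))"
    unfolding D_def z_def[symmetric] \<tau>_def[symmetric]
    using frechet_derivative_at by (fastforce simp: z_def)
  then show "fst (D h) = fst h" and "fst (snd (D h)) = pd (transition c d) x (fst (snd h))"
    by (simp_all add: \<phi>_def)
qed

text \<open>The transition maps preserve \<open>\<partial>/\<partial>t\<close> and act on the base directions by the derivative of \<open>\<phi>\<close>,
  so contraction with these directions shows that \<open>e\<close> transforms as a covector.\<close>

lemma e_transform:
  assumes c: "c \<in> \<A>" and d: "d \<in> \<A>" and x: "x \<in> overlap c d"
  defines "\<phi> \<equiv> transition c d"
  shows "e c (x, v, a) \<bullet> \<xi> = e d (\<phi> x, pd \<phi> x v, pd (dlift \<phi>) (x, v) (v, a)) \<bullet> pd \<phi> x \<xi>"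
proof -
  define z where "z = (0 :: real, x, v, a)"
  define \<tau> where "\<tau> = transition (rt2 \<A> c) (rt2 \<A> d)"
  define D where "D = frechet_derivative \<tau> (at z)"
  have D: "fst (D h) = fst h" "fst (snd (D h)) = pd \<phi> x (fst (snd h))" for h
    unfolding D_def \<tau>_def z_def \<phi>_def by (rule transition_rt2_derivative[OF c d x])+
  have "z \<in> overlap (rt2 \<A> c) (rt2 \<A> d)" using x by (simp add: overlap_rt2[OF c d] z_def)
  then have "\<epsilon> c z (0, \<xi>, 0, 0) (1, 0, 0, 0) = \<epsilon> d (\<tau> z) (D (0, \<xi>, 0, 0)) (D (1, 0, 0, 0))"
    using source c d unfolding source_form_def form2_def D_def \<tau>_def by blast
  moreover have "\<epsilon> c z (0, \<xi>, 0, 0) (1, 0, 0, 0) = e c (x, v, a) \<bullet> \<xi>"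
    using source_contract[OF c subsetD[OF overlap_subset x]] by (simp add: z_def)
  moreover have "\<phi> x \<in> chart_image d"
    unfolding \<phi>_def by (rule subsetD[OF overlap_subset transition_in_overlap[OF c x]])
  then have "\<epsilon> d (\<tau> z) (D (0, \<xi>, 0, 0)) (D (1, 0, 0, 0))
      = e d (\<phi> x, pd \<phi> x v, pd (dlift \<phi>) (x, v) (v, a)) \<bullet> pd \<phi> x \<xi>"
    using source_contract[OF d, of "\<phi> x" "D (0, \<xi>, 0, 0)" "D (1, 0, 0, 0)"] transition_rt2[OF c d x]
    by (simp add: D z_def \<tau>_def \<phi>_def)
  ultimately show ?thesis by simp
qed

lemma smooth_en:
  assumes c: "c \<in> \<A>"
  shows "smooth_on (chart_image c \<times> UNIV) (en c)"
proof -
  note S = open_prod[OF c]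
  have "smooth_on (chart_image c \<times> UNIV) (\<lambda>z. \<Sum>i\<in>UNIV. (e c (fst z, snd z, snd z) $ i - e c (fst z, snd z, 0) $ i) * snd z $ i)"
    by (intro smooth_intros S smooth_on_compose_UNIV[OF S smooth_e[OF c]]) auto
  moreover have "(\<lambda>z. \<Sum>i\<in>UNIV. (e c (fst z, snd z, snd z) $ i - e c (fst z, snd z, 0) $ i) * snd z $ i) = en c"
    by (simp add: energy_def inner_vec_def case_prod_unfold)
  ultimately show ?thesis by simp
qed

text \<open>At the point \<open>x\<close> of the chart \<open>c\<close> the components are the Euler-Lagrange expressions of \<open>r\<close> times the
  energy, and the energy is homogeneous. The components are contracted with \<open>\<xi>\<close> because the
  transformation rules are stated for the covector.\<close>

definition energy_form_at where
  "energy_form_at c x \<longleftrightarrow> (\<forall>v. pd (en c) (x, v) (0, v) = k * en c (x, v)) \<and>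
     (\<forall>v a \<xi>. e c (x, v, a) \<bullet> \<xi> = r * (pd (en c) (x, v) (\<xi>, 0) - pd (\<lambda>y. pd (en c) y (0, \<xi>)) (x, v) (v, a)))"

text \<open>By \<open>e_transform\<close> the energy in \<open>c\<close> is the increment of \<open>e d\<close> when the image of \<open>v\<close> is added to the
  acceleration, taken at the acceleration that corresponds to \<open>0\<close>. Since \<open>e d\<close> is affine in the
  acceleration, this increment may be taken at \<open>0\<close> instead.\<close>

lemma energy_invariant:
  assumes c: "c \<in> \<A>" and d: "d \<in> \<A>" and x: "x \<in> overlap c d" and n: "energy_form_at d (transition c d x)"
  shows "en c (x, v) = en d (transition c d x, pd (transition c d) x v)"
proof -
  define \<phi> where "\<phi> = transition c d"
  have \<phi>: "smooth_on (overlap c d) \<phi>" unfolding \<phi>_def by (rule smooth_transition[OF c d])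
  define z where "z = (\<phi> x, pd \<phi> x v)"
  have "\<phi> x \<in> chart_image d"
    unfolding \<phi>_def by (rule subsetD[OF overlap_subset transition_in_overlap[OF c x]])
  then have dif: "(\<lambda>y. pd (en d) y h) differentiable at z" for h
    using smooth_on_differentiable[OF smooth_on_pd[OF smooth_en[OF d]]] by (simp add: z_def)
  have aff: "(e d (fst z, snd z, a + b) - e d (fst z, snd z, a)) \<bullet> \<xi> = - r * pd (\<lambda>y. pd (en d) y (0, \<xi>)) z (0, b)" for a b \<xi>
  proof -
    have E: "e d (fst z, snd z, a) \<bullet> \<xi> = r * (pd (en d) z (\<xi>, 0) - pd (\<lambda>y. pd (en d) y (0, \<xi>)) z (snd z, a))" for a
      using n by (simp add: energy_form_at_def z_def \<phi>_def)
    have "pd (\<lambda>y. pd (en d) y (0, \<xi>)) z (snd z, a + b) = pd (\<lambda>y. pd (en d) y (0, \<xi>)) z (snd z, a) + pd (\<lambda>y. pd (en d) y (0, \<xi>)) z (0, b)"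
      using linear_add[OF linear_pd[OF dif], of _ "(snd z, a)" "(0, b)"] by simp
    then show ?thesis by (simp add: inner_diff_left E algebra_simps)
  qed
  have acc: "pd (dlift \<phi>) (x, v) (v, a) = pd (dlift \<phi>) (x, v) (v, 0) + pd \<phi> x a" for a
    using pd_dlift[OF open_overlap[OF c d] \<phi> x, of v v] linear_0[OF linear_pd[OF smooth_on_differentiable[OF \<phi> x]]]
    by simp
  have tr: "e c (x, v, a) \<bullet> v = e d (fst z, snd z, pd (dlift \<phi>) (x, v) (v, 0) + pd \<phi> x a) \<bullet> snd z" for a
    using e_transform[OF c d x, of v a v] unfolding \<phi>_def[symmetric] acc[symmetric] by (simp add: z_def)
  have "pd \<phi> x 0 = 0" using linear_0[OF linear_pd[OF smooth_on_differentiable[OF \<phi> x]]] .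
  then have "en c (x, v) = (e d (fst z, snd z, pd (dlift \<phi>) (x, v) (v, 0) + snd z) - e d (fst z, snd z, pd (dlift \<phi>) (x, v) (v, 0))) \<bullet> snd z"
    using tr[of v] tr[of 0] by (simp add: energy_def inner_diff_left z_def)
  also have "\<dots> = (e d (fst z, snd z, 0 + snd z) - e d (fst z, snd z, 0)) \<bullet> snd z"
    unfolding aff ..
  finally show ?thesis by (simp add: energy_def z_def \<phi>_def)
qed

lemma maps_overlap:
  assumes "c \<in> \<A>" "x \<in> overlap c d"
  shows "(transition c d x, pd (transition c d) x v) \<in> chart_image d \<times> UNIV"
  using subsetD[OF overlap_subset transition_in_overlap[OF assms]] by simp

lemma energy_form_transfer:
  assumes c: "c \<in> \<A>" and d: "d \<in> \<A>" and x: "x \<in> overlap c d"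
    and n: "\<And>y. y \<in> overlap c d \<Longrightarrow> energy_form_at d (transition c d y)"
  shows "energy_form_at c x"
proof -
  have inv: "en c (y, v) = en d (transition c d y, pd (transition c d) y v)" if "y \<in> overlap c d" for y v
    by (rule energy_invariant[OF c d that n[OF that]])
  note nat = open_overlap[OF c d] smooth_transition[OF c d] open_prod[OF d] smooth_en[OF d] maps_overlap[OF c] inv
  have "pd (en c) (x, v) (0, v) = k * en c (x, v)" for v
    using pd_velocity_map_vertical[OF nat x, of v v] n[OF x] energy_invariant[OF c d x n[OF x], of v]
    by (simp add: energy_form_at_def)
  moreover have "e c (x, v, a) \<bullet> \<xi> = r * (pd (en c) (x, v) (\<xi>, 0) - pd (\<lambda>y. pd (en c) y (0, \<xi>)) (x, v) (v, a))" for v a \<xi>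
  proof -
    have "pd (en c) (x, v) (\<xi>, 0) - pd (\<lambda>y. pd (en c) y (0, \<xi>)) (x, v) (v, a)
        = pd (en d) (transition c d x, pd (transition c d) x v) (pd (transition c d) x \<xi>, 0)
          - pd (\<lambda>y. pd (en d) y (0, pd (transition c d) x \<xi>)) (transition c d x, pd (transition c d) x v)
              (pd (transition c d) x v, pd (dlift (transition c d)) (x, v) (v, a))"
      by (rule euler_lagrange_natural[OF nat x])
    then show ?thesis
      using e_transform[OF c d x, of v a \<xi>] n[OF x] by (simp add: energy_form_at_def)
  qed
  ultimately show ?thesis unfolding energy_form_at_def by blast
qed

end


section \<open>Globalization\<close>

lemma sum_pd_vertical:
  fixes f :: "'m::finite rn \<times> 'm rn \<Rightarrow> real"
  assumes "open T" "smooth_on T f" "z \<in> T"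
  shows "(\<Sum>i\<in>UNIV. \<xi> $ i * pd (\<lambda>y. pd f y (0, axis i 1)) z h) = pd (\<lambda>y. pd f y (0, \<xi>)) z h"
  using pd_expand_snd[OF smooth_on_differentiable[OF smooth_on_pd[OF assms(2)] assms(3)], of \<xi> h]
  unfolding pd_commute[OF assms, of h] .

context homogeneous_variational
begin

lemma homogeneous_e:
  assumes "c \<in> \<A>" "x \<in> chart_image c"
  shows "homogeneous_at k (\<lambda>w. e c w $ i) (x, v, a)"
proof -
  have "(0, x, v, a) \<in> chart_image (rt2 \<A> c)" using assms by (simp add: chart_image_rt2)
  then show ?thesis using hom assms(1) unfolding homogeneous_coeffs_def by blast
qed

lemma energy_form_of_lagrangian:
  assumes c: "c \<in> \<A>" and L: "lagrange_function \<A> c (e c) L" and x: "x \<in> chart_image c"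
  shows "energy_form_at c x"
proof -
  define U where "U = chart_image c"
  have U: "open U" and xU: "x \<in> U" using open_chart_image[OF c] x by (auto simp: U_def)
  have smL: "smooth_on (UNIV \<times> U \<times> UNIV \<times> UNIV) L"
    using L c by (simp add: lagrange_function_def chart_image_rt2 U_def)
  have EL: "e c (x, v, a) $ i = euler_lagrange i L (t, x, v, a, b, w)" if "x \<in> U" for t x v a b w i
  proof -
    have "(t, x, v, a) \<in> chart_image (rt2 \<A> c)" using that c by (simp add: chart_image_rt2 U_def)
    then show ?thesis using L unfolding lagrange_function_def by blast
  qed
  have hom': "homogeneous_at k (\<lambda>w. e c w $ i) (x, v, a)" if "x \<in> U" for x v a i
    by (rule homogeneous_e[OF c that[unfolded U_def]])
  have chart: "e c (x, v, a) $ i = r * (pd (en c) (x, v) (axis i 1, 0) - pd (\<lambda>y. pd (en c) y (0, axis i 1)) (x, v) (v, a))"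
    "pd (en c) (x, v) (0, v) = k * en c (x, v)" for v a i
    unfolding r by (rule variational_homogeneous_chart[OF U smL EL hom' k xU]; assumption)+
  have "e c (x, v, a) \<bullet> \<xi> = r * (pd (en c) (x, v) (\<xi>, 0) - pd (\<lambda>y. pd (en c) y (0, \<xi>)) (x, v) (v, a))" for v a \<xi>
  proof -
    have xT: "(x, v) \<in> chart_image c \<times> UNIV" using x by simp
    have "e c (x, v, a) \<bullet> \<xi> = r * ((\<Sum>i\<in>UNIV. \<xi> $ i * pd (en c) (x, v) (axis i 1, 0))
        - (\<Sum>i\<in>UNIV. \<xi> $ i * pd (\<lambda>y. pd (en c) y (0, axis i 1)) (x, v) (v, a)))"
      unfolding inner_vec_def inner_real_def chart(1)
      by (simp add: sum_subtractf sum_distrib_left algebra_simps)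
    then show ?thesis
      unfolding sum_pd_vertical[OF open_prod[OF c] smooth_en[OF c] xT]
        pd_expand_fst[OF smooth_on_differentiable[OF smooth_en[OF c] xT]] .
  qed
  moreover have "pd (en c) (x, v) (0, v) = k * en c (x, v)" for v
    using chart(2)[of v] by assumption
  ultimately show ?thesis by (simp only: energy_form_at_def simp_thms)
qed

text \<open>A chart of the covering around the given point has a Lagrange function, hence the property at all of
  its points, and passes it on.\<close>

lemma energy_form_everywhere:
  assumes c: "c \<in> \<A>" and x: "x \<in> chart_image c"
  shows "energy_form_at c x"
proof -
  obtain \<C> where C: "\<C> \<subseteq> \<A>" "(\<Union>c\<in>\<C>. fst c) = topspace X" "\<forall>c\<in>\<C>. \<exists>L. lagrange_function \<A> c (e c) L"
    using locvar unfolding locally_variational_def by (elim exE conjE) (rule that)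
  have p: "chart_inv c x \<in> fst c" "snd c (chart_inv c x) = x" by (rule chart_inv_image[OF x])+
  have "(\<Union>c\<in>\<A>. fst c) = topspace X" using mfd by (simp add: smooth_manifold_def)
  then have "chart_inv c x \<in> topspace X" using p(1) c by blast
  then obtain d where d: "d \<in> \<C>" "chart_inv c x \<in> fst d" using C(2) by blast
  have dA: "d \<in> \<A>" using d(1) C(1) by blast
  obtain L where L: "lagrange_function \<A> d (e d) L" using bspec[OF C(3) d(1)] ..
  show ?thesis
  proof (rule energy_form_transfer[OF c dA])
    show "x \<in> overlap c d" using mem_overlap_iff[OF c p(1), of d] d(2) p(2) by simp
    show "energy_form_at d (transition c d y)" if "y \<in> overlap c d" for y
      by (rule energy_form_of_lagrangian[OF dA L subsetD[OF overlap_subset transition_in_overlap[OF c that]]])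
  qed
qed

lemma euler_en: "c \<in> \<A> \<Longrightarrow> x \<in> chart_image c \<Longrightarrow> pd (en c) (x, v) (0, v) = k * en c (x, v)"
  using energy_form_everywhere by (simp add: energy_form_at_def)

lemma e_formula:
  assumes "c \<in> \<A>" "x \<in> chart_image c"
  shows "e c (x, v, a) $ i = r * (pd (en c) (x, v) (axis i 1, 0) - pd (\<lambda>y. pd (en c) y (0, axis i 1)) (x, v) (v, a))"
proof -
  have "e c (x, v, a) $ i = e c (x, v, a) \<bullet> axis i 1" by (simp add: inner_axis)
  then show ?thesis using energy_form_everywhere[OF assms] by (simp add: energy_form_at_def)
qed

lemma en_invariant:
  assumes "c \<in> \<A>" "d \<in> \<A>" "x \<in> overlap c d"
  shows "en c (x, v) = en d (transition c d x, pd (transition c d) x v)"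
  by (rule energy_invariant[OF assms energy_form_everywhere[OF assms(2) subsetD[OF overlap_subset transition_in_overlap[OF assms(1,3)]]]])

lemma pd_en_transform:
  assumes "c \<in> \<A>" "d \<in> \<A>" "x \<in> overlap c d"
  shows "pd (en c) (x, v) h = pd (en d) (transition c d x, pd (transition c d) x v)
      (pd (transition c d) x (fst h), pd (dlift (transition c d)) (x, v) h)"
    and "pd (en c) (x, v) (0, \<eta>) = pd (en d) (transition c d x, pd (transition c d) x v) (0, pd (transition c d) x \<eta>)"
proof -
  note nat = open_overlap[OF assms(1,2)] smooth_transition[OF assms(1,2)] open_prod[OF assms(2)] smooth_en[OF assms(2)]
    maps_overlap[OF assms(1)] en_invariant[OF assms(1,2)]
  show "pd (en c) (x, v) h = pd (en d) (transition c d x, pd (transition c d) x v)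
      (pd (transition c d) x (fst h), pd (dlift (transition c d)) (x, v) h)"
    by (rule pd_velocity_map[OF nat assms(3)])
  show "pd (en c) (x, v) (0, \<eta>) = pd (en d) (transition c d x, pd (transition c d) x v) (0, pd (transition c d) x \<eta>)"
    by (rule pd_velocity_map_vertical[OF nat assms(3)])
qed

text \<open>On the image of a chart these are the coefficients of the components, which are affine in the
  acceleration.\<close>

definition A0 where "A0 c = (\<lambda>(x, v). e c (x, v, 0))"

definition B0 where
  "B0 c = (\<lambda>z. \<chi> i j. - r * pd (\<lambda>y. pd (en c) y (0, axis i 1)) z (0, axis j 1))"

lemma smooth_A0:
  assumes c: "c \<in> \<A>"
  shows "smooth_on (chart_image c \<times> UNIV) (\<lambda>w. A0 c w $ i)"
  unfolding A0_def case_prod_unfold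
  by (rule smooth_on_compose_UNIV[OF open_prod[OF c] smooth_e[OF c]])
    (intro smooth_intros open_prod[OF c], auto)

lemma affine_A0_B0: "affine_coeffs \<A> e A0 B0"
  unfolding affine_coeffs_def
proof (intro ballI conjI)
  fix c assume c: "c \<in> \<A>"
  note S = open_prod[OF c] and f = smooth_en[OF c]
  have "smooth_on (chart_image c \<times> UNIV) (\<lambda>w. \<chi> i. A0 c w $ i)"
    by (intro smooth_on_vec_lambda S smooth_A0[OF c])
  then show "smooth_on (chart_image c \<times> UNIV) (A0 c)" by simp
  show "smooth_on (chart_image c \<times> UNIV) (B0 c)"
    unfolding B0_def by (intro smooth_on_vec_lambda S smooth_on_mult smooth_on_const smooth_on_pd f)
  fix z assume "z \<in> chart_image (rt2 \<A> c)"
  then obtain t x v a where z: "z = (t, x, v, a)" and x: "x \<in> chart_image c"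
    using chart_image_rt2[OF c] by (cases z) auto
  have xT: "(x, v) \<in> chart_image c \<times> UNIV" using x by simp
  have dif: "(\<lambda>y. pd (en c) y h) differentiable at (x, v)" for h
    by (rule smooth_on_differentiable[OF smooth_on_pd[OF f] xT])
  have "e c (x, v, a) $ i = A0 c (x, v) $ i + (\<Sum>j\<in>UNIV. B0 c (x, v) $ i $ j * a $ j)" for i
  proof -
    have "(\<Sum>j\<in>UNIV. B0 c (x, v) $ i $ j * a $ j) = - r * pd (\<lambda>y. pd (en c) y (0, axis i 1)) (x, v) (0, a)"
      unfolding pd_expand_snd[OF dif, of a, symmetric]
      by (simp add: B0_def sum_distrib_left sum_negf algebra_simps)
    then show ?thesis
      using pd_split[OF dif, of "(0, axis i 1)" v a] by (simp add: A0_def e_formula[OF c x] algebra_simps)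
  qed
  moreover have "B0 c (x, v) $ i $ j = B0 c (x, v) $ j $ i" for i j
    using pd_commute[OF S f xT, of "(0, axis i 1)" "(0, axis j 1)"] by (simp add: B0_def)
  ultimately show "case z of (t, x, v, a) \<Rightarrow> \<forall>i. e c (x, v, a) $ i = A0 c (x, v) $ i + (\<Sum>j\<in>UNIV. B0 c (x, v) $ i $ j * a $ j) \<and>
      (\<forall>j. B0 c (x, v) $ i $ j = B0 c (x, v) $ j $ i)"
    by (simp add: z)
qed

lemma euler_A0:
  assumes c: "c \<in> \<A>" and x: "x \<in> chart_image c"
  shows "pd (\<lambda>w. A0 c w $ i) (x, v) (0, v) = k * A0 c (x, v) $ i"
proof -
  have x3: "(x, v, 0) \<in> chart_image c \<times> UNIV \<times> UNIV" using x by simp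
  have l: "linear (pd (\<lambda>w. e c w $ i) (x, v, 0))"
    by (rule linear_pd[OF smooth_on_differentiable[OF smooth_e[OF c] x3]])
  have "linear (\<lambda>u. pd (\<lambda>w. e c w $ i) (x, v, 0) (0, u, 0))"
    by (rule linear_compose[OF _ l, unfolded o_def]) (auto intro!: linearI)
  then have "pd (\<lambda>w. e c w $ i) (x, v, 0) (0, v, 0) = k * e c (x, v, 0) $ i"
    using homogeneous_e[OF c x, of i v 0] linear_vec_expansion_real[of "\<lambda>u. pd (\<lambda>w. e c w $ i) (x, v, 0) (0, u, 0)" v]
    by (simp add: homogeneous_at_def)
  moreover have "((\<lambda>z. e c (fst z, snd z, 0) $ i) has_derivative
      (\<lambda>h. pd (\<lambda>w. e c w $ i) (fst (x, v), snd (x, v), 0) (fst h, snd h, 0))) (at (x, v))"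
    by (rule has_derivative_compose_pd[OF smooth_e[OF c]]) (auto intro!: derivative_eq_intros simp: x)
  from pd_eq[OF this] have "pd (\<lambda>w. A0 c w $ i) (x, v) (0, v) = pd (\<lambda>w. e c w $ i) (x, v, 0) (0, v, 0)"
    by (simp add: A0_def case_prod_unfold)
  ultimately show ?thesis by (simp add: A0_def)
qed

lemma mu0_eq:
  assumes c: "c \<in> \<A>" and x: "x \<in> chart_image c"
  shows "mu0 A0 B0 c (t, x, v) (\<tau>, \<xi>, \<eta>) = - (t / k) * pd (en c) (x, v) (\<xi>, \<eta>)"
proof (rule mu0_formula[OF open_chart_image[OF c] smooth_en[OF c] k euler_en[OF c] r x])
  show "smooth_on (chart_image c \<times> UNIV) (\<lambda>w. A0 c w $ i)" for i by (rule smooth_A0[OF c])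
  show "pd (\<lambda>w. A0 c w $ i) (x, v) (0, v) = k * A0 c (x, v) $ i" if "x \<in> chart_image c" for x v i
    by (rule euler_A0[OF c that])
qed (simp_all add: A0_def e_formula[OF c] B0_def)

lemma kappa_eq:
  assumes c: "c \<in> \<A>" and x: "x \<in> chart_image c"
  shows "kappa B0 c (t, x, v) (\<tau>, \<xi>, \<eta>) = r * pd (en c) (x, v) (0, \<xi>)"
  by (rule kappa_formula[OF open_chart_image[OF c] smooth_en[OF c] k euler_en[OF c] r x]) (simp_all add: B0_def)

text \<open>The differential of an invariant function and its vertical part, regarded as a semibasic form, are
  both invariant.\<close>

lemma form1_energy:
  assumes \<alpha>: "\<And>c t x v \<tau> \<xi> \<eta>. c \<in> \<A> \<Longrightarrow> x \<in> chart_image c \<Longrightarrow>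
    \<alpha> c (t, x, v) (\<tau>, \<xi>, \<eta>) = p * t * pd (en c) (x, v) (\<xi>, \<eta>) + q * pd (en c) (x, v) (0, \<xi>)"
  shows "form1 (rt1 \<A>) \<A> \<alpha>"
  unfolding form1_def
proof (intro conjI ballI allI)
  fix c assume c: "c \<in> \<A>"
  have oS: "open (UNIV \<times> chart_image c \<times> UNIV :: ('m coords1) set)"
    by (intro open_Times open_UNIV open_chart_image c)
  have \<alpha>': "\<alpha> c z Y = p * fst z * pd (en c) (snd z) (snd Y) + q * pd (en c) (snd z) (0, fst (snd Y))"
    if "z \<in> UNIV \<times> chart_image c \<times> UNIV" for z Y
    using that \<alpha>[OF c, of "fst (snd z)" "fst z" "snd (snd z)" "fst Y" "fst (snd Y)" "snd (snd Y)"] by auto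
  show "linear (\<alpha> c z)" if "z \<in> chart_image (rt1 \<A> c)" for z
  proof -
    have z: "z \<in> UNIV \<times> chart_image c \<times> UNIV" using that chart_image_rt1[OF c] by simp
    then have l: "linear (pd (en c) (snd z))"
      by (intro linear_pd smooth_on_differentiable[OF smooth_en[OF c]]) auto
    have lin: "linear (\<lambda>Y :: 'm coords1. pd (en c) (snd z) (snd Y))" "linear (\<lambda>Y :: 'm coords1. pd (en c) (snd z) (0, fst (snd Y)))"
      by (rule linear_compose[OF _ l, unfolded o_def]; auto intro!: linearI)+
    have scale: "linear (\<lambda>Y. b * h Y)" if "linear h" for b and h :: "'m coords1 \<Rightarrow> real"
      by (rule linearI) (simp_all add: linear_add[OF that] linear_scale[OF that] algebra_simps)
    have "linear (\<lambda>Y :: 'm coords1. p * fst z * pd (en c) (snd z) (snd Y) + q * pd (en c) (snd z) (0, fst (snd Y)))"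
      by (rule linear_compose_add[OF scale[OF lin(1)] scale[OF lin(2)]])
    moreover have "\<alpha> c z = (\<lambda>Y. p * fst z * pd (en c) (snd z) (snd Y) + q * pd (en c) (snd z) (0, fst (snd Y)))"
      by (rule ext) (rule \<alpha>'[OF z])
    ultimately show ?thesis by (simp only:)
  qed
  show "smooth_on (chart_image (rt1 \<A> c)) (\<lambda>z. \<alpha> c z Y)" for Y
  proof -
    have "smooth_on (UNIV \<times> chart_image c \<times> UNIV)
        (\<lambda>z. p * fst z * pd (en c) (snd z) (snd Y) + q * pd (en c) (snd z) (0, fst (snd Y)))"
      by (intro smooth_on_add smooth_on_mult smooth_on_const smooth_on_fst smooth_on_ident oS
          smooth_on_compose_UNIV[OF oS smooth_on_pd[OF smooth_en[OF c]]] smooth_on_snd) auto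
    then show ?thesis
      unfolding chart_image_rt1[OF c]
      using smooth_on_cong[OF oS, of "\<lambda>z. \<alpha> c z Y"
          "\<lambda>z. p * fst z * pd (en c) (snd z) (snd Y) + q * pd (en c) (snd z) (0, fst (snd Y))"] \<alpha>' by simp
  qed
next
  fix c d and z Y :: "'m coords1"
  assume c: "c \<in> \<A>" and d: "d \<in> \<A>" and z: "z \<in> overlap (rt1 \<A> c) (rt1 \<A> d)"
  define \<phi> where "\<phi> = transition c d"
  obtain t x v where zz: "z = (t, x, v)" and x: "x \<in> overlap c d"
    using z overlap_rt1[OF c d] by (cases z) auto
  have W: "open (overlap c d)" "smooth_on (overlap c d) \<phi>"
    using open_overlap[OF c d] smooth_transition[OF c d] by (auto simp: \<phi>_def)
  define S where "S = (UNIV :: real set) \<times> overlap c d \<times> (UNIV :: 'm rn set)"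
  have S: "open S" unfolding S_def by (intro open_Times open_UNIV W)
  have zS: "z \<in> S" by (simp add: zz S_def x)
  have tr: "transition (rt1 \<A> c) (rt1 \<A> d) y = (fst y, \<phi> (fst (snd y)), pd \<phi> (fst (snd y)) (snd (snd y)))" if "y \<in> S" for y
    using that transition_rt1[OF c d] by (auto simp: S_def \<phi>_def)
  have "((\<lambda>y. (fst y, \<phi> (fst (snd y)), pd \<phi> (fst (snd y)) (snd (snd y)))) has_derivative
      (\<lambda>h. (fst h, pd \<phi> x (fst (snd h)), pd (dlift \<phi>) (x, v) (snd h)))) (at z)"
  proof (rule has_derivative_Pair)
    have "(snd has_derivative snd) (at z)" by (auto intro!: derivative_eq_intros)
    from diff_chain_at[OF this] has_derivative_velocity_map[OF W x, of v]
    show "((\<lambda>y. (\<phi> (fst (snd y)), pd \<phi> (fst (snd y)) (snd (snd y)))) has_derivative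
      (\<lambda>h. (pd \<phi> x (fst (snd h)), pd (dlift \<phi>) (x, v) (snd h)))) (at z)"
      by (fastforce simp: o_def zz)
  qed (auto intro!: derivative_eq_intros)
  then have "(transition (rt1 \<A> c) (rt1 \<A> d) has_derivative
      (\<lambda>h. (fst h, pd \<phi> x (fst (snd h)), pd (dlift \<phi>) (x, v) (snd h)))) (at z)"
    using has_derivative_cong_open[OF S zS, of "transition (rt1 \<A> c) (rt1 \<A> d)"
        "\<lambda>y. (fst y, \<phi> (fst (snd y)), pd \<phi> (fst (snd y)) (snd (snd y)))"] tr by blast
  then have D: "frechet_derivative (transition (rt1 \<A> c) (rt1 \<A> d)) (at z)
      = (\<lambda>h. (fst h, pd \<phi> x (fst (snd h)), pd (dlift \<phi>) (x, v) (snd h)))"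
    by (rule frechet_derivative_at[symmetric])
  have xc: "x \<in> chart_image c" by (rule subsetD[OF overlap_subset x])
  have xd: "\<phi> x \<in> chart_image d"
    unfolding \<phi>_def by (rule subsetD[OF overlap_subset transition_in_overlap[OF c x]])
  obtain \<tau> \<xi> \<eta> where Y: "Y = (\<tau>, \<xi>, \<eta>)" by (cases Y) auto
  show "\<alpha> c z Y = \<alpha> d (transition (rt1 \<A> c) (rt1 \<A> d) z) (frechet_derivative (transition (rt1 \<A> c) (rt1 \<A> d)) (at z) Y)"
    unfolding D tr[OF zS] using pd_en_transform(1)[OF c d x, of v "(\<xi>, \<eta>)"] pd_en_transform(2)[OF c d x, of v \<xi>]
    by (simp add: zz Y \<alpha>[OF c xc] \<alpha>[OF d xd] \<phi>_def[symmetric])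
qed

lemma form1_mu0: "form1 (rt1 \<A>) \<A> (mu0 A0 B0)"
  by (rule form1_energy[where p = "- 1 / k" and q = 0]) (simp add: mu0_eq del: mu0.simps)

lemma form1_kappa: "form1 (rt1 \<A>) \<A> (kappa B0)"
  by (rule form1_energy[where p = 0 and q = r]) (simp add: kappa_eq)

text \<open>The Lagrange function of the horizontalization of the sum of the two forms, by \<open>hor_eq\<close> below.\<close>

definition lagrange_fun where
  "lagrange_fun c = (\<lambda>(t, x, v, a). - 1 / k * (t * pd (en c) (x, v) (v, a)) + r * k * en c (x, v))"

lemma r_k_difference: "r * k - - 1 / k = r"
  using k by (simp add: r divide_simps)

lemma lagrange_function_total:
  assumes c: "c \<in> \<A>"
    and L: "\<And>t x v a. x \<in> chart_image c \<Longrightarrow> L (t, x, v, a) = s * (t * pd (en c) (x, v) (v, a)) + q * en c (x, v)"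
    and "q - s = r"
  shows "lagrange_function \<A> c (e c) L"
proof -
  have S: "open (UNIV \<times> chart_image c \<times> UNIV \<times> UNIV :: ('m coords2) set)"
    by (intro open_Times open_UNIV open_chart_image c)
  have "smooth_on (UNIV \<times> chart_image c \<times> UNIV \<times> UNIV)
      (\<lambda>z. s * (fst z * pd (en c) (fst (snd z), fst (snd (snd z))) (snd (snd z))) + q * en c (fst (snd z), fst (snd (snd z))))"
    by (intro smooth_on_add smooth_on_mult smooth_on_const S smooth_on_fst smooth_on_snd smooth_on_ident smooth_on_Pair
        smooth_on_pd_compose[OF S smooth_en[OF c]] smooth_on_compose_UNIV[OF S smooth_en[OF c]];
        simp add: mem_Times_iff)
  then have "smooth_on (UNIV \<times> chart_image c \<times> UNIV \<times> UNIV) L"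
    using smooth_on_cong[OF S, of L "\<lambda>z. s * (fst z * pd (en c) (fst (snd z), fst (snd (snd z))) (snd (snd z))) + q * en c (fst (snd z), fst (snd (snd z)))"]
    by (auto simp: L)
  moreover have "e c (x, v, a) $ i = euler_lagrange i L (t, x, v, a, b, w)" if "x \<in> chart_image c" for t x v a b w i
    using euler_lagrange_total[OF open_chart_image[OF c] smooth_en[OF c] that L] e_formula[OF c that] assms(3) by simp
  ultimately show ?thesis unfolding lagrange_function_def chart_image_rt2[OF c] by auto
qed

lemma hor_eq:
  assumes c: "c \<in> \<A>" and x: "x \<in> chart_image c"
  shows "hor (\<lambda>c z Y. mu0 A0 B0 c z Y + kappa B0 c z Y) c (t, x, v, a) Y = lagrange_fun c (t, x, v, a) * fst Y"
proof -
  obtain \<tau> \<xi> \<eta> \<zeta> where Y: "Y = (\<tau>, \<xi>, \<eta>, \<zeta>)" by (cases Y) auto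
  have xT: "(x, v) \<in> chart_image c \<times> UNIV" using x by simp
  note dif = smooth_on_differentiable[OF smooth_en[OF c] xT]
  have 0: "pd (en c) (x, v) (0, 0) = 0" using linear_0[OF linear_pd[OF dif]] by (simp add: zero_prod_def)
  have 1: "(\<Sum>i\<in>UNIV. (p * pd (en c) (x, v) (axis i 1, 0) + q * pd (en c) (x, v) (0, axis i 1)) * (v $ i * \<tau>))
      = (p * pd (en c) (x, v) (v, 0) + q * pd (en c) (x, v) (0, v)) * \<tau>" for p q
    unfolding pd_expand_fst[OF dif, of v, symmetric] pd_expand_snd[OF dif, of v, symmetric]
    by (simp add: sum_distrib_left sum_distrib_right sum.distrib algebra_simps)
  have 2: "(\<Sum>i\<in>UNIV. (p * pd (en c) (x, v) (0, axis i 1)) * (a $ i * \<tau>)) = p * pd (en c) (x, v) (0, a) * \<tau>" for p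
    unfolding pd_expand_snd[OF dif, of a, symmetric]
    by (simp add: sum_distrib_left sum_distrib_right algebra_simps)
  have "hor (\<lambda>c z Y. mu0 A0 B0 c z Y + kappa B0 c z Y) c (t, x, v, a) Y
      = (- (t / k) * pd (en c) (x, v) (v, 0) + r * pd (en c) (x, v) (0, v)) * \<tau> + - (t / k) * pd (en c) (x, v) (0, a) * \<tau>"
    unfolding Y hor.simps mu0_eq[OF c x] kappa_eq[OF c x] 0 1 by (simp add: 2[of "- (t / k)", simplified])
  then show ?thesis
    unfolding lagrange_fun_def prod.case pd_split[OF dif, of v a] euler_en[OF c x] by (simp add: Y algebra_simps)
qed

lemma lagrange_fun_transform:
  assumes "c \<in> \<A>" "d \<in> \<A>" "x \<in> overlap c d"
  shows "lagrange_fun c (t, x, v, a) = lagrange_fun d (transition (rt2 \<A> c) (rt2 \<A> d) (t, x, v, a))"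
  unfolding transition_rt2[OF assms] lagrange_fun_def prod.case pd_en_transform(1)[OF assms, of v "(v, a)"] en_invariant[OF assms, of v]
  by simp

lemma global_lagrangian_hor: "global_lagrangian \<A> e (hor (\<lambda>c z Y. mu0 A0 B0 c z Y + kappa B0 c z Y))"
proof -
  define lam where "lam = hor (\<lambda>c z Y. mu0 A0 B0 c z Y + kappa B0 c z Y)"
  have lam: "lam c z Y = lagrange_fun c z * fst Y" if "c \<in> \<A>" "z \<in> chart_image (rt2 \<A> c)" for c z Y
    using that hor_eq[OF that(1)] chart_image_rt2[OF that(1)] by (cases z) (auto simp: lam_def)
  have L: "lagrange_function \<A> c (e c) (lagrange_fun c)" if "c \<in> \<A>" for c
    by (rule lagrange_function_total[OF that _ r_k_difference]) (simp add: lagrange_fun_def)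
  have "form1 (rt2 \<A>) \<A> lam"
    unfolding form1_def
  proof (intro conjI ballI allI)
    fix c assume c: "c \<in> \<A>"
    have S: "open (chart_image (rt2 \<A> c))"
      unfolding chart_image_rt2[OF c] by (intro open_Times open_UNIV open_chart_image c)
    show "linear (lam c z)" if "z \<in> chart_image (rt2 \<A> c)" for z
      by (rule linearI) (simp_all add: lam[OF c that] algebra_simps)
    show "smooth_on (chart_image (rt2 \<A> c)) (\<lambda>z. lam c z Y)" for Y
    proof -
      have "smooth_on (chart_image (rt2 \<A> c)) (\<lambda>z. lagrange_fun c z * fst Y)"
        using L[OF c] by (intro smooth_on_mult smooth_on_const S) (simp add: lagrange_function_def)
      then show ?thesis using smooth_on_cong[OF S, of "\<lambda>z. lam c z Y" "\<lambda>z. lagrange_fun c z * fst Y"] lam[OF c] by simp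
    qed
  next
    fix c d and z Y :: "'m coords2"
    assume c: "c \<in> \<A>" and d: "d \<in> \<A>" and z: "z \<in> overlap (rt2 \<A> c) (rt2 \<A> d)"
    obtain t x v a where zz: "z = (t, x, v, a)" and x: "x \<in> overlap c d"
      using z overlap_rt2[OF c d] by (cases z) auto
    have "z \<in> chart_image (rt2 \<A> c)" using subsetD[OF overlap_subset x] by (simp add: zz chart_image_rt2[OF c])
    moreover have "transition (rt2 \<A> c) (rt2 \<A> d) z \<in> chart_image (rt2 \<A> d)"
      using subsetD[OF overlap_subset transition_in_overlap[OF c x]]
      by (simp add: zz chart_image_rt2[OF d] transition_rt2[OF c d x])
    ultimately show "lam c z Y = lam d (transition (rt2 \<A> c) (rt2 \<A> d) z) (frechet_derivative (transition (rt2 \<A> c) (rt2 \<A> d)) (at z) Y)"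
      using lagrange_fun_transform[OF c d x] transition_rt2_derivative(1)[OF c d x]
      by (simp add: lam[OF c] lam[OF d] zz)
  qed
  then show ?thesis unfolding global_lagrangian_def lam_def[symmetric] using lam L by blast
qed

text \<open>The value at a jet is computed in an arbitrarily chosen chart around its base point; by the
  invariance of the energy the choice does not matter.\<close>

lemma globally_variational: "globally_variational \<A> e"
proof -
  define ch where "ch = (\<lambda>j. SOME d. d \<in> \<A> \<and> j \<in> jets_over \<A> 1 (fst d))"
  define L where "L = (\<lambda>(t :: real, j). r * en (ch j) (jet_coord (ch j) 0 j, jet_coord (ch j) 1 j))"
  have L: "L (chart_inv (rt1 \<A> c) (t, x, v)) = r * en c (x, v)" if c: "c \<in> \<A>" and x: "x \<in> chart_image c" for c t x v
  proof -
    obtain \<gamma> where g: "smooth_curve \<A> \<gamma>" "\<gamma> 0 \<in> fst c" "chart_inv (rt1 \<A> c) (t, x, v) = (t, jet \<A> 1 \<gamma>)"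
      "curve_coord c 0 \<gamma> = x" "curve_coord c 1 \<gamma> = v"
      by (rule rt1_inv[OF c x])
    define d where "d = ch (jet \<A> 1 \<gamma>)"
    have "c \<in> \<A> \<and> jet \<A> 1 \<gamma> \<in> jets_over \<A> 1 (fst c)" using c g by (simp add: jet_in_jets_over)
    then have "d \<in> \<A> \<and> jet \<A> 1 \<gamma> \<in> jets_over \<A> 1 (fst d)"
      unfolding d_def ch_def by (rule someI[of "\<lambda>d. d \<in> \<A> \<and> jet \<A> 1 \<gamma> \<in> jets_over \<A> 1 (fst d)"])
    then have d: "d \<in> \<A>" "\<gamma> 0 \<in> fst d" using jet_in_jets_over[OF g(1)] by auto
    have "x \<in> overlap c d" using mem_overlap_iff[OF c g(2), of d] d(2) g(4) by (simp add: curve_coord_0)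
    from en_invariant[OF c d(1) this, of v]
    have "en c (x, v) = en d (curve_coord d 0 \<gamma>, curve_coord d 1 \<gamma>)"
      using curve_coord_transition(1,2)[OF g(1) c d(1) g(2) d(2)] g(4,5) by simp
    moreover have "jet_coord d 0 (jet \<A> 1 \<gamma>) = curve_coord d 0 \<gamma>" "jet_coord d 1 (jet \<A> 1 \<gamma>) = curve_coord d 1 \<gamma>"
      by (rule jet_coord_jet[OF g(1) d]; simp)+
    ultimately show ?thesis unfolding g(3) L_def prod.case d_def[symmetric] by simp
  qed
  show ?thesis
    unfolding globally_variational_def
  proof (intro exI[of _ L] ballI conjI)
    fix c assume c: "c \<in> \<A>"
    have S: "open (UNIV \<times> chart_image c \<times> UNIV :: ('m coords1) set)"
      by (intro open_Times open_UNIV open_chart_image c)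
    have "smooth_on (UNIV \<times> chart_image c \<times> UNIV) (\<lambda>z :: 'm coords1. r * en c (snd z))"
      by (intro smooth_on_mult smooth_on_const S smooth_on_compose_UNIV[OF S smooth_en[OF c]] smooth_on_snd smooth_on_ident) auto
    then show "smooth_on (chart_image (rt1 \<A> c)) (L \<circ> chart_inv (rt1 \<A> c))"
      unfolding chart_image_rt1[OF c]
      using smooth_on_cong[OF S, of "L \<circ> chart_inv (rt1 \<A> c)" "\<lambda>z. r * en c (snd z)"] L[OF c] by auto
    show "lagrange_function \<A> c (e c) (\<lambda>(t, x, v, a). L (chart_inv (rt1 \<A> c) (t, x, v)))"
      by (rule lagrange_function_total[OF c, of _ 0 r]) (simp_all add: L[OF c])
  qed
qed

end

theorem theorem14:
  fixes X :: "'p topology"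
    and \<A> :: "('p, real ^ 'm::{finite,linorder}) chart set"
    and k :: real
  assumes "smooth_manifold X \<A>"
    and "CARD('m) \<ge> 2"
    and "k \<noteq> 0" and "k \<noteq> 1"
    and "source_form \<A> \<epsilon> e"
    and "locally_variational X \<A> e"
    and "homogeneous_coeffs \<A> k e"
  shows "globally_variational \<A> e \<and>
    (\<exists>A B. affine_coeffs \<A> e A B \<and>
       form1 (rt1 \<A>) \<A> (mu0 A B) \<and>
       form1 (rt1 \<A>) \<A> (kappa B) \<and>
       global_lagrangian \<A> e (hor (\<lambda>c z Y. mu0 A B c z Y + kappa B c z Y)))"
proof -
  interpret homogeneous_variational X \<A> k "- 1 / (k * (k - 1))" \<epsilon> e
    using assms by unfold_locales auto
  show ?thesis
    using globally_variational affine_A0_B0 form1_mu0 form1_kappa global_lagrangian_hor by blast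
qed

end
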